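(* There is a constant $\gamma<\infty$ such that for every $\mathbf f\in L^3_\#(\mathbb T^3,\mathbb R^3)$ the equation $\mathrm{curl}\,U=\mathbf f$ admits a solution $U\in L^\infty\cap\dot W^{1,3}(\mathbb T^3,\mathbb R^3)$ with $$\|U\|_{L^\infty\cap\dot W^{1,3}(\mathbb T^3,\mathbb R^3)}\le\gamma\,\|\mathbf f\|_{L^3(\mathbb T^3,\mathbb R^3)},$$ which can be constructed by the (nonlinear) hierarchical expansion $U=\sum_{j=1}^\infty\mathbf u_j$, $$\mathbf u_{j+1}=\mathop{\mathrm{arg\,min}}_{\mathbf u}\Big\{\|\mathbf u\|_{L^\infty\cap\dot W^{1,3}}+\lambda_1 2^{j}\Big\|\mathbf f-\mathrm{curl}\Big(\sum_{k=1}^{j}\mathbf u_k+\mathbf u\Big)\Big\|_{L^3(\mathbb T^3,\mathbb R^3)}^3\Big\},\qquad j=0,1,2,\dots,$$ with a suitable, sufficiently large $\lambda_1\ge\frac{\beta}{3}\|\mathbf f\|_{L^3(\mathbb T^3,\mathbb R^3)}^{-2}$.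
   Context: $\mathbb T^3$ is the three-dimensional torus and $L^3_\#(\mathbb T^3,\mathbb R^3)$ is the subspace of $L^3(\mathbb T^3,\mathbb R^3)$ of divergence-free vector fields with zero mean; for $\mathbf f=0$ the condition on $\lambda_1$ is read as $\lambda_1>0$. $L^\infty\cap\dot W^{1,3}$ carries the usual norm of an intersection space, e.g. $\|\mathbf u\|_{L^\infty}+\|\nabla\mathbf u\|_{L^3}$. $\beta>0$ denotes a constant for which the (known, Bourgain–Brezis) estimate $$\|\mathbf g\|_{L^{3/2}(\mathbb T^3,\mathbb R^3)}\le\beta\,\|\mathrm{curl}\,\mathbf g\|_{L^1+\dot W^{-1,3/2}(\mathbb T^3,\mathbb R^3)}\qquad\text{for all }\mathbf g\in L^{3/2}(\mathbb T^3,\mathbb R^3)\text{ with }\mathrm{div}\,\mathbf g=0,\ \overline{\mathbf g}=0$$ holds, where $\overline{\mathbf g}$ is the average of $\mathbf g$ and the norm on the sum space is the infimum of $\|a\|_{L^1}+\|b\|_{\dot W^{-1,3/2}}$ over decompositions $\mathrm{curl}\,\mathbf g=a+b$. An empty sum $\sum_{k=1}^0$ is $0$. *)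

theory Defs
  imports "HOL-Analysis.Analysis" "HOL-Probability.Essential_Supremum"
begin

(* Functions on the torus R^3/Z^3 are represented by Z^3-periodic functions on real^3; integrals
   are taken over the fundamental cell, which has volume 1.  The elements of the function spaces
   below are functions, not classes, so equality in these spaces is equality almost everywhere. *)

abbreviation torus :: "(real^3) measure" where
  "torus \<equiv> lebesgue_on (cbox 0 1)"

definition periodic :: "(real^3 \<Rightarrow> 'a) \<Rightarrow> bool" where
  "periodic u \<longleftrightarrow> (\<forall>x i. u (x + axis i 1) = u x)"

definition Lp :: "real \<Rightarrow> (real^3 \<Rightarrow> 'a::euclidean_space) set" where
  "Lp p = {u. u \<in> borel_measurable lebesgue \<and> periodic u \<and>
              integrable torus (\<lambda>x. norm (u x) powr p)}"

definition Lp_norm :: "real \<Rightarrow> (real^3 \<Rightarrow> 'a::euclidean_space) \<Rightarrow> real" where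
  "Lp_norm p u = (LINT x|torus. norm (u x) powr p) powr (1 / p)"

definition Linf :: "(real^3 \<Rightarrow> 'a::euclidean_space) set" where
  "Linf = {u. u \<in> borel_measurable lebesgue \<and> periodic u \<and>
              esssup torus (\<lambda>x. ereal (norm (u x))) < \<infinity>}"

definition Linf_norm :: "(real^3 \<Rightarrow> 'a::euclidean_space) \<Rightarrow> real" where
  "Linf_norm u = real_of_ereal (esssup torus (\<lambda>x. ereal (norm (u x))))"

definition partial :: "3 \<Rightarrow> (real^3 \<Rightarrow> 'a::real_normed_vector) \<Rightarrow> real^3 \<Rightarrow> 'a" where
  "partial i u x = frechet_derivative u (at x) (axis i 1)"

primrec Ck :: "nat \<Rightarrow> (real^3 \<Rightarrow> 'a::real_normed_vector) \<Rightarrow> bool" where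
  "Ck 0 u \<longleftrightarrow> continuous_on UNIV u"
| "Ck (Suc k) u \<longleftrightarrow> (\<forall>x. u differentiable (at x)) \<and> (\<forall>i. Ck k (partial i u))"

definition test_functions :: "(real^3 \<Rightarrow> 'a::real_normed_vector) set" where
  "test_functions = {\<phi>. periodic \<phi> \<and> (\<forall>k. Ck k \<phi>)}"

(* G x $ i $ j stands for the j-th partial derivative of the i-th component, as in jacobian. *)
definition has_weak_gradient :: "(real^3 \<Rightarrow> real^3) \<Rightarrow> (real^3 \<Rightarrow> real^3^3) \<Rightarrow> bool" where
  "has_weak_gradient u G \<longleftrightarrow> u \<in> Lp 1 \<and> G \<in> Lp 1 \<and>
     (\<forall>\<phi> \<in> test_functions. \<forall>i j.
        (LINT x|torus. u x $ i * partial j \<phi> x) = - (LINT x|torus. G x $ i $ j * \<phi> x))"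

(* Determined only up to null sets; meaningful only for fields that have a weak gradient. *)
definition weak_gradient :: "(real^3 \<Rightarrow> real^3) \<Rightarrow> real^3 \<Rightarrow> real^3^3" where
  "weak_gradient u = (SOME G. has_weak_gradient u G)"

(* The homogeneous space: only the gradient is measured in L^3, see X_norm. *)
definition W13 :: "(real^3 \<Rightarrow> real^3) set" where
  "W13 = {u. \<exists>G. has_weak_gradient u G \<and> G \<in> Lp 3}"

definition X_norm :: "(real^3 \<Rightarrow> real^3) \<Rightarrow> real" where
  "X_norm u = Linf_norm u + Lp_norm 3 (weak_gradient u)"

definition curl_of_gradient :: "real^3^3 \<Rightarrow> real^3" where
  "curl_of_gradient G = vector [G$3$2 - G$2$3, G$1$3 - G$3$1, G$2$1 - G$1$2]"

definition weak_curl :: "(real^3 \<Rightarrow> real^3) \<Rightarrow> real^3 \<Rightarrow> real^3" where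
  "weak_curl u x = curl_of_gradient (weak_gradient u x)"

definition div_free :: "(real^3 \<Rightarrow> real^3) \<Rightarrow> bool" where
  "div_free g \<longleftrightarrow>
     (\<forall>\<phi> \<in> test_functions. (LINT x|torus. (\<Sum>i\<in>UNIV. g x $ i * partial i \<phi> x)) = 0)"

definition Lp_sharp :: "real \<Rightarrow> (real^3 \<Rightarrow> real^3) set" where
  "Lp_sharp p = {g \<in> Lp p. div_free g \<and> (LINT x|torus. g x) = 0}"

(* Vector-valued distributions are functionals on smooth periodic fields; values on other
   arguments are irrelevant.  The curl is formally self-adjoint, hence no sign here. *)
definition distr_curl :: "(real^3 \<Rightarrow> real^3) \<Rightarrow> (real^3 \<Rightarrow> real^3) \<Rightarrow> real" where
  "distr_curl g \<Phi> = (LINT x|torus. g x \<bullet> curl_of_gradient (jacobian \<Phi> (at x)))"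

(* The dual of the homogeneous space W^{1,3}, in which smooth fields are dense. *)
definition Wm :: "((real^3 \<Rightarrow> real^3) \<Rightarrow> real) set" where
  "Wm = {b.
     (\<forall>\<Phi> \<in> test_functions. \<forall>\<Psi> \<in> test_functions. b (\<lambda>x. \<Phi> x + \<Psi> x) = b \<Phi> + b \<Psi>) \<and>
     (\<forall>\<Phi> \<in> test_functions. \<forall>c. b (\<lambda>x. c *\<^sub>R \<Phi> x) = c * b \<Phi>) \<and>
     (\<exists>C. \<forall>\<Phi> \<in> test_functions. \<bar>b \<Phi>\<bar> \<le> C * Lp_norm 3 (\<lambda>x. jacobian \<Phi> (at x)))}"

definition Wm_norm :: "((real^3 \<Rightarrow> real^3) \<Rightarrow> real) \<Rightarrow> real" where
  "Wm_norm b = (SUP \<Phi> \<in> {\<Phi> \<in> test_functions. Lp_norm 3 (\<lambda>x. jacobian \<Phi> (at x)) \<le> 1}. \<bar>b \<Phi>\<bar>)"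

definition sum_norm :: "((real^3 \<Rightarrow> real^3) \<Rightarrow> real) \<Rightarrow> real" where
  "sum_norm T = Inf {Lp_norm 1 a + Wm_norm b | a b. a \<in> Lp 1 \<and> b \<in> Wm \<and>
     (\<forall>\<Phi> \<in> test_functions. T \<Phi> = (LINT x|torus. a x \<bullet> \<Phi> x) + b \<Phi>)}"

(* For g in L^{3/2} the set whose infimum is taken in sum_norm is nonempty: take a = 0. *)
definition bourgain_brezis :: "real \<Rightarrow> bool" where
  "bourgain_brezis \<beta> \<longleftrightarrow>
     (\<forall>g \<in> Lp_sharp (3/2). Lp_norm (3/2) g \<le> \<beta> * sum_norm (distr_curl g))"

(* The minimizers need not be unique, so u is any sequence of successive minimizers.
   The sequence starts with u 1; the value u 0 is not used. *)
definition hierarchical ::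
    "(real^3 \<Rightarrow> real^3) \<Rightarrow> real \<Rightarrow> (nat \<Rightarrow> real^3 \<Rightarrow> real^3) \<Rightarrow> bool" where
  "hierarchical f lam1 u \<longleftrightarrow>
     (\<forall>j. is_arg_min
        (\<lambda>v. X_norm v + lam1 * 2 ^ j *
               Lp_norm 3 (\<lambda>x. f x - weak_curl (\<lambda>y. (\<Sum>k=1..j. u k y) + v y) x) ^ 3)
        (\<lambda>v. v \<in> Linf \<inter> W13) (u (Suc j)))"

definition series_converges_to :: "(nat \<Rightarrow> real^3 \<Rightarrow> real^3) \<Rightarrow> (real^3 \<Rightarrow> real^3) \<Rightarrow> bool" where
  "series_converges_to u U \<longleftrightarrow> (\<lambda>n. X_norm (\<lambda>x. (\<Sum>k=1..n. u k x) - U x)) \<longlonglongrightarrow> 0"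

end

(* The curl maps X, the intersection of L^inf and W^{1,3}, onto L^3_#, with a bounded right inverse:
   for f in L^3_# the functional that sends curl g to the integral of f . g is bounded, by the
   Bourgain-Brezis estimate, in the norm of L^1 + W^{-1,3/2}. A norm preserving extension (up to a factor)
   is given by a pair (U, G) that lies in the dual space, so U is bounded and G is in L^3. Testing it with
   representations of 0 shows that G is the gradient of U, and testing it with f - curl U shows
   curl U = f. The extension is found by projecting in L^2 instead of using the Hahn-Banach theorem.

   Let the constant of this inverse be c and let r_j be the residual after j steps, with weight
   lambda_j = lambda_1 2^{j-1} in step j. Comparing the minimizer u_j with a solution of curl h = r_{j-1} gives
   |u_j|_X <= c |r_{j-1}|, and comparing it with u_j + h, where curl h = r_j, gives
   lambda_j |r_j|^2 <= c. Hence the residuals, and with them the u_j, decay geometrically. *)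
theory Submission
  imports Defs "HOL-Probability.Probability_Measure"
begin

text \<open>The obstacle is that neither L^1 + W^{-1,3/2} nor X carries a norm from an inner
  product, so shortest elements are out of reach there. On a cell of volume 1 the L^2 norm dominates
  those of L^1 and L^{3/2}. Curls of L^3 fields are represented by pairs (a, B) in L^2, and the
  split norm is a continuous convex function of the pair. A gap in the split norm between a level
  set and a ball of half the critical radius is then a gap in L^2, where a separating vector exists;
  the halved radius is the factor 2 that is lost. The two norms in X each receive the bound 2
  \<beta> |f|, which gives c = 4 \<beta>.

  Minimizers are found by the same device. Almost minimal pairs (v, grad v) form shrinking convex
  sets in L^2, their almost shortest elements converge strongly, and the energy is lower
  semicontinuous under almost everywhere convergence.

  In the decay, |r_j| is at most a multiple of 2^{-j/2}. The choice lambda_1 \<ge> c / |f|^2 makes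
  the first of these bounds at most |f|, so the resulting constant depends neither on f nor on
  lambda_1.\<close>

interpretation torus: prob_space torus
proof
  show "emeasure torus (space torus) = 1"
    using content_cbox_cart[of "0::real^3" 1]
    by (simp add: emeasure_restrict_space space_restrict_space emeasure_eq_measure2 interval_eq_empty_cart)
qed

section \<open>Periodic measurable functions\<close>

definition periodic_measurable :: "(real^3 \<Rightarrow> 'a::euclidean_space) set" where
  "periodic_measurable = {u. u \<in> borel_measurable lebesgue \<and> periodic u}"

lemma periodic_measurable_torus [measurable_dest]:
  "u \<in> periodic_measurable \<Longrightarrow> u \<in> borel_measurable torus"
  by (auto simp: periodic_measurable_def intro: measurable_restrict_space1)

lemma periodic_measurable_compose:
  "h \<in> borel_measurable borel \<Longrightarrow> u \<in> periodic_measurable \<Longrightarrow> (\<lambda>x. h (u x)) \<in> periodic_measurable"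
  by (auto simp: periodic_measurable_def periodic_def)

lemma periodic_measurable_const [simp]: "(\<lambda>x. c) \<in> periodic_measurable"
  by (auto simp: periodic_measurable_def periodic_def)

lemma periodic_measurable_add:
  "u \<in> periodic_measurable \<Longrightarrow> v \<in> periodic_measurable \<Longrightarrow> (\<lambda>x. u x + v x) \<in> periodic_measurable"
  by (auto simp: periodic_measurable_def periodic_def)

lemma periodic_measurable_diff:
  "u \<in> periodic_measurable \<Longrightarrow> v \<in> periodic_measurable \<Longrightarrow> (\<lambda>x. u x - v x) \<in> periodic_measurable"
  by (auto simp: periodic_measurable_def periodic_def)

lemma periodic_measurable_scaleR:
  "u \<in> periodic_measurable \<Longrightarrow> v \<in> periodic_measurable \<Longrightarrow> (\<lambda>x. u x *\<^sub>R v x) \<in> periodic_measurable"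
  by (auto simp: periodic_measurable_def periodic_def)

lemma periodic_measurable_linear:
  fixes h :: "'a::euclidean_space \<Rightarrow> 'b::euclidean_space"
  assumes "linear h" "u \<in> periodic_measurable"
  shows "(\<lambda>x. h (u x)) \<in> periodic_measurable"
  by (rule periodic_measurable_compose)
     (use assms in \<open>auto intro: borel_measurable_continuous_onI linear_continuous_on linear_conv_bounded_linear[THEN iffD1]\<close>)

text \<open>\<open>lim\<close> is a total function, so translating the argument by a period leaves
  the whole sequence, and with it the chosen value, unchanged even where the sequence diverges.
  Limits found almost everywhere thus have representatives that are periodic at every point.\<close>

lemma periodic_measurable_lim:
  assumes "\<And>n. u n \<in> periodic_measurable"
  shows "(\<lambda>x. lim (\<lambda>n. u n x)) \<in> periodic_measurable"
proof -
  have "(\<lambda>n. u n (x + axis i 1)) = (\<lambda>n. u n x)" for x i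
    using assms by (auto simp: periodic_measurable_def periodic_def)
  then show ?thesis
    using assms by (auto simp: periodic_measurable_def periodic_def intro: borel_measurable_lim_metric)
qed

subsection \<open>Lebesgue spaces on the torus\<close>

lemma Lp_iff:
  "u \<in> Lp p \<longleftrightarrow> u \<in> periodic_measurable \<and> integrable torus (\<lambda>x. norm (u x) powr p)"
  by (auto simp: Lp_def periodic_measurable_def)

lemma Lp_measurable: "u \<in> Lp p \<Longrightarrow> u \<in> periodic_measurable"
  by (simp add: Lp_iff)

lemma Lp_integrable: "u \<in> Lp p \<Longrightarrow> integrable torus (\<lambda>x. norm (u x) powr p)"
  by (simp add: Lp_iff)

lemma Lp_norm_nonneg [simp]: "Lp_norm p u \<ge> 0"
  by (simp add: Lp_norm_def)

lemma Lp_norm_powr: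
  "p > 0 \<Longrightarrow> Lp_norm p u powr p = (LINT x|torus. norm (u x) powr p)"
  by (simp add: Lp_norm_def powr_powr)

lemma Lp_norm_leI:
  assumes "p > 0" "(LINT x|torus. norm (u x) powr p) \<le> C powr p" "C \<ge> 0"
  shows "Lp_norm p u \<le> C"
proof -
  have "Lp_norm p u \<le> (C powr p) powr (1/p)"
    unfolding Lp_norm_def using assms by (intro powr_mono2) auto
  then show ?thesis using assms by (simp add: powr_powr)
qed

lemma Lp_dominated:
  assumes p: "p > 0" and u: "u \<in> periodic_measurable" and v: "v \<in> Lp p"
    and le: "AE x in torus. norm (u x) \<le> norm (v x)"
  shows "u \<in> Lp p" and "Lp_norm p u \<le> Lp_norm p v"
proof -
  have le': "AE x in torus. norm (u x) powr p \<le> norm (v x) powr p"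
    using le by eventually_elim (use p in \<open>auto intro: powr_mono2\<close>)
  have [measurable]: "u \<in> borel_measurable torus" using u by measurable
  show L: "u \<in> Lp p"
    unfolding Lp_iff
    using u le' by (auto intro!: Bochner_Integration.integrable_bound[OF Lp_integrable[OF v]])
  show "Lp_norm p u \<le> Lp_norm p v"
    unfolding Lp_norm_def
    by (intro powr_mono2 integral_mono_AE Lp_integrable L v le') (use p in auto)
qed

lemma Lp_cong_AE:
  assumes "p > 0" "u \<in> periodic_measurable" "v \<in> Lp p" "AE x in torus. u x = v x"
  shows "u \<in> Lp p" "Lp_norm p u = Lp_norm p v"
proof -
  have 1: "AE x in torus. norm (u x) \<le> norm (v x)" "AE x in torus. norm (v x) \<le> norm (u x)"
    using assms(4) by (eventually_elim, simp)+
  show u: "u \<in> Lp p" by (rule Lp_dominated(1)[OF assms(1-3) 1(1)])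
  show "Lp_norm p u = Lp_norm p v"
    using Lp_dominated(2)[OF assms(1-3) 1(1)]
      Lp_dominated(2)[OF assms(1) Lp_measurable[OF assms(3)] u 1(2)] by simp
qed

lemma Lp_bounded:
  assumes "p > 0" "u \<in> periodic_measurable" "AE x in torus. norm (u x) \<le> C"
  shows "u \<in> Lp p" "Lp_norm p u \<le> C"
proof -
  have "C \<ge> 0"
  proof (rule ccontr)
    assume "\<not> C \<ge> 0"
    have "AE x in torus. False"
      using assms(3) by eventually_elim (use \<open>\<not> C \<ge> 0\<close> norm_ge_zero order_trans in blast)
    then show False by simp
  qed
  have C: "(\<lambda>x::real^3. C) \<in> Lp p" by (auto simp: Lp_iff)
  have "AE x in torus. norm (u x) \<le> norm C" using assms(3) \<open>C \<ge> 0\<close> by auto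
  note * = Lp_dominated[OF assms(1,2) C this]
  show "u \<in> Lp p" by fact
  have "Lp_norm p (\<lambda>x::real^3. C) = C"
    using assms(1) \<open>C \<ge> 0\<close> torus.prob_space by (simp add: Lp_norm_def powr_powr)
  with * show "Lp_norm p u \<le> C" by simp
qed

lemma Lp_zero [simp]: "(\<lambda>x. 0) \<in> Lp p" "p > 0 \<Longrightarrow> Lp_norm p (\<lambda>x. 0) = 0"
  by (auto simp: Lp_iff Lp_norm_def)

lemma Lp_scaleR:
  assumes "u \<in> Lp p"
  shows "(\<lambda>x. c *\<^sub>R u x) \<in> Lp p" and "p > 0 \<Longrightarrow> Lp_norm p (\<lambda>x. c *\<^sub>R u x) = \<bar>c\<bar> * Lp_norm p u"
proof -
  have [simp]: "norm (c *\<^sub>R u x) powr p = \<bar>c\<bar> powr p * norm (u x) powr p" for x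
    by (simp add: powr_mult)
  show "(\<lambda>x. c *\<^sub>R u x) \<in> Lp p"
    using assms periodic_measurable_scaleR[OF periodic_measurable_const, of u c]
    unfolding Lp_iff by (simp del: norm_scaleR)
  show "Lp_norm p (\<lambda>x. c *\<^sub>R u x) = \<bar>c\<bar> * Lp_norm p u" if "p > 0"
    using that by (simp add: Lp_norm_def powr_mult powr_powr del: norm_scaleR)
qed

lemma Lp_norm_eq_0_iff:
  assumes "p > 0" "u \<in> Lp p"
  shows "Lp_norm p u = 0 \<longleftrightarrow> (AE x in torus. u x = 0)"
  using integral_nonneg_eq_0_iff_AE[OF Lp_integrable[OF assms(2)]] assms
  by (auto simp: Lp_norm_def)

text \<open>Convexity of the power at a / s and b / t with weights s / (s + t) and t / (s + t). It
  is applied on the open half-line; zero values of a and b are reached by continuity from the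
  right.\<close>

lemma powr_convex_comb:
  fixes a b :: real
  assumes "p \<ge> 1" "a \<ge> 0" "b \<ge> 0" "0 < s" "0 < t"
  shows "(a + b) powr p \<le> (s + t) powr p * (s / (s+t) * (a/s) powr p + t/(s+t) * (b/t) powr p)"
proof -
  have pos: "(a + b) powr p \<le> (s + t) powr p * (s / (s+t) * (a/s) powr p + t/(s+t) * (b/t) powr p)"
    if "a > 0" "b > 0" for a b
  proof -
    have eq: "1 - t/(s+t) = s/(s+t)" using assms by (simp add: field_simps)
    have "(s/(s+t) * (a/s) + t/(s+t) * (b/t)) powr p \<le> s/(s+t) * (a/s) powr p + t/(s+t) * (b/t) powr p"
      using convex_onD[OF powr_convex[OF assms(1)], of "t/(s+t)" "a/s" "b/t"] assms that
      unfolding eq by simp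
    moreover have "s/(s+t) * (a/s) + t/(s+t) * (b/t) = (a+b)/(s+t)"
      using assms by (simp add: add_divide_distrib)
    ultimately have "((a+b)/(s+t)) powr p \<le> s/(s+t) * (a/s) powr p + t/(s+t) * (b/t) powr p" by simp
    then have "(s + t) powr p * ((a+b)/(s+t)) powr p \<le>
        (s + t) powr p * (s/(s+t) * (a/s) powr p + t/(s+t) * (b/t) powr p)"
      by (rule mult_left_mono) simp
    moreover have "(a + b) powr p = (s + t) powr p * ((a+b)/(s+t)) powr p"
      using assms that by (simp add: powr_divide)
    ultimately show ?thesis by simp
  qed
  show ?thesis
  proof (rule tendsto_le[where F="at_right (0::real)"])
    show "((\<lambda>e. ((a + e) + (b + e)) powr p) \<longlongrightarrow> (a + b) powr p) (at_right 0)"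
      using assms by (auto intro!: tendsto_eq_intros tendsto_powr' eventually_at_rightI[of 0 1])
    show "((\<lambda>e. (s + t) powr p * (s / (s+t) * ((a+e)/s) powr p + t/(s+t) * ((b+e)/t) powr p)) \<longlongrightarrow>
        (s + t) powr p * (s / (s+t) * (a/s) powr p + t/(s+t) * (b/t) powr p)) (at_right 0)"
      using assms by (intro tendsto_mult tendsto_add tendsto_const tendsto_powr')
        (auto intro!: tendsto_eq_intros eventually_at_rightI[of 0 1])
    show "\<forall>\<^sub>F e in at_right 0. ((a + e) + (b + e)) powr p \<le>
        (s + t) powr p * (s / (s+t) * ((a+e)/s) powr p + t/(s+t) * ((b+e)/t) powr p)"
      using assms by (intro eventually_at_rightI[of 0 1] pos) auto
  qed auto
qed

text \<open>Minkowski's inequality by normalization: with s and t above the two norms, the integrals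
  of (|u| / s)^p and (|v| / t)^p are at most 1, and integrating the convexity estimate bounds the
  norm of the sum by s + t.\<close>

lemma Lp_add:
  assumes p: "p \<ge> 1" and u: "u \<in> Lp p" and v: "v \<in> Lp p"
  shows "(\<lambda>x. u x + v x) \<in> Lp p"
    and "Lp_norm p (\<lambda>x. u x + v x) \<le> Lp_norm p u + Lp_norm p v"
proof -
  have le: "norm (u x + v x) powr p \<le>
      (s + t) powr p * (s / (s+t) * (norm (u x) powr p / s powr p) + t/(s+t) * (norm (v x) powr p / t powr p))"
    if "s > 0" "t > 0" for s t x
  proof -
    have "norm (u x + v x) powr p \<le> (norm (u x) + norm (v x)) powr p"
      using p by (intro powr_mono2) (auto simp: norm_triangle_ineq)
    also have "\<dots> \<le> (s + t) powr p * (s / (s+t) * (norm (u x)/s) powr p + t/(s+t) * (norm (v x)/t) powr p)"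
      using p that by (intro powr_convex_comb) auto
    finally show ?thesis using that by (simp add: powr_divide)
  qed
  have int: "integrable torus (\<lambda>x. (s + t) powr p * (s / (s+t) * (norm (u x) powr p / s powr p) + t/(s+t) * (norm (v x) powr p / t powr p)))" for s t
    using u v by (auto simp: Lp_iff)
  have [measurable]: "u \<in> borel_measurable torus" "v \<in> borel_measurable torus" 
    using u v Lp_measurable by (blast intro: periodic_measurable_torus)+
  show add: "(\<lambda>x. u x + v x) \<in> Lp p"
    unfolding Lp_iff
  proof
    show "(\<lambda>x. u x + v x) \<in> periodic_measurable" using u v by (simp add: periodic_measurable_add Lp_iff)
    show "integrable torus (\<lambda>x. norm (u x + v x) powr p)"
      by (rule Bochner_Integration.integrable_bound[OF int[of 1 1]]) (use le[of 1 1] in \<open>auto intro!: AE_I2 order_trans[OF le[of 1 1] abs_ge_self]\<close>)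
  qed
  \<comment> \<open>The strict inequalities make \<open>s\<close> and \<open>t\<close> positive,
    which covers vanishing norms without a case distinction.\<close>
  have *: "Lp_norm p (\<lambda>x. u x + v x) \<le> s + t" if s: "s > Lp_norm p u" and t: "t > Lp_norm p v" for s t
  proof (rule Lp_norm_leI)
    have s0: "s > 0" and t0: "t > 0" using s t Lp_norm_nonneg[of p] by (metis order_le_less_trans)+
    have su: "(LINT x|torus. norm (u x) powr p) \<le> s powr p" and tv: "(LINT x|torus. norm (v x) powr p) \<le> t powr p"
      using Lp_norm_powr[of p u] Lp_norm_powr[of p v] p s t by (auto intro!: powr_mono2 simp flip: Lp_norm_powr)
    have "(LINT x|torus. norm (u x + v x) powr p) \<le> 
      (LINT x|torus. (s + t) powr p * (s / (s+t) * (norm (u x) powr p / s powr p) + t/(s+t) * (norm (v x) powr p / t powr p)))"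
      by (intro integral_mono Lp_integrable add int le s0 t0)
    also have "\<dots> = (s + t) powr p * (s / (s+t) * ((LINT x|torus. norm (u x) powr p) / s powr p) + t/(s+t) * ((LINT x|torus. norm (v x) powr p) / t powr p))"
      using u v by (subst integral_mult_right_zero, subst Bochner_Integration.integral_add) (auto simp: Lp_iff)
    also have "\<dots> \<le> (s + t) powr p * (s / (s+t) * 1 + t/(s+t) * 1)"
      using s0 t0 su tv by (intro mult_left_mono add_mono) (auto simp: divide_le_eq)
    also have "\<dots> = (s+t) powr p" using s0 t0 by (simp flip: add_divide_distrib)
    finally show "(LINT x|torus. norm (u x + v x) powr p) \<le> (s+t) powr p" .
    show "p > 0" "s + t \<ge> 0" using p s0 t0 by auto
  qed
  show "Lp_norm p (\<lambda>x. u x + v x) \<le> Lp_norm p u + Lp_norm p v"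
  proof (rule field_le_epsilon)
    fix e :: real assume "e > 0"
    show "Lp_norm p (\<lambda>x. u x + v x) \<le> Lp_norm p u + Lp_norm p v + e"
      using *[of "Lp_norm p u + e/2" "Lp_norm p v + e/2"] \<open>e > 0\<close> by simp
  qed
qed

lemma Lp_norm_uminus: "Lp_norm p (\<lambda>x. - u x) = Lp_norm p u"
  by (simp add: Lp_norm_def)

lemma Lp_uminus: "u \<in> Lp p \<Longrightarrow> (\<lambda>x. - u x) \<in> Lp p"
  using Lp_scaleR(1)[of u p "-1"] by simp

lemma Lp_diff:
  assumes p: "p \<ge> 1" and u: "u \<in> Lp p" and v: "v \<in> Lp p"
  shows "(\<lambda>x. u x - v x) \<in> Lp p"
    and "Lp_norm p (\<lambda>x. u x - v x) \<le> Lp_norm p u + Lp_norm p v"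
  using Lp_add[OF p u Lp_uminus[OF v]] by (simp_all add: Lp_norm_uminus)

lemma Lp_norm_minus_commute: "Lp_norm p (\<lambda>x. u x - v x) = Lp_norm p (\<lambda>x. v x - u x)"
  by (simp add: Lp_norm_def norm_minus_commute)

text \<open>Young's inequality for u / s and v / t, integrated. As in the triangle inequality, s and
  t stay strictly above the norms and tend to them at the end.\<close>

lemma Lp_Holder:
  fixes u v :: "real^3 \<Rightarrow> 'a::euclidean_space"
  assumes pq: "p > 1" "q > 1" "1/p + 1/q = 1" and u: "u \<in> Lp p" and v: "v \<in> Lp q"
  shows "integrable torus (\<lambda>x. norm (u x) * norm (v x))"
    and "(LINT x|torus. norm (u x) * norm (v x)) \<le> Lp_norm p u * Lp_norm q v"
    and "integrable torus (\<lambda>x. u x \<bullet> v x)"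
    and "\<bar>LINT x|torus. u x \<bullet> v x\<bar> \<le> Lp_norm p u * Lp_norm q v"
proof -
  have le: "norm (u x) * norm (v x) \<le> s * t * (norm (u x) powr p / s powr p / p + norm (v x) powr q / t powr q / q)"
    if "s > 0" "t > 0" for s t x
    using Youngs_inequality[OF pq, of "norm (u x) / s" "norm (v x) / t"] that
    by (simp add: powr_divide field_simps)
  have int: "integrable torus (\<lambda>x. s * t * (norm (u x) powr p / s powr p / p + norm (v x) powr q / t powr q / q))" for s t
    using u v by (auto simp: Lp_iff)
  have [measurable]: "u \<in> borel_measurable torus" "v \<in> borel_measurable torus" 
    using u v Lp_measurable by (blast intro: periodic_measurable_torus)+
  show 1: "integrable torus (\<lambda>x. norm (u x) * norm (v x))"
    by (rule Bochner_Integration.integrable_bound[OF int[of 1 1]])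
      (use le[of 1 1] in \<open>auto intro!: AE_I2 intro: order_trans[OF _ abs_ge_self]\<close>)
  show 2: "integrable torus (\<lambda>x. u x \<bullet> v x)"
    by (rule Bochner_Integration.integrable_bound[OF 1]) (auto intro!: AE_I2 Cauchy_Schwarz_ineq2)
  have *: "(LINT x|torus. norm (u x) * norm (v x)) \<le> s * t" if s: "s > Lp_norm p u" and t: "t > Lp_norm q v" for s t
  proof -
    have s0: "s > 0" and t0: "t > 0" using s t Lp_norm_nonneg by (metis order_le_less_trans)+
    have su: "(LINT x|torus. norm (u x) powr p) \<le> s powr p" and tv: "(LINT x|torus. norm (v x) powr q) \<le> t powr q"
      using Lp_norm_powr[of p u] Lp_norm_powr[of q v] pq s t by (auto intro!: powr_mono2 simp flip: Lp_norm_powr)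
    have "(LINT x|torus. norm (u x) * norm (v x)) \<le> (LINT x|torus. s * t * (norm (u x) powr p / s powr p / p + norm (v x) powr q / t powr q / q))"
      by (intro integral_mono 1 int le s0 t0)
    also have "\<dots> = s * t * ((LINT x|torus. norm (u x) powr p) / s powr p / p + (LINT x|torus. norm (v x) powr q) / t powr q / q)"
      using u v by (subst integral_mult_right_zero, subst Bochner_Integration.integral_add) (auto simp: Lp_iff)
    also have "\<dots> \<le> s * t * (1 / p + 1 / q)"
      using s0 t0 su tv pq by (intro mult_left_mono add_mono divide_right_mono) (auto simp: divide_le_eq)
    finally show ?thesis using pq by simp
  qed
  show 3: "(LINT x|torus. norm (u x) * norm (v x)) \<le> Lp_norm p u * Lp_norm q v"
  proof (rule tendsto_lowerbound)
    show "((\<lambda>e. (Lp_norm p u + e) * (Lp_norm q v + e)) \<longlongrightarrow> Lp_norm p u * Lp_norm q v) (at_right 0)"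
      by (auto intro!: tendsto_eq_intros)
    show "\<forall>\<^sub>F e in at_right 0. (LINT x|torus. norm (u x) * norm (v x)) \<le> (Lp_norm p u + e) * (Lp_norm q v + e)"
      using * by (auto simp: eventually_at_right_field intro!: exI[of _ 1])
  qed auto
  have "\<bar>LINT x|torus. u x \<bullet> v x\<bar> \<le> (LINT x|torus. \<bar>u x \<bullet> v x\<bar>)"
    by (rule integral_abs_bound)
  also have "\<dots> \<le> (LINT x|torus. norm (u x) * norm (v x))"
    using 1 2 by (intro integral_mono Cauchy_Schwarz_ineq2) auto
  finally show "\<bar>LINT x|torus. u x \<bullet> v x\<bar> \<le> Lp_norm p u * Lp_norm q v" using 3 by simp
qed

text \<open>Hoelder's inequality for |u|^p and the constant 1 with exponents q / p and q / (q - p).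
  The second factor is 1 because the cell has volume 1, so the norms increase with the
  exponent.\<close>

lemma Lp_subset:
  fixes u :: "real^3 \<Rightarrow> 'a::euclidean_space"
  assumes pq: "0 < p" "p \<le> q" and u: "u \<in> Lp q"
  shows "u \<in> Lp p" and "Lp_norm p u \<le> Lp_norm q u"
proof -
  have [measurable]: "u \<in> borel_measurable torus" 
    using u Lp_measurable by (blast intro: periodic_measurable_torus)+
  show L: "u \<in> Lp p"
    unfolding Lp_iff
  proof
    show "u \<in> periodic_measurable" using u by (rule Lp_measurable)
    have "norm (u x) powr p \<le> 1 + norm (u x) powr q" for x
    proof (cases "norm (u x) \<le> 1")
      case True
      then have "norm (u x) powr p \<le> 1" using pq by (simp add: powr_le1)
      then show ?thesis by (simp add: add_increasing2)
    next
      case False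
      then have "norm (u x) powr p \<le> norm (u x) powr q" using pq by (intro powr_mono) auto
      then show ?thesis by simp
    qed
    then have le: "AE x in torus. norm (norm (u x) powr p) \<le> norm (1 + norm (u x) powr q)"
      by (intro AE_I2) (simp add: add_nonneg_nonneg)
    have int: "integrable torus (\<lambda>x. 1 + norm (u x) powr q)"
      using Lp_integrable[OF u] by auto
    show "integrable torus (\<lambda>x. norm (u x) powr p)"
      by (rule Bochner_Integration.integrable_bound[OF int _ le]) measurable
  qed
  show "Lp_norm p u \<le> Lp_norm q u"
  proof (cases "p = q")
    case False
    then have p: "p < q" "p > 0" using pq by auto
    let ?w = "\<lambda>x. norm (u x) powr p"
    define a b where "a = q / p" and "b = q / (q - p)"
    have ab: "a > 1" "b > 1" "1/a + 1/b = 1" using p by (auto simp: a_def b_def field_simps)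
    have w: "?w \<in> periodic_measurable" using Lp_measurable[OF u]
      by (auto intro!: periodic_measurable_compose[of "\<lambda>y. norm y powr p"])
    have "?w \<in> Lp a" using p Lp_integrable[OF u] w by (auto simp: Lp_iff powr_powr a_def)
    moreover have "(\<lambda>x. 1::real) \<in> Lp b" by (auto simp: Lp_iff)
    ultimately have "(LINT x|torus. norm (u x) powr p) \<le> Lp_norm a ?w * Lp_norm b (\<lambda>x. 1::real)"
      using Lp_Holder(2)[OF ab, of ?w "\<lambda>x. 1"] by simp
    also have "Lp_norm b (\<lambda>x. 1::real) = 1" using torus.prob_space by (simp add: Lp_norm_def)
    also have "Lp_norm a ?w = Lp_norm q u powr p"
      using p by (simp add: Lp_norm_def powr_powr a_def)
    finally show ?thesis by (intro Lp_norm_leI) (use p in auto)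
  qed simp
qed

lemma Lp1_iff: "u \<in> Lp 1 \<longleftrightarrow> u \<in> periodic_measurable \<and> integrable torus u"
proof -
  have "integrable torus (\<lambda>x. norm (u x)) \<longleftrightarrow> integrable torus u" if "u \<in> periodic_measurable"
    using that by (auto simp: integrable_norm_iff)
  then show ?thesis by (auto simp: Lp_iff)
qed

lemma Lp_integrable1: "u \<in> Lp p \<Longrightarrow> 1 \<le> p \<Longrightarrow> integrable torus u"
  using Lp_subset(1)[of 1 p u] by (simp add: Lp1_iff)

lemma Lp1_norm_eq: "Lp_norm 1 u = (LINT x|torus. norm (u x))"
  by (simp add: Lp_norm_def)

lemma Lp_linear:
  fixes h :: "'a::euclidean_space \<Rightarrow> 'b::euclidean_space"
  assumes h: "linear h" and p: "p > 0" and u: "u \<in> Lp p"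
  shows "(\<lambda>x. h (u x)) \<in> Lp p" and "Lp_norm p (\<lambda>x. h (u x)) \<le> onorm h * Lp_norm p u"
proof -
  have b: "bounded_linear h" using h by (simp add: linear_conv_bounded_linear)
  have le: "AE x in torus. norm (h (u x)) \<le> norm (onorm h *\<^sub>R u x)"
    using onorm[OF b] onorm_pos_le[OF b] by (auto intro!: AE_I2)
  note dom = Lp_dominated[OF p periodic_measurable_linear[OF h Lp_measurable[OF u]] Lp_scaleR(1)[OF u] le]
  show "(\<lambda>x. h (u x)) \<in> Lp p" by fact
  show "Lp_norm p (\<lambda>x. h (u x)) \<le> onorm h * Lp_norm p u"
    using dom(2) Lp_scaleR(2)[OF u p, of "onorm h"] onorm_pos_le[OF b] by simp
qed

text \<open>The bounds \<open>c n\<close> may vary with n. Taken to be the norms themselves along a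
  subsequence where they converge, they turn Fatou's lemma into lower semicontinuity of the
  norm.\<close>

lemma Lp_Fatou:
  assumes p: "p > 0" and u: "\<And>n. u n \<in> Lp p" and v: "v \<in> periodic_measurable"
    and lim: "AE x in torus. (\<lambda>n. u n x) \<longlonglongrightarrow> v x"
    and le: "\<And>n. Lp_norm p (u n) \<le> c n" and c: "c \<longlonglongrightarrow> C"
  shows "v \<in> Lp p" and "Lp_norm p v \<le> C"
proof -
  have c0: "c n \<ge> 0" for n using le[of n] Lp_norm_nonneg order_trans by blast
  then have C0: "C \<ge> 0" using c by (meson LIMSEQ_le_const)
  have [measurable]: "v \<in> borel_measurable torus" "u n \<in> borel_measurable torus" for n
    using v u[THEN Lp_measurable] by (blast intro: periodic_measurable_torus)+
  have "(\<integral>\<^sup>+ x. ennreal (norm (v x) powr p) \<partial>torus) = (\<integral>\<^sup>+ x. liminf (\<lambda>n. ennreal (norm (u n x) powr p)) \<partial>torus)"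
  proof (intro nn_integral_cong_AE)
    show "AE x in torus. ennreal (norm (v x) powr p) = liminf (\<lambda>n. ennreal (norm (u n x) powr p))"
      using lim
    proof eventually_elim
      case (elim x)
      then have "(\<lambda>n. ennreal (norm (u n x) powr p)) \<longlonglongrightarrow> ennreal (norm (v x) powr p)"
        using p by (intro tendsto_ennrealI tendsto_powr' tendsto_norm tendsto_const) auto
      then show ?case using lim_imp_Liminf[OF sequentially_bot] by metis
    qed
  qed
  also have "\<dots> \<le> liminf (\<lambda>n. \<integral>\<^sup>+ x. ennreal (norm (u n x) powr p) \<partial>torus)"
    by (rule nn_integral_liminf) auto
  also have "\<dots> \<le> liminf (\<lambda>n. ennreal (c n powr p))"
  proof (intro Liminf_mono always_eventually allI)
    fix n
    have "(\<integral>\<^sup>+ x. ennreal (norm (u n x) powr p) \<partial>torus) = ennreal (Lp_norm p (u n) powr p)"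
      using Lp_integrable[OF u[of n]] p by (simp add: nn_integral_eq_integral Lp_norm_powr)
    also have "\<dots> \<le> ennreal (c n powr p)"
      using le[of n] p by (intro ennreal_leI powr_mono2) auto
    finally show "(\<integral>\<^sup>+ x. ennreal (norm (u n x) powr p) \<partial>torus) \<le> ennreal (c n powr p)" .
  qed
  also have "\<dots> = ennreal (C powr p)"
    using c0 c p by (intro lim_imp_Liminf tendsto_ennrealI tendsto_powr') auto
  finally have *: "(\<integral>\<^sup>+ x. ennreal (norm (v x) powr p) \<partial>torus) \<le> ennreal (C powr p)" .
  then have int: "integrable torus (\<lambda>x. norm (v x) powr p)"
    by (intro integrableI_bounded) (auto simp: order_le_less_trans)
  then show "v \<in> Lp p" using v by (simp add: Lp_iff)
  from * int have "ennreal (LINT x|torus. norm (v x) powr p) \<le> ennreal (C powr p)"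
    by (simp add: nn_integral_eq_integral)
  then show "Lp_norm p v \<le> C" using C0 p by (intro Lp_norm_leI) auto
qed

text \<open>Riesz-Fischer for sequences with summable steps. The sum of the |u_{n+1} - u_n| has a
  finite integral, since L^1 norms are at most L^p norms, so the telescoping series converges
  absolutely almost everywhere. Fatou then bounds the distance to the limit by the tail of the
  series, and pointwise and norm limit agree.\<close>

lemma Lp_complete:
  assumes p: "p \<ge> 1" and u: "\<And>n. u n \<in> Lp p"
    and le: "\<And>n. Lp_norm p (\<lambda>x. u (Suc n) x - u n x) \<le> a n" and a: "summable a"
  obtains v where "v \<in> Lp p" "AE x in torus. (\<lambda>n. u n x) \<longlonglongrightarrow> v x"
    "(\<lambda>n. Lp_norm p (\<lambda>x. u n x - v x)) \<longlonglongrightarrow> 0"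
proof -
  define v where "v = (\<lambda>x. lim (\<lambda>n. u n x))"
  have vm: "v \<in> periodic_measurable"
    unfolding v_def using u by (intro periodic_measurable_lim) (auto simp: Lp_iff)
  have [measurable]: "v \<in> borel_measurable torus" "u n \<in> borel_measurable torus" for n
    using vm u[THEN Lp_measurable] by (blast intro: periodic_measurable_torus)+
  define w where "w n x = u (Suc n) x - u n x" for n x
  have w: "w n \<in> Lp p" for n unfolding w_def using u p by (intro Lp_diff) auto
  have [measurable]: "w n \<in> borel_measurable torus" for n unfolding w_def by measurable
  have a0: "a n \<ge> 0" for n using le[of n] Lp_norm_nonneg order_trans by blast
  have "(\<integral>\<^sup>+ x. (\<Sum>n. ennreal (norm (w n x))) \<partial>torus) = (\<Sum>n. \<integral>\<^sup>+ x. ennreal (norm (w n x)) \<partial>torus)"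
    by (rule nn_integral_suminf) auto
  also have "\<dots> \<le> (\<Sum>n. ennreal (a n))"
  proof (intro suminf_le)
    fix n
    have "w n \<in> Lp 1" and "Lp_norm 1 (w n) \<le> Lp_norm p (w n)"
      using Lp_subset[of 1 p "w n"] w p by auto
    then show "(\<integral>\<^sup>+ x. ennreal (norm (w n x)) \<partial>torus) \<le> ennreal (a n)"
      using le[of n] unfolding w_def[symmetric]
      by (auto simp: Lp1_iff Lp1_norm_eq nn_integral_eq_integral intro!: ennreal_leI)
  qed auto
  also have "\<dots> < \<infinity>" using a a0 by (simp add: ennreal_suminf_neq_top less_top)
  finally have "AE x in torus. (\<Sum>n. ennreal (norm (w n x))) \<noteq> \<infinity>"
    by (intro nn_integral_PInf_AE) auto
  then have lim: "AE x in torus. (\<lambda>n. u n x) \<longlonglongrightarrow> v x"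
  proof eventually_elim
    case (elim x)
    then have "summable (\<lambda>n. norm (w n x))"
      by (intro summable_suminf_not_top) auto
    then have "summable (\<lambda>n. w n x)" by (rule summable_norm_cancel)
    then have "convergent (\<lambda>n. \<Sum>i<n. w i x)" by (simp add: summable_iff_convergent)
    moreover have "(\<Sum>i<n. w i x) = u n x - u 0 x" for n
      unfolding w_def by (rule sum_lessThan_telescope)
    ultimately have "convergent (\<lambda>n. u n x - u 0 x)" by simp
    then have "convergent (\<lambda>n. u n x)" by (simp add: convergent_diff_const_right_iff)
    then show ?case by (simp add: v_def convergent_LIMSEQ_iff)
  qed
  have bound: "Lp_norm p (\<lambda>x. u (n + k) x - u n x) \<le> (\<Sum>i<k. a (i + n))" for n k
  proof (induction k)
    case (Suc k)
    have "Lp_norm p (\<lambda>x. u (n + Suc k) x - u n x) = Lp_norm p (\<lambda>x. w (n + k) x + (u (n + k) x - u n x))"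
      by (simp add: w_def)
    also have "\<dots> \<le> Lp_norm p (w (n + k)) + Lp_norm p (\<lambda>x. u (n + k) x - u n x)"
      by (intro Lp_add Lp_diff p w u)
    also have "\<dots> \<le> a (n + k) + (\<Sum>i<k. a (i + n))"
      using Suc le[of "n + k"] by (simp add: w_def[abs_def])
    finally show ?case by (simp add: add.commute)
  qed (use p in auto)
  have *: "Lp_norm p (\<lambda>x. v x - u n x) \<le> (\<Sum>i. a (i + n))" "(\<lambda>x. v x - u n x) \<in> Lp p" for n
  proof -
    have 1: "(\<lambda>x. u (n + k) x - u n x) \<in> Lp p" for k using u p by (intro Lp_diff)
    have 2: "(\<lambda>x. v x - u n x) \<in> periodic_measurable"
      using vm Lp_measurable[OF u] by (rule periodic_measurable_diff)
    have 3: "AE x in torus. (\<lambda>k. u (n + k) x - u n x) \<longlonglongrightarrow> v x - u n x"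
      using lim
    proof eventually_elim
      case (elim x)
      then have "(\<lambda>k. u (n + k) x) \<longlonglongrightarrow> v x"
        using LIMSEQ_ignore_initial_segment[of "\<lambda>k. u k x" "v x" n] by (simp add: add.commute)
      then show ?case by (intro tendsto_diff tendsto_const)
    qed
    have 4: "(\<lambda>k. \<Sum>i<k. a (i + n)) \<longlonglongrightarrow> (\<Sum>i. a (i + n))"
      using a by (intro summable_LIMSEQ) (simp add: summable_iff_shift)
    have "p > 0" using p by simp
    from Lp_Fatou[OF this 1 2 3 bound 4]
    show "Lp_norm p (\<lambda>x. v x - u n x) \<le> (\<Sum>i. a (i + n))" "(\<lambda>x. v x - u n x) \<in> Lp p" by auto
  qed
  have "(\<lambda>x. (v x - u 0 x) + u 0 x) \<in> Lp p" by (intro Lp_add p * u)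
  then have "v \<in> Lp p" by simp
  moreover have "(\<lambda>n. Lp_norm p (\<lambda>x. u n x - v x)) \<longlonglongrightarrow> 0"
  proof (rule tendsto_sandwich[OF _ _ tendsto_const suminf_exist_split2[OF a]])
    show "\<forall>\<^sub>F n in sequentially. Lp_norm p (\<lambda>x. u n x - v x) \<le> (\<Sum>i. a (i + n))"
      using * by (simp add: Lp_norm_minus_commute[of p _ v])
  qed auto
  ultimately show ?thesis using lim that by blast
qed

lemma Lp_norm_tendsto:
  assumes p: "p \<ge> 1" and u: "\<And>n. u n \<in> Lp p" and v: "v \<in> Lp p"
    and lim: "(\<lambda>n. Lp_norm p (\<lambda>x. u n x - v x)) \<longlonglongrightarrow> 0"
  shows "(\<lambda>n. Lp_norm p (u n)) \<longlonglongrightarrow> Lp_norm p v"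
proof -
  have "\<bar>Lp_norm p (u n) - Lp_norm p v\<bar> \<le> Lp_norm p (\<lambda>x. u n x - v x)" for n
  proof -
    have "Lp_norm p (\<lambda>x. (u n x - v x) + v x) \<le> Lp_norm p (\<lambda>x. u n x - v x) + Lp_norm p v"
      by (intro Lp_add Lp_diff p u v)
    moreover have "Lp_norm p (\<lambda>x. u n x - (u n x - v x)) \<le> Lp_norm p (u n) + Lp_norm p (\<lambda>x. u n x - v x)"
      by (intro Lp_diff p u v)
    ultimately show ?thesis by simp
  qed
  then have "(\<lambda>n. Lp_norm p (u n) - Lp_norm p v) \<longlonglongrightarrow> 0"
    by (intro Lim_null_comparison[OF _ lim]) auto
  then show ?thesis by (rule LIM_zero_cancel)
qed

lemma L2_Cauchy_Schwarz:
  assumes "u \<in> Lp 2" "v \<in> Lp 2"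
  shows "integrable torus (\<lambda>x. u x \<bullet> v x)" "\<bar>LINT x|torus. u x \<bullet> v x\<bar> \<le> Lp_norm 2 u * Lp_norm 2 v"
  using Lp_Holder(3,4)[of 2 2 u v] assms by auto

lemma L2_norm_sq: "(Lp_norm 2 u)\<^sup>2 = (LINT x|torus. u x \<bullet> u x)"
proof -
  have "(Lp_norm 2 u)\<^sup>2 = Lp_norm 2 u powr 2" by simp
  also have "\<dots> = (LINT x|torus. u x \<bullet> u x)"
    by (subst Lp_norm_powr) (auto simp: power2_norm_eq_inner)
  finally show ?thesis .
qed

lemma L2_norm_comb_sq:
  assumes u: "u \<in> Lp 2" and v: "v \<in> Lp 2"
  shows "(Lp_norm 2 (\<lambda>x. a *\<^sub>R u x + b *\<^sub>R v x))\<^sup>2 =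
    a\<^sup>2 * (Lp_norm 2 u)\<^sup>2 + 2 * a * b * (LINT x|torus. u x \<bullet> v x) + b\<^sup>2 * (Lp_norm 2 v)\<^sup>2"
proof -
  have "(Lp_norm 2 (\<lambda>x. a *\<^sub>R u x + b *\<^sub>R v x))\<^sup>2 =
    (LINT x|torus. a\<^sup>2 * (u x \<bullet> u x) + 2 * a * b * (u x \<bullet> v x) + b\<^sup>2 * (v x \<bullet> v x))"
    unfolding L2_norm_sq
    by (intro Bochner_Integration.integral_cong)
      (auto simp: inner_simps inner_commute power2_eq_square algebra_simps)
  also have "\<dots> = a\<^sup>2 * (Lp_norm 2 u)\<^sup>2 + 2 * a * b * (LINT x|torus. u x \<bullet> v x) + b\<^sup>2 * (Lp_norm 2 v)\<^sup>2"
    unfolding L2_norm_sq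
    using L2_Cauchy_Schwarz(1)[OF u u] L2_Cauchy_Schwarz(1)[OF u v] L2_Cauchy_Schwarz(1)[OF v v]
    by simp
  finally show ?thesis .
qed

lemma Lp_comb:
  "p \<ge> 1 \<Longrightarrow> u \<in> Lp p \<Longrightarrow> v \<in> Lp p \<Longrightarrow> (\<lambda>x. a *\<^sub>R u x + b *\<^sub>R v x) \<in> Lp p"
  by (intro Lp_add Lp_scaleR)

subsection \<open>Minimal elements of convex sets in \<open>L\<^sup>2\<close>\<close>

text \<open>By the parallelogram law, almost shortest elements of decreasing midpoint-convex sets form
  a Cauchy sequence. This replaces weak compactness.\<close>

lemma L2_nested_convex:
  fixes C :: "nat \<Rightarrow> (real^3 \<Rightarrow> 'a::euclidean_space) set"
  assumes sub: "\<And>n. C n \<subseteq> Lp 2" and dec: "\<And>n. C (Suc n) \<subseteq> C n"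
    and mid: "\<And>n u v. u \<in> C n \<Longrightarrow> v \<in> C n \<Longrightarrow> (\<lambda>x. (1/2) *\<^sub>R u x + (1/2) *\<^sub>R v x) \<in> C n"
    and bd: "\<And>n. \<exists>u\<in>C n. Lp_norm 2 u \<le> K"
  obtains c h where "\<And>n. c n \<in> C n" "h \<in> Lp 2"
    "AE x in torus. (\<lambda>n. c n x) \<longlonglongrightarrow> h x" "(\<lambda>n. Lp_norm 2 (\<lambda>x. c n x - h x)) \<longlonglongrightarrow> 0"
    "\<And>n v. (\<And>m. v \<in> C m) \<Longrightarrow> (Lp_norm 2 (c n))\<^sup>2 \<le> (Lp_norm 2 v)\<^sup>2 + 1 / real (Suc n)"
proof -
  define d where "d n = (INF v\<in>C n. (Lp_norm 2 v)\<^sup>2)" for n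
  have bdd: "bdd_below ((\<lambda>v. (Lp_norm 2 v)\<^sup>2) ` C n)" for n by (intro bdd_belowI2[of _ 0]) auto
  have d_le: "d n \<le> (Lp_norm 2 v)\<^sup>2" if "v \<in> C n" for n v
    unfolding d_def using bdd that by (rule cINF_lower)
  have decn: "C k \<subseteq> C n" if "n \<le> k" for n k
    using that by (induction rule: dec_induct) (use dec in auto)
  have ne: "C n \<noteq> {}" for n using bd[of n] by auto
  have "incseq d" unfolding incseq_def d_def
    using decn ne bdd by (intro allI impI cINF_superset_mono) auto
  moreover have "d n \<le> K\<^sup>2" for n
  proof -
    obtain u where "u \<in> C n" "Lp_norm 2 u \<le> K" using bd by blast
    then show ?thesis using d_le[of u n] power_mono[of "Lp_norm 2 u" K 2] by simp
  qed
  ultimately obtain D where D: "d \<longlonglongrightarrow> D" "\<And>n. d n \<le> D"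
    using incseq_convergent[of d "K\<^sup>2"] by blast
  have "\<exists>v\<in>C n. (Lp_norm 2 v)\<^sup>2 \<le> d n + 1 / real (Suc n)" for n
    using cINF_less_iff[OF ne bdd, of n "d n + 1 / real (Suc n)"] by (force simp: d_def intro: less_imp_le)
  then obtain e where e: "\<And>n. e n \<in> C n" "\<And>n. (Lp_norm 2 (e n))\<^sup>2 \<le> d n + 1 / real (Suc n)"
    by metis
  have eL: "e n \<in> Lp 2" for n using e(1) sub by blast
  \<comment> \<open>Parallelogram law: the midpoint of \<open>e k\<close> and \<open>e n\<close>
    lies in \<open>C n\<close>, because \<open>C k\<close> is contained in it, so its squared norm
    is at least \<open>d n\<close>. The infima \<open>d n\<close> increase to \<open>D\<close>,
    which makes the right-hand side small.\<close>
  have close: "(Lp_norm 2 (\<lambda>x. e k x - e n x))\<^sup>2 \<le> 2 * (D - d n) + 4 / real (Suc n)" if "n \<le> k" for n k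
  proof -
    have "e k \<in> C n" using e(1) decn that by blast
    then have "d n \<le> (Lp_norm 2 (\<lambda>x. (1/2) *\<^sub>R e k x + (1/2) *\<^sub>R e n x))\<^sup>2"
      using mid[OF _ e(1)] by (intro d_le) auto
    moreover have "(Lp_norm 2 (\<lambda>x. e k x - e n x))\<^sup>2 = 2 * (Lp_norm 2 (e k))\<^sup>2 + 2 * (Lp_norm 2 (e n))\<^sup>2
        - 4 * (Lp_norm 2 (\<lambda>x. (1/2) *\<^sub>R e k x + (1/2) *\<^sub>R e n x))\<^sup>2"
      using L2_norm_comb_sq[OF eL[of k] eL[of n], of 1 "-1"]
        L2_norm_comb_sq[OF eL[of k] eL[of n], of "1/2" "1/2"] by (simp add: power2_eq_square)
    moreover have "1 / real (Suc k) \<le> 1 / real (Suc n)" using that by (simp add: field_simps)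
    ultimately show ?thesis using e(2)[of n] e(2)[of k] D(2)[of k] by simp
  qed
  have "\<exists>N. \<forall>n\<ge>N. \<forall>k\<ge>n. Lp_norm 2 (\<lambda>x. e k x - e n x) \<le> (1/2)^m" for m
  proof -
    have "(\<lambda>n. 2 * (D - d n) + 4 / real (Suc n)) \<longlonglongrightarrow> 2 * (D - D) + 0"
      by (intro tendsto_add tendsto_mult tendsto_diff tendsto_const D(1) LIMSEQ_Suc[OF lim_const_over_n])
    then have "\<forall>\<^sub>F n in sequentially. 2 * (D - d n) + 4 / real (Suc n) < ((1/2)^m)\<^sup>2"
      by (intro order_tendstoD) auto
    then obtain N where N: "\<And>n. n \<ge> N \<Longrightarrow> 2 * (D - d n) + 4 / real (Suc n) < ((1/2)^m)\<^sup>2"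
      by (auto simp: eventually_sequentially)
    have "Lp_norm 2 (\<lambda>x. e k x - e n x) \<le> (1/2)^m" if "n \<ge> N" "k \<ge> n" for n k
      by (rule power2_le_imp_le[OF less_imp_le[OF order_le_less_trans[OF close[OF that(2)] N[OF that(1)]]]]) simp
    then show ?thesis by blast
  qed
  then obtain N where N: "\<And>m n k. n \<ge> N m \<Longrightarrow> k \<ge> n \<Longrightarrow> Lp_norm 2 (\<lambda>x. e k x - e n x) \<le> (1/2)^m"
    by metis
  \<comment> \<open>The sum makes \<open>r\<close> increasing and at least \<open>N m\<close>, so
    consecutive distances are at most (1/2)^m; the summand \<open>m\<close> ensures that
    \<open>e (r m)\<close> still lies in \<open>C m\<close>.\<close>
  define r where "r m = m + (\<Sum>i\<le>m. N i)" for m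
  have r: "r m \<ge> N m" "r (Suc m) \<ge> r m" "r m \<ge> m" for m
    using member_le_sum[of m "{..m}" N] by (auto simp: r_def)
  have "Lp_norm 2 (\<lambda>x. e (r (Suc m)) x - e (r m) x) \<le> (1/2)^m" for m
    by (intro N r)
  then obtain h where h: "h \<in> Lp 2" "AE x in torus. (\<lambda>n. e (r n) x) \<longlonglongrightarrow> h x"
    "(\<lambda>n. Lp_norm 2 (\<lambda>x. e (r n) x - h x)) \<longlonglongrightarrow> 0"
    using Lp_complete[of 2 "\<lambda>n. e (r n)" "\<lambda>m. (1/2)^m"] eL by (auto simp: summable_geometric)
  show ?thesis
  proof (rule that[of "\<lambda>n. e (r n)" h])
    show "e (r n) \<in> C n" for n using decn[OF r(3)] e(1) by blast
    show "(Lp_norm 2 (e (r n)))\<^sup>2 \<le> (Lp_norm 2 v)\<^sup>2 + 1 / real (Suc n)" if "\<And>m. v \<in> C m" for n v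
    proof -
      have "1 / real (Suc (r n)) \<le> 1 / real (Suc n)" using r(3)[of n] by (simp add: field_simps)
      then show ?thesis using e(2)[of "r n"] d_le[OF that, of "r n"] by linarith
    qed
  qed (use h in auto)
qed

text \<open>\<open>h\<close> is the shortest vector of the closure of \<open>C\<close>. As
  \<open>C\<close> need not be closed, \<open>h\<close> may lie outside it and is reached only
  through the sequence \<open>c\<close>. The last conclusion is the variational inequality:
  \<open>C\<close> lies beyond the hyperplane through \<open>h\<close> orthogonal to
  \<open>h\<close>.\<close>

lemma L2_projection:
  fixes C :: "(real^3 \<Rightarrow> 'a::euclidean_space) set"
  assumes sub: "C \<subseteq> Lp 2" and ne: "C \<noteq> {}"
    and conv: "\<And>u v t. u \<in> C \<Longrightarrow> v \<in> C \<Longrightarrow> 0 < t \<Longrightarrow> t < 1 \<Longrightarrow> (\<lambda>x. (1 - t) *\<^sub>R u x + t *\<^sub>R v x) \<in> C"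
  obtains c h where "\<And>n. c n \<in> C" "h \<in> Lp 2" "(\<lambda>n. Lp_norm 2 (\<lambda>x. c n x - h x)) \<longlonglongrightarrow> 0"
    "\<And>v. v \<in> C \<Longrightarrow> (Lp_norm 2 h)\<^sup>2 \<le> (LINT x|torus. h x \<bullet> v x)"
proof -
  obtain u0 where u0: "u0 \<in> C" using ne by blast
  obtain c h where c: "\<And>n. c n \<in> C" and h: "h \<in> Lp 2" and lim: "(\<lambda>n. Lp_norm 2 (\<lambda>x. c n x - h x)) \<longlonglongrightarrow> 0"
    and min: "\<And>n v. v \<in> C \<Longrightarrow> (Lp_norm 2 (c n))\<^sup>2 \<le> (Lp_norm 2 v)\<^sup>2 + 1 / real (Suc n)"
  proof (rule L2_nested_convex[of "\<lambda>n. C" "Lp_norm 2 u0"])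
    show "(\<lambda>x. (1/2) *\<^sub>R u x + (1/2) *\<^sub>R v x) \<in> C" if "u \<in> C" "v \<in> C" for u v
      using conv[OF that, of "1/2"] by simp
  qed (use sub u0 in auto)
  have "(Lp_norm 2 h)\<^sup>2 \<le> (LINT x|torus. h x \<bullet> v x)" if v: "v \<in> C" for v
  proof -
    have vL: "v \<in> Lp 2" and cL: "c n \<in> Lp 2" for n using v c sub by auto
    \<comment> \<open>Minimality of \<open>h\<close> against (1 - t) h + t v, expanded and divided
      by t. It comes from the competitors (1 - t) c_n + t v, which do belong to \<open>C\<close>.
      The limit t to 0 yields the variational inequality.\<close>
    have "(2 - t) * (Lp_norm 2 h)\<^sup>2 \<le> 2 * (1 - t) * (LINT x|torus. h x \<bullet> v x) + t * (Lp_norm 2 v)\<^sup>2"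
      if t: "0 < t" "t < 1" for t
    proof -
      let ?w = "\<lambda>n x. (1 - t) *\<^sub>R c n x + t *\<^sub>R v x"
      let ?z = "\<lambda>x. (1 - t) *\<^sub>R h x + t *\<^sub>R v x"
      have "(\<lambda>n. Lp_norm 2 (\<lambda>x. ?w n x - ?z x)) \<longlonglongrightarrow> 0"
      proof -
        have "Lp_norm 2 (\<lambda>x. ?w n x - ?z x) = \<bar>1 - t\<bar> * Lp_norm 2 (\<lambda>x. c n x - h x)" for n
        proof -
          have "(\<lambda>x. ?w n x - ?z x) = (\<lambda>x. (1 - t) *\<^sub>R (c n x - h x))" by (auto simp: algebra_simps)
          then show ?thesis using Lp_scaleR(2)[OF Lp_diff(1)[OF _ cL h]] by simp
        qed
        then show ?thesis using tendsto_mult_right_zero[OF lim] by simp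
      qed
      then have "(\<lambda>n. Lp_norm 2 (?w n)) \<longlonglongrightarrow> Lp_norm 2 ?z"
        by (intro Lp_norm_tendsto Lp_comb cL vL h) auto
      then have lim2: "(\<lambda>n. (Lp_norm 2 (?w n))\<^sup>2 + 1 / real (Suc n)) \<longlonglongrightarrow> (Lp_norm 2 ?z)\<^sup>2 + 0"
        by (intro tendsto_add tendsto_power LIMSEQ_Suc[OF lim_const_over_n])
      have "(\<lambda>n. (Lp_norm 2 (c n))\<^sup>2) \<longlonglongrightarrow> (Lp_norm 2 h)\<^sup>2"
        by (intro tendsto_power Lp_norm_tendsto cL h lim) auto
      then have "(Lp_norm 2 h)\<^sup>2 \<le> (Lp_norm 2 ?z)\<^sup>2 + 0"
        by (rule LIMSEQ_le[OF _ lim2]) (use min conv[OF c v t] in auto)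
      also have "\<dots> = (1-t)\<^sup>2 * (Lp_norm 2 h)\<^sup>2 + 2 * (1 - t) * t * (LINT x|torus. h x \<bullet> v x) + t\<^sup>2 * (Lp_norm 2 v)\<^sup>2"
        using L2_norm_comb_sq[OF h vL, of "1-t" t] by simp
      finally have "t * ((2 - t) * (Lp_norm 2 h)\<^sup>2) \<le> t * (2 * (1 - t) * (LINT x|torus. h x \<bullet> v x) + t * (Lp_norm 2 v)\<^sup>2)"
        by (simp add: algebra_simps power2_eq_square)
      then show ?thesis using t by simp
    qed
    then have ev: "\<forall>\<^sub>F t in at_right 0. (2 - t) * (Lp_norm 2 h)\<^sup>2 \<le> 2 * (1 - t) * (LINT x|torus. h x \<bullet> v x) + t * (Lp_norm 2 v)\<^sup>2"
      by (intro eventually_at_rightI[of 0 1]) auto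
    have "(2 - 0) * (Lp_norm 2 h)\<^sup>2 \<le> 2 * (1 - 0) * (LINT x|torus. h x \<bullet> v x) + 0 * (Lp_norm 2 v)\<^sup>2"
      by (rule tendsto_le[OF _ _ _ ev]) (intro tendsto_intros trivial_limit_at_right_real)+
    then show ?thesis by simp
  qed
  then show ?thesis using that c h lim by blast
qed

section \<open>Essentially bounded functions\<close>

lemma Linf_iff: "u \<in> Linf \<longleftrightarrow> u \<in> periodic_measurable \<and> (\<exists>C. AE x in torus. norm (u x) \<le> C)"
  and Linf_norm_nonneg: "0 \<le> Linf_norm u"
  and Linf_AE_norm: "u \<in> Linf \<Longrightarrow> AE x in torus. norm (u x) \<le> Linf_norm u"
  and Linf_norm_leI: "u \<in> periodic_measurable \<Longrightarrow> AE x in torus. norm (u x) \<le> C \<Longrightarrow> Linf_norm u \<le> C"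
proof -
  let ?e = "esssup torus (\<lambda>x. ereal (norm (u x)))"
  \<comment> \<open>A negative essential supremum of a norm would make a false statement hold almost
    everywhere, impossible on a space of measure 1. Hence \<open>real_of_ereal\<close> is faithful
    on finite values, and it sends an infinite one to 0.\<close>
  have e0: "0 \<le> ?e"
  proof (rule ccontr)
    assume *: "\<not> 0 \<le> ?e"
    have "AE x in torus. False"
      using esssup_AE[of "\<lambda>x. ereal (norm (u x))" torus]
      by eventually_elim (use * in \<open>metis ereal_less_eq(5) norm_ge_zero order_trans\<close>)
    then show False by simp
  qed
  then show "0 \<le> Linf_norm u" by (simp add: Linf_norm_def real_of_ereal_pos)
  have le: "?e \<le> ereal C" if "u \<in> periodic_measurable" "AE x in torus. norm (u x) \<le> C" for C
    using that periodic_measurable_torus[OF that(1)] by (intro esssup_I) auto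
  have fin: "?e = ereal (Linf_norm u)" if "?e < \<infinity>"
    using that e0 unfolding Linf_norm_def by (cases ?e) auto
  have AE: "AE x in torus. norm (u x) \<le> Linf_norm u" if "?e < \<infinity>"
    using esssup_AE[of "\<lambda>x. ereal (norm (u x))" torus] fin[OF that] by simp
  then show "AE x in torus. norm (u x) \<le> Linf_norm u" if "u \<in> Linf" using that by (simp add: Linf_def)
  show "u \<in> Linf \<longleftrightarrow> u \<in> periodic_measurable \<and> (\<exists>C. AE x in torus. norm (u x) \<le> C)"
  proof
    assume "u \<in> Linf"
    then show "u \<in> periodic_measurable \<and> (\<exists>C. AE x in torus. norm (u x) \<le> C)"
      using AE by (auto simp: Linf_def periodic_measurable_def)
  next
    assume "u \<in> periodic_measurable \<and> (\<exists>C. AE x in torus. norm (u x) \<le> C)"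
    then obtain C where C: "u \<in> periodic_measurable" "?e \<le> ereal C" using le by blast
    then have "?e < \<infinity>" by (metis less_ereal.simps(4) order.strict_trans1)
    with C show "u \<in> Linf" by (simp add: Linf_def periodic_measurable_def)
  qed
  show "Linf_norm u \<le> C" if "u \<in> periodic_measurable" "AE x in torus. norm (u x) \<le> C"
  proof -
    have "?e < \<infinity>" using le[OF that] by (metis less_ereal.simps(4) order.strict_trans1)
    then show ?thesis using le[OF that] fin by simp
  qed
qed

lemma Linf_measurable: "u \<in> Linf \<Longrightarrow> u \<in> periodic_measurable"
  by (simp add: Linf_iff)

lemma Linf_subset_Lp:
  assumes "u \<in> Linf" "p > 0"
  shows "u \<in> Lp p" "Lp_norm p u \<le> Linf_norm u"
  using Lp_bounded[OF assms(2) Linf_measurable[OF assms(1)] Linf_AE_norm[OF assms(1)]] by auto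

lemma Linf_comb:
  assumes "u \<in> Linf" "v \<in> Linf"
  shows "(\<lambda>x. a *\<^sub>R u x + b *\<^sub>R v x) \<in> Linf"
    and "Linf_norm (\<lambda>x. a *\<^sub>R u x + b *\<^sub>R v x) \<le> \<bar>a\<bar> * Linf_norm u + \<bar>b\<bar> * Linf_norm v"
proof -
  have m: "(\<lambda>x. a *\<^sub>R u x + b *\<^sub>R v x) \<in> periodic_measurable"
    using assms by (intro periodic_measurable_add periodic_measurable_scaleR periodic_measurable_const Linf_measurable)
  have AE: "AE x in torus. norm (a *\<^sub>R u x + b *\<^sub>R v x) \<le> \<bar>a\<bar> * Linf_norm u + \<bar>b\<bar> * Linf_norm v"
    using Linf_AE_norm[OF assms(1)] Linf_AE_norm[OF assms(2)]
  proof eventually_elim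
    case (elim x)
    have "norm (a *\<^sub>R u x + b *\<^sub>R v x) \<le> \<bar>a\<bar> * norm (u x) + \<bar>b\<bar> * norm (v x)"
      by (metis norm_scaleR norm_triangle_ineq)
    also have "\<dots> \<le> \<bar>a\<bar> * Linf_norm u + \<bar>b\<bar> * Linf_norm v"
      using elim by (intro add_mono mult_left_mono) auto
    finally show ?case .
  qed
  show "(\<lambda>x. a *\<^sub>R u x + b *\<^sub>R v x) \<in> Linf" using m AE by (auto simp: Linf_iff)
  show "Linf_norm (\<lambda>x. a *\<^sub>R u x + b *\<^sub>R v x) \<le> \<bar>a\<bar> * Linf_norm u + \<bar>b\<bar> * Linf_norm v"
    using m AE by (rule Linf_norm_leI)
qed

lemma Linf_Fatou:
  assumes u: "\<And>n. u n \<in> Linf" and v: "v \<in> periodic_measurable"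
    and lim: "AE x in torus. (\<lambda>n. u n x) \<longlonglongrightarrow> v x"
    and le: "\<And>n. Linf_norm (u n) \<le> c n" and c: "c \<longlonglongrightarrow> C"
  shows "v \<in> Linf" and "Linf_norm v \<le> C"
proof -
  have "AE x in torus. \<forall>n. norm (u n x) \<le> Linf_norm (u n)"
    using Linf_AE_norm[OF u] by (simp add: AE_all_countable)
  then have AE: "AE x in torus. norm (v x) \<le> C"
    using lim
  proof eventually_elim
    case (elim x)
    then show ?case
      by (intro LIMSEQ_le[OF tendsto_norm c]) (auto intro: order_trans[OF _ le])
  qed
  then show "v \<in> Linf" "Linf_norm v \<le> C" using v Linf_norm_leI by (auto simp: Linf_iff)
qed

subsection \<open>Test functions\<close>

lemma partial_eqI:
  "(u has_derivative D) (at x) \<Longrightarrow> partial i u x = D (axis i 1)"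
  unfolding partial_def using frechet_derivative_at by fastforce

lemma periodic_translate: "periodic u \<Longrightarrow> periodic (\<lambda>x. u (x + a))"
  unfolding periodic_def by (metis add.assoc add.commute)

lemma has_derivative_translate:
  assumes "(u has_derivative D) (at (x + a))"
  shows "((\<lambda>x. u (x + a)) has_derivative D) (at x)"
proof -
  have "((\<lambda>x. x + a) has_derivative (\<lambda>h. h)) (at x)" by (auto intro!: derivative_eq_intros)
  from has_derivative_compose[OF this assms] show ?thesis .
qed

lemma partial_translate:
  assumes "\<And>x. u differentiable (at x)"
  shows "partial i (\<lambda>x. u (x + a)) = (\<lambda>x. partial i u (x + a))"
proof
  fix x
  have "(u has_derivative frechet_derivative u (at (x + a))) (at (x + a))"
    using assms frechet_derivative_works by blast
  from partial_eqI[OF has_derivative_translate[OF this]]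
  show "partial i (\<lambda>x. u (x + a)) x = partial i u (x + a)" by (simp add: partial_def)
qed

lemma partial_comb:
  assumes "\<And>x. u differentiable (at x)" "\<And>x. v differentiable (at x)"
  shows "partial i (\<lambda>x. a *\<^sub>R u x + b *\<^sub>R v x) = (\<lambda>x. a *\<^sub>R partial i u x + b *\<^sub>R partial i v x)"
proof
  fix x
  have "(u has_derivative frechet_derivative u (at x)) (at x)"
    "(v has_derivative frechet_derivative v (at x)) (at x)"
    using assms frechet_derivative_works by blast+
  then have "((\<lambda>x. a *\<^sub>R u x + b *\<^sub>R v x) has_derivative
      (\<lambda>h. a *\<^sub>R frechet_derivative u (at x) h + b *\<^sub>R frechet_derivative v (at x) h)) (at x)"
    by (intro derivative_intros)
  from partial_eqI[OF this]
  show "partial i (\<lambda>x. a *\<^sub>R u x + b *\<^sub>R v x) x = a *\<^sub>R partial i u x + b *\<^sub>R partial i v x"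
    by (simp add: partial_def)
qed

lemma Ck_translate: "Ck k u \<Longrightarrow> Ck k (\<lambda>x. u (x + a))"
proof (induction k arbitrary: u)
  case 0
  then show ?case by (auto intro!: continuous_on_compose2[of UNIV u] continuous_intros)
next
  case (Suc k)
  have "(\<lambda>x. u (x + a)) differentiable (at x)" for x
    using Suc.prems has_derivative_translate unfolding Ck.simps differentiable_def by blast
  moreover have "Ck k (partial i (\<lambda>x. u (x + a)))" for i
    using Suc by (subst partial_translate) auto
  ultimately show ?case by auto
qed

lemma Ck_comb: "Ck k u \<Longrightarrow> Ck k v \<Longrightarrow> Ck k (\<lambda>x. a *\<^sub>R u x + b *\<^sub>R v x)"
proof (induction k arbitrary: u v)
  case 0
  then show ?case by (auto intro!: continuous_intros)
next
  case (Suc k)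
  have "(\<lambda>x. a *\<^sub>R u x + b *\<^sub>R v x) differentiable (at x)" for x
    using Suc.prems by (auto intro!: derivative_intros)
  moreover have "Ck k (partial i (\<lambda>x. a *\<^sub>R u x + b *\<^sub>R v x))" for i
    using Suc by (subst partial_comb) auto
  ultimately show ?case by auto
qed

lemma partial_const: "partial i (\<lambda>x. c) = (\<lambda>x. 0)"
  by (rule ext, rule partial_eqI[of "\<lambda>x. c" "\<lambda>x. 0", THEN trans]) auto

lemma Ck_const: "Ck k (\<lambda>x. c)"
proof (induction k arbitrary: c)
  case (Suc k)
  then show ?case by (auto simp: partial_const)
qed auto

lemma
  assumes "\<phi> \<in> test_functions"
  shows test_functions_periodic: "periodic \<phi>"
    and test_functions_differentiable: "\<phi> differentiable (at x)"
    and test_functions_derivative: "(\<phi> has_derivative frechet_derivative \<phi> (at x)) (at x)"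
    and test_functions_partial: "partial i \<phi> \<in> test_functions"
proof -
  have C: "Ck (Suc k) \<phi>" for k using assms by (simp add: test_functions_def del: Ck.simps)
  show p: "periodic \<phi>" using assms by (simp add: test_functions_def)
  show d: "\<phi> differentiable (at x)" for x using C[of 0] by simp
  then show "(\<phi> has_derivative frechet_derivative \<phi> (at x)) (at x)" by (simp add: frechet_derivative_works)
  \<comment> \<open>Periodicity is invariance under a translation, and partial derivatives commute
    with translations, so they inherit it.\<close>
  have "(\<lambda>x. \<phi> (x + axis j 1)) = \<phi>" for j using p by (auto simp: periodic_def)
  then have "periodic (partial i \<phi>)"
    using partial_translate[OF d, of i "axis j 1" for j] unfolding periodic_def by metis
  then show "partial i \<phi> \<in> test_functions"
    using C unfolding test_functions_def by simp
qed

lemma test_functions_continuous: "\<phi> \<in> test_functions \<Longrightarrow> continuous_on UNIV \<phi>"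
  unfolding test_functions_def using Ck.simps(1) by blast

lemma test_functions_const: "(\<lambda>x. c) \<in> test_functions"
  by (auto simp: test_functions_def periodic_def Ck_const)

lemma test_functions_comb:
  "\<phi> \<in> test_functions \<Longrightarrow> \<psi> \<in> test_functions \<Longrightarrow> (\<lambda>x. a *\<^sub>R \<phi> x + b *\<^sub>R \<psi> x) \<in> test_functions"
  by (auto simp: test_functions_def Ck_comb periodic_def)

lemma test_functions_translate:
  "\<phi> \<in> test_functions \<Longrightarrow> (\<lambda>x. \<phi> (x + a)) \<in> test_functions"
  by (auto simp: test_functions_def Ck_translate periodic_translate)

lemma continuous_periodic_Linf:
  fixes u :: "real^3 \<Rightarrow> 'a::euclidean_space"
  assumes "continuous_on UNIV u" "periodic u"
  shows "u \<in> Linf"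
proof -
  have "u \<in> borel_measurable lebesgue"
    using borel_measurable_continuous_onI[OF assms(1)] by (simp add: measurable_completion)
  moreover have "bounded (u ` cbox 0 1)"
    by (intro compact_imp_bounded compact_continuous_image continuous_on_subset[OF assms(1)]) auto
  then obtain B where "\<And>x. x \<in> cbox 0 1 \<Longrightarrow> norm (u x) \<le> B" by (auto simp: bounded_iff)
  then have "AE x in torus. norm (u x) \<le> B" by (auto intro!: AE_I2)
  ultimately show ?thesis using assms by (auto simp: Linf_iff periodic_measurable_def)
qed

lemma continuous_torus_integrable:
  fixes u :: "real^3 \<Rightarrow> 'a::euclidean_space"
  assumes "continuous_on UNIV u"
  shows "integrable torus u"
  by (intro continuous_imp_integrable continuous_on_subset[OF assms]) auto

lemma test_functions_Linf:
  fixes \<phi> :: "real^3 \<Rightarrow> 'a::euclidean_space"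
  shows "\<phi> \<in> test_functions \<Longrightarrow> \<phi> \<in> Linf"
  by (intro continuous_periodic_Linf test_functions_continuous test_functions_periodic)

subsection \<open>Integration by parts\<close>

text \<open>The shifted cell is cut by the plane where the j-th coordinate is 1. The piece beyond
  the plane, moved back by one period, is the slab of the original cell that the shift had
  uncovered.\<close>

lemma integral_translate:
  fixes u :: "real^3 \<Rightarrow> real"
  assumes u: "continuous_on UNIV u" "periodic u" and t: "0 \<le> t" "t \<le> 1"
  shows "(LINT x|torus. u (x + t *\<^sub>R axis j 1)) = (LINT x|torus. u x)"
proof -
  let ?e = "axis j 1 :: real^3"
  have int: "u integrable_on cbox a b" for a b
    by (intro integrable_continuous continuous_on_subset[OF u(1)]) auto
  let ?I = "\<lambda>a b. integral (cbox a b) u"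
  have I: "(u has_integral ?I a b) (cbox a b)" for a b using int by (rule integrable_integral)
  have e: "?e \<in> Basis" by (simp add: axis_in_Basis_iff)
  have ex: "x \<bullet> ?e = x $ j" and ei: "?e $ i = (if i = j then 1 else 0)" for x and i :: 3
    by (auto simp: inner_axis, simp add: axis_def)
  have box: "x \<in> cbox a b \<longleftrightarrow> a $ j \<le> x $ j \<and> x $ j \<le> b $ j \<and> (\<forall>i. i \<noteq> j \<longrightarrow> a $ i \<le> x $ i \<and> x $ i \<le> b $ i)"
    for x a b :: "real^3" by (auto simp: mem_box_cart)
  \<comment> \<open>The corner \<open>1 + t *\<^sub>R ?e - ?e\<close> has j-th coordinate t and all
    others 1, so it bounds the slab of thickness t.\<close>
  have 1: "cbox (t *\<^sub>R ?e) (1 + t *\<^sub>R ?e) \<inter> {x. x \<bullet> ?e \<le> 1} = cbox (t *\<^sub>R ?e) 1"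
    "cbox (t *\<^sub>R ?e) (1 + t *\<^sub>R ?e) \<inter> {x. x \<bullet> ?e \<ge> 1} = cbox ?e (1 + t *\<^sub>R ?e)"
    "cbox 0 1 \<inter> {x. x \<bullet> ?e \<le> t} = cbox 0 (1 + t *\<^sub>R ?e - ?e)"
    "cbox 0 1 \<inter> {x. x \<bullet> ?e \<ge> t} = cbox (t *\<^sub>R ?e) 1"
    using t by (auto simp: box ex ei)
  have "?I (t *\<^sub>R ?e) (1 + t *\<^sub>R ?e) = ?I (t *\<^sub>R ?e) 1 + ?I ?e (1 + t *\<^sub>R ?e)"
    by (rule integral_unique, rule has_integral_split[OF _ _ e, of _ _ _ _ 1]) (auto simp: 1 I)
  also have "?I ?e (1 + t *\<^sub>R ?e) = ?I 0 (1 + t *\<^sub>R ?e - ?e)"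
  proof -
    have "u \<circ> (+) ?e = u" using u(2) by (auto simp: periodic_def add.commute)
    then show ?thesis using integral_shift_cbox_plus[of 0 "1 + t *\<^sub>R ?e - ?e" u ?e] by simp
  qed
  also have "?I (t *\<^sub>R ?e) 1 + ?I 0 (1 + t *\<^sub>R ?e - ?e) = ?I 0 1"
    by (rule sym, rule integral_unique, subst add.commute,
        rule has_integral_split[OF _ _ e, of _ _ _ _ t]) (auto simp: 1 I)
  finally have "?I (t *\<^sub>R ?e) (1 + t *\<^sub>R ?e) = ?I 0 1" .
  moreover have "integral (cbox 0 1) (\<lambda>x. u (x + t *\<^sub>R ?e)) = ?I (t *\<^sub>R ?e) (1 + t *\<^sub>R ?e)"
    using integral_shift_cbox_plus[of 0 1 u "t *\<^sub>R ?e"] by (simp add: o_def add.commute)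
  ultimately show ?thesis
    using Ck_translate[of 0 u] u(1)
    by (subst (1 2) lebesgue_integral_eq_integral) (auto intro: continuous_torus_integrable)
qed

text \<open>Dominated convergence: by the mean value theorem the quotients are values of the partial
  derivative at nearby points, hence uniformly bounded on the cell. The weight \<open>w\<close> is
  merely integrable, so that components of weak gradients can be inserted later.\<close>

lemma difference_quotient_limit:
  fixes v w :: "real^3 \<Rightarrow> real"
  assumes d: "\<And>x. v differentiable (at x)" and c: "continuous_on UNIV (partial j v)"
    and w: "integrable torus w"
  shows "(\<lambda>n. LINT x|torus. w x * (real (Suc n) * (v (x + (1 / real (Suc n)) *\<^sub>R axis j 1) - v x)))
    \<longlonglongrightarrow> (LINT x|torus. w x * partial j v x)"
proof -
  let ?e = "axis j 1 :: real^3"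
  define q where "q n x = real (Suc n) * (v (x + (1 / real (Suc n)) *\<^sub>R ?e) - v x)" for n x
  have der: "((\<lambda>t. v (x + t *\<^sub>R ?e)) has_real_derivative partial j v (x + t *\<^sub>R ?e)) (at t)" for x t
  proof -
    have 1: "((\<lambda>t. x + t *\<^sub>R ?e) has_derivative (\<lambda>h. h *\<^sub>R ?e)) (at t)"
      by (auto intro!: derivative_eq_intros)
    have 2: "(v has_derivative frechet_derivative v (at (x + t *\<^sub>R ?e))) (at (x + t *\<^sub>R ?e))"
      using d by (simp add: frechet_derivative_works)
    have "((\<lambda>t. v (x + t *\<^sub>R ?e)) has_derivative (\<lambda>h. frechet_derivative v (at (x + t *\<^sub>R ?e)) (h *\<^sub>R ?e))) (at t)"
      by (rule has_derivative_compose[OF 1 2])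
    moreover have "frechet_derivative v (at (x + t *\<^sub>R ?e)) (h *\<^sub>R ?e) = partial j v (x + t *\<^sub>R ?e) * h" for h
      using linear_scale[OF has_derivative_linear[OF 2], of h ?e] by (simp add: partial_def)
    ultimately show ?thesis by (simp add: has_field_derivative_def)
  qed
  have vc: "continuous_on UNIV v"
    using d by (intro continuous_at_imp_continuous_on) (auto intro: differentiable_imp_continuous_within)
  have qc: "continuous_on UNIV (q n)" for n
    unfolding q_def by (intro continuous_intros continuous_on_compose2[OF vc]) auto
  \<comment> \<open>A generous radius: points of the cell have norm at most 3, and the mean value
    point is at distance at most 1 from them.\<close>
  have "bounded (partial j v ` cball 0 10)"
    by (intro compact_imp_bounded compact_continuous_image continuous_on_subset[OF c]) auto
  then obtain B where "\<forall>y\<in>partial j v ` cball 0 10. norm y \<le> B" unfolding bounded_iff by blast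
  then have B: "\<bar>partial j v x\<bar> \<le> B" if "norm x \<le> 10" for x using that by simp
  have bound: "\<bar>q n x\<bar> \<le> B" if "x \<in> cbox 0 1" for n x
  proof -
    obtain t where t: "0 < t" "t < 1 / real (Suc n)"
      "v (x + (1 / real (Suc n)) *\<^sub>R ?e) - v (x + 0 *\<^sub>R ?e) = (1 / real (Suc n) - 0) * partial j v (x + t *\<^sub>R ?e)"
      using MVT2[of 0 "1 / real (Suc n)" "\<lambda>t. v (x + t *\<^sub>R ?e)" "\<lambda>t. partial j v (x + t *\<^sub>R ?e)"] der by auto
    then have "q n x = partial j v (x + t *\<^sub>R ?e)" by (simp add: q_def)
    moreover have "norm (x + t *\<^sub>R ?e) \<le> 10"
    proof -
      have "norm x \<le> (\<Sum>i\<in>UNIV. \<bar>x $ i\<bar>)" by (rule norm_le_l1_cart)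
      also have "\<dots> \<le> (\<Sum>i\<in>(UNIV::3 set). 1)" using that by (intro sum_mono) (auto simp: mem_box_cart)
      finally have "norm x \<le> 3" by simp
      moreover have "1 / real (Suc n) \<le> 1" by simp
      then have "t \<le> 1" using t(2) by linarith
      then have "norm (t *\<^sub>R ?e) \<le> 1" using t(1) by simp
      ultimately show ?thesis using norm_triangle_ineq[of x "t *\<^sub>R ?e"] by linarith
    qed
    ultimately show ?thesis using B by simp
  qed
  have lim: "(\<lambda>n. q n x) \<longlonglongrightarrow> partial j v x" for x
  proof -
    have "((\<lambda>h. (v (x + h *\<^sub>R ?e) - v x) / h) \<longlongrightarrow> partial j v x) (at 0)"
      using der[of x 0] by (simp add: DERIV_def)
    moreover have "filterlim (\<lambda>n. 1 / real (Suc n)) (at 0) sequentially"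
      using LIMSEQ_Suc[OF lim_1_over_n] by (intro filterlim_atI) auto
    ultimately have "(\<lambda>n. (v (x + (1 / real (Suc n)) *\<^sub>R ?e) - v x) / (1 / real (Suc n))) \<longlonglongrightarrow> partial j v x"
      by (rule filterlim_compose)
    then show ?thesis by (simp add: q_def mult.commute)
  qed
  have [measurable]: "w \<in> borel_measurable torus" using w by (rule borel_measurable_integrable)
  have [measurable]: "q n \<in> borel_measurable torus" "partial j v \<in> borel_measurable torus" for n
    using qc c continuous_torus_integrable borel_measurable_integrable by blast+
  show ?thesis
    unfolding q_def[symmetric]
  proof (rule integral_dominated_convergence)
    show "integrable torus (\<lambda>x. norm (w x) * B)" using w by auto
    show "AE x in torus. (\<lambda>n. w x * q n x) \<longlonglongrightarrow> w x * partial j v x"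
      using lim by (auto intro!: AE_I2 tendsto_intros)
    show "AE x in torus. norm (w x * q n x) \<le> norm (w x) * B" for n
      using bound by (auto intro!: AE_I2 mult_left_mono simp: abs_mult)
  qed measurable
qed

text \<open>Every difference quotient has integral 0 by translation invariance, and these integrals
  converge to that of the derivative.\<close>

lemma integral_partial_eq_0:
  fixes v :: "real^3 \<Rightarrow> real"
  assumes p: "periodic v" and d: "\<And>x. v differentiable (at x)" and c: "continuous_on UNIV (partial j v)"
  shows "(LINT x|torus. partial j v x) = 0"
proof -
  have vc: "continuous_on UNIV v"
    using d by (intro continuous_at_imp_continuous_on) (auto intro: differentiable_imp_continuous_within)
  have 0: "(LINT x|torus. (real (Suc n) * (v (x + (1 / real (Suc n)) *\<^sub>R axis j 1) - v x))) = 0" for n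
    using Ck_translate[of 0 v] vc integral_translate[OF vc p, of "1 / real (Suc n)" j]
    by (simp add: continuous_torus_integrable)
  show ?thesis
    using difference_quotient_limit[OF d c, of "\<lambda>x. 1"] unfolding 0 mult_1 by (simp add: LIMSEQ_const_iff)
qed

section \<open>Trigonometric polynomials and the fundamental lemma of the calculus of
  variations\<close>

definition circles :: "real^3 \<Rightarrow> (real^3) \<times> (real^3)" where
  "circles x = ((\<chi> i. cos (2 * pi * x $ i)), (\<chi> i. sin (2 * pi * x $ i)))"

lemma has_derivative_vec_lambda:
  fixes f :: "'n::finite \<Rightarrow> 'a::real_normed_vector \<Rightarrow> real"
  assumes "\<And>i. (f i has_derivative D i) (at x)"
  shows "((\<lambda>x. \<chi> i. f i x) has_derivative (\<lambda>h. \<chi> i. D i h)) (at x)"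
  by (rule has_derivative_componentwise_within[THEN iffD2])
    (use assms in \<open>auto simp: Basis_vec_def inner_axis\<close>)

text \<open>\<open>circles\<close> embeds the torus in R^6 as a product of three circles, so
  polynomials in it are the trigonometric polynomials. Moving in direction i changes only the i-th
  circle, at a velocity that is a linear image \<open>R i\<close> of the point itself: a quarter
  turn times 2 pi. The class is therefore closed under partial derivatives, and smoothness follows
  by iteration.\<close>

lemma polynomial_circles_derivative:
  assumes "real_polynomial_function p"
  shows "\<exists>D. (\<forall>x. ((\<lambda>x. p (circles x)) has_derivative D x) (at x)) \<and>
    (\<forall>i. \<exists>q. real_polynomial_function q \<and> (\<forall>x. D x (axis i 1) = q (circles x)))"
  using assms
proof induction
  case (linear f)
  define R :: "3 \<Rightarrow> (real^3) \<times> (real^3) \<Rightarrow> (real^3) \<times> (real^3)" where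
    "R i y = (axis i (- 2 * pi * snd y $ i), axis i (2 * pi * fst y $ i))" for i y
  have R: "linear (R i)" for i
    by (auto intro!: linearI simp: R_def axis_def vec_eq_iff algebra_simps)
  define T where "T x h = ((\<chi> i. - sin (2 * pi * x $ i) * (2 * pi * h $ i)),
    (\<chi> i. cos (2 * pi * x $ i) * (2 * pi * h $ i)))" for x h :: "real^3"
  have T: "(circles has_derivative T x) (at x)" for x
    unfolding circles_def[abs_def] T_def
    by (intro has_derivative_Pair has_derivative_vec_lambda) (auto intro!: derivative_eq_intros bounded_linear_imp_has_derivative bounded_linear_vec_nth)
  have "T x (axis i 1) = R i (circles x)" for x i
    by (auto simp: T_def R_def circles_def axis_def vec_eq_iff)
  moreover have "bounded_linear (\<lambda>y. f (R i y))" for i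
    by (rule bounded_linear_compose[OF linear.hyps]) (use R linear_conv_bounded_linear in blast)
  ultimately show ?case
    by (intro exI[of _ "\<lambda>x h. f (T x h)"])
      (use bounded_linear.has_derivative[OF linear.hyps T] in \<open>auto intro!: exI[of _ "\<lambda>y. f (R _ y)"]\<close>)
next
  case (const c)
  show ?case by (rule exI[of _ "\<lambda>x h. 0"]) auto
next
  case (add f g)
  then obtain D E where D: "\<forall>x. ((\<lambda>x. f (circles x)) has_derivative D x) (at x)"
      "\<And>i. \<exists>q. real_polynomial_function q \<and> (\<forall>x. D x (axis i 1) = q (circles x))"
    and E: "\<forall>x. ((\<lambda>x. g (circles x)) has_derivative E x) (at x)"
      "\<And>i. \<exists>q. real_polynomial_function q \<and> (\<forall>x. E x (axis i 1) = q (circles x))" by auto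
  show ?case
  proof (intro exI[of _ "\<lambda>x h. D x h + E x h"] conjI allI)
    show "((\<lambda>x. f (circles x) + g (circles x)) has_derivative (\<lambda>h. D x h + E x h)) (at x)" for x
      using D(1) E(1) by (auto intro!: derivative_intros)
    fix i
    obtain a b where "real_polynomial_function a" "\<forall>x. D x (axis i 1) = a (circles x)"
      "real_polynomial_function b" "\<forall>x. E x (axis i 1) = b (circles x)" using D(2) E(2) by meson
    then show "\<exists>q. real_polynomial_function q \<and> (\<forall>x. D x (axis i 1) + E x (axis i 1) = q (circles x))"
      by (intro exI[of _ "\<lambda>y. a y + b y"]) auto
  qed
next
  case (mult f g)
  then obtain D E where D: "\<forall>x. ((\<lambda>x. f (circles x)) has_derivative D x) (at x)"
      "\<And>i. \<exists>q. real_polynomial_function q \<and> (\<forall>x. D x (axis i 1) = q (circles x))"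
    and E: "\<forall>x. ((\<lambda>x. g (circles x)) has_derivative E x) (at x)"
      "\<And>i. \<exists>q. real_polynomial_function q \<and> (\<forall>x. E x (axis i 1) = q (circles x))" by auto
  show ?case
  proof (intro exI[of _ "\<lambda>x h. f (circles x) * E x h + D x h * g (circles x)"] conjI allI)
    show "((\<lambda>x. f (circles x) * g (circles x)) has_derivative
        (\<lambda>h. f (circles x) * E x h + D x h * g (circles x))) (at x)" for x
      using D(1) E(1) by (auto intro!: derivative_intros)
    fix i
    obtain a b where "real_polynomial_function a" "\<forall>x. D x (axis i 1) = a (circles x)"
      "real_polynomial_function b" "\<forall>x. E x (axis i 1) = b (circles x)" using D(2) E(2) by meson
    then show "\<exists>q. real_polynomial_function q \<and>
        (\<forall>x. f (circles x) * E x (axis i 1) + D x (axis i 1) * g (circles x) = q (circles x))"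
      using mult.hyps by (intro exI[of _ "\<lambda>y. f y * b y + a y * g y"]) auto
  qed
qed

lemma polynomial_circles_test_function:
  assumes "real_polynomial_function p"
  shows "(\<lambda>x. p (circles x)) \<in> test_functions"
proof -
  have "Ck k (\<lambda>x. p (circles x))" for k
    using assms
  proof (induction k arbitrary: p)
    case 0
    obtain D where "\<forall>x. ((\<lambda>x. p (circles x)) has_derivative D x) (at x)"
      using polynomial_circles_derivative[OF 0] by blast
    then show ?case
      by (auto intro!: continuous_at_imp_continuous_on has_derivative_continuous)
  next
    case (Suc k)
    obtain D where D: "\<forall>x. ((\<lambda>x. p (circles x)) has_derivative D x) (at x)"
      "\<And>i. \<exists>q. real_polynomial_function q \<and> (\<forall>x. D x (axis i 1) = q (circles x))"
      using polynomial_circles_derivative[OF Suc.prems] by blast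
    have "Ck k (partial i (\<lambda>x. p (circles x)))" for i
    proof -
      obtain q where q: "real_polynomial_function q" "\<forall>x. D x (axis i 1) = q (circles x)"
        using D(2) by blast
      have "partial i (\<lambda>x. p (circles x)) = (\<lambda>x. q (circles x))"
        using partial_eqI[OF D(1)[rule_format]] q(2) by auto
      then show ?thesis using Suc.IH[OF q(1)] by simp
    qed
    moreover have "(\<lambda>x. p (circles x)) differentiable (at x)" for x
      using D(1) by (auto simp: differentiable_def)
    ultimately show ?case by simp
  qed
  moreover have "circles (x + axis i 1) = circles x" for x i
    by (auto simp: circles_def axis_def vec_eq_iff distrib_left cos_add sin_add)
  ultimately show ?thesis by (auto simp: test_functions_def periodic_def)
qed

lemma continuous_circles: "continuous_on UNIV circles"
  unfolding circles_def by (intro continuous_intros)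

text \<open>Equal cosines and sines make coordinate differences integers. Opposite faces of the cell
  have the same image, so one of the two points must be interior; this forces the differences below
  1.\<close>

lemma circles_inj:
  assumes "circles x = circles y" "x \<in> cbox 0 1" "y \<in> box 0 1"
  shows "x = y"
proof -
  have "x $ i = y $ i" for i
  proof -
    have eq: "cos (2 * pi * x $ i) = cos (2 * pi * y $ i)" "sin (2 * pi * x $ i) = sin (2 * pi * y $ i)"
      using assms(1) by (auto simp: circles_def vec_eq_iff)
    have "cos (2 * pi * x $ i - 2 * pi * y $ i) = 1"
      using sin_cos_squared_add3[of "2 * pi * y $ i"] by (simp add: cos_diff eq)
    then obtain n :: int where "2 * pi * x $ i - 2 * pi * y $ i = real_of_int n * 2 * pi"
      unfolding cos_one_2pi_int by blast
    then have "2 * pi * (x $ i - y $ i) = 2 * pi * n" by (simp add: algebra_simps)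
    then have n: "x $ i - y $ i = n" by simp
    moreover have "\<bar>x $ i - y $ i\<bar> < 1"
    proof -
      have "0 \<le> x $ i" "x $ i \<le> 1" "0 < y $ i" "y $ i < 1" using assms(2,3) by (auto simp: mem_box_cart)
      then show ?thesis by (simp add: abs_if)
    qed
    ultimately have "n = 0" by simp
    with n show ?thesis by simp
  qed
  then show ?thesis by (simp add: vec_eq_iff)
qed

text \<open>By Stone-Weierstrass on the compact image of the cell, \<open>g\<close> is orthogonal to
  every continuous function of \<open>circles x\<close>. The cut-offs max(0, 1 - n dist) around the
  image of \<open>K\<close> decrease to its indicator, and since \<open>K\<close> avoids the
  boundary of the cell, only points of \<open>K\<close> are mapped into that image.\<close>

lemma integral_compact_eq_0:
  fixes g :: "real^3 \<Rightarrow> real"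
  assumes g: "integrable torus g"
    and 0: "\<And>\<psi>. \<psi> \<in> test_functions \<Longrightarrow> (LINT x|torus. g x * \<psi> x) = 0"
    and K: "compact K" "K \<subseteq> box 0 1"
  shows "(LINT x|torus. g x * indicator K x) = 0"
proof (cases "K = {}")
  case False
  have [measurable]: "g \<in> borel_measurable torus" using g by (rule borel_measurable_integrable)
  have cont: "(LINT x|torus. g x * c (circles x)) = 0" if c: "continuous_on UNIV c" for c
  proof -
    define S where "S = circles ` cbox 0 1"
    have "compact S" unfolding S_def
      by (intro compact_continuous_image continuous_on_subset[OF continuous_circles]) auto
    have "\<exists>p. real_polynomial_function p \<and> (\<forall>y\<in>S. \<bar>c y - p y\<bar> < 1 / real (Suc n))" for n
      using Stone_Weierstrass_real_polynomial_function[OF \<open>compact S\<close> continuous_on_subset[OF c], of "1 / real (Suc n)"]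
      by (metis subset_UNIV zero_less_divide_1_iff of_nat_0_less_iff zero_less_Suc)
    then obtain p where p: "\<And>n. real_polynomial_function (p n)"
      "\<And>n y. y \<in> S \<Longrightarrow> \<bar>c y - p n y\<bar> < 1 / real (Suc n)" by metis
    have cc: "continuous_on UNIV (\<lambda>x. c (circles x))"
      by (rule continuous_on_compose2[OF c continuous_circles]) auto
    have [measurable]: "(\<lambda>x. c (circles x)) \<in> borel_measurable torus"
      using borel_measurable_integrable[OF continuous_torus_integrable[OF cc]] .
    have [measurable]: "(\<lambda>x. p n (circles x)) \<in> borel_measurable torus" for n
      using borel_measurable_integrable[OF continuous_torus_integrable[OF test_functions_continuous[OF polynomial_circles_test_function[OF p(1)]]]] .
    have "bounded (c ` S)" 
      by (intro compact_imp_bounded compact_continuous_image continuous_on_subset[OF c] \<open>compact S\<close>) auto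
    then obtain B where B: "\<And>y. y \<in> S \<Longrightarrow> \<bar>c y\<bar> \<le> B" by (auto simp: bounded_iff)
    have "(\<lambda>n. LINT x|torus. g x * p n (circles x)) \<longlonglongrightarrow> (LINT x|torus. g x * c (circles x))"
    proof (rule integral_dominated_convergence)
      show "integrable torus (\<lambda>x. norm (g x) * (B + 1))" using g by auto
      have "(\<lambda>n. p n y) \<longlonglongrightarrow> c y" if "y \<in> S" for y
      proof -
        have "(\<lambda>n. p n y - c y) \<longlonglongrightarrow> 0"
          by (rule Lim_null_comparison[OF always_eventually LIMSEQ_Suc[OF lim_1_over_n]])
            (use p(2)[OF that] in \<open>auto simp: abs_minus_commute intro: less_imp_le\<close>)
        then show ?thesis by (rule LIM_zero_cancel)
      qed
      then show "AE x in torus. (\<lambda>n. g x * p n (circles x)) \<longlonglongrightarrow> g x * c (circles x)"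
        by (intro AE_I2 tendsto_mult tendsto_const) (simp add: S_def)
      show "AE x in torus. norm (g x * p n (circles x)) \<le> norm (g x) * (B + 1)" for n
      proof (rule AE_I2)
        fix x assume "x \<in> space torus"
        then have S: "circles x \<in> S" by (auto simp: S_def)
        have "1 / real (Suc n) \<le> 1" by simp
        then have "\<bar>p n (circles x)\<bar> \<le> B + 1" using B[OF S] p(2)[OF S, of n] by linarith
        then show "norm (g x * p n (circles x)) \<le> norm (g x) * (B + 1)"
          by (auto simp: abs_mult intro: mult_left_mono)
      qed
    qed measurable
    then show ?thesis using 0[OF polynomial_circles_test_function[OF p(1)]] by (simp add: LIMSEQ_const_iff)
  qed
  define A where "A = circles ` K"
  have A: "compact A" "A \<noteq> {}"
    using False K unfolding A_def
    by (auto intro!: compact_continuous_image continuous_on_subset[OF continuous_circles])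
  define c where "c n y = max 0 (1 - real n * infdist y A)" for n y
  have cc: "continuous_on UNIV (c n)" for n unfolding c_def by (intro continuous_intros)
  have ccc: "continuous_on UNIV (\<lambda>x. c n (circles x))" for n
    by (rule continuous_on_compose2[OF cc continuous_circles]) auto
  have [measurable]: "(\<lambda>x. c n (circles x)) \<in> borel_measurable torus" for n
    using borel_measurable_integrable[OF continuous_torus_integrable[OF ccc]] .
  have [measurable]: "K \<in> sets torus"
    using K compact_imp_closed[OF K(1)] box_subset_cbox
    by (subst sets_restrict_space_iff) auto
  have "(\<lambda>n. LINT x|torus. g x * c n (circles x)) \<longlonglongrightarrow> (LINT x|torus. g x * indicator K x)"
  proof (rule integral_dominated_convergence)
    show "integrable torus (\<lambda>x. norm (g x))" using g by auto
    show "AE x in torus. (\<lambda>n. g x * c n (circles x)) \<longlonglongrightarrow> g x * indicator K x"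
    proof (intro AE_I2 tendsto_intros)
      fix x assume "x \<in> space torus"
      then have x: "x \<in> cbox 0 1" by simp
      show "(\<lambda>n. c n (circles x)) \<longlonglongrightarrow> indicator K x"
      proof (cases "x \<in> K")
        case True
        then have "infdist (circles x) A = 0" by (auto simp: A_def)
        then show ?thesis using True by (simp add: c_def)
      next
        case False
        then have "circles x \<notin> A" using circles_inj x K(2) by (auto simp: A_def)
        then have "infdist (circles x) A > 0"
          using infdist_pos_not_in_closed[OF compact_imp_closed[OF A(1)] A(2)] by blast
        then have pos: "infdist (circles x) A > 0" .
        have "\<forall>\<^sub>F n in sequentially. c n (circles x) = 0"
          using eventually_ge_at_top[of "nat \<lceil>1 / infdist (circles x) A\<rceil>"]
        proof eventually_elim
          case (elim n)
          then have "1 / infdist (circles x) A \<le> real n" by linarith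
          then have "1 \<le> real n * infdist (circles x) A" using pos by (simp add: field_simps)
          then show ?case by (simp add: c_def)
        qed
        then show ?thesis using False by (simp add: tendsto_eventually)
      qed
    qed
    show "AE x in torus. norm (g x * c n (circles x)) \<le> norm (g x)" for n
    proof (rule AE_I2)
      fix x
      have "\<bar>c n (circles x)\<bar> \<le> 1" using infdist_nonneg[of "circles x" A] by (auto simp: c_def)
      then show "norm (g x * c n (circles x)) \<le> norm (g x)"
        by (auto simp: abs_mult intro: mult_left_le)
    qed
  qed measurable
  then show ?thesis using cont[OF cc] by (simp add: LIMSEQ_const_iff)
qed simp

text \<open>Up to a null set, the part of the open cell where g is positive is a countable union of
  compact sets. On each of them g is positive with integral 0, so each is null. The same applies to
  -g, and the boundary of the cell is a null set.\<close>

lemma fundamental_lemma: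
  fixes g :: "real^3 \<Rightarrow> real"
  assumes g: "integrable torus g"
    and 0: "\<And>\<psi>. \<psi> \<in> test_functions \<Longrightarrow> (LINT x|torus. g x * \<psi> x) = 0"
  shows "AE x in torus. g x = 0"
proof -
  have *: "AE x in torus. g x \<le> 0" if g: "integrable torus g"
    and 0: "\<And>\<psi>. \<psi> \<in> test_functions \<Longrightarrow> (LINT x|torus. g x * \<psi> x) = 0" for g :: "real^3 \<Rightarrow> real"
  proof -
    have [measurable]: "g \<in> borel_measurable torus" using g by (rule borel_measurable_integrable)
    define P where "P = {x \<in> cbox 0 1. g x > 0} \<inter> box 0 1"
    have "{x \<in> space torus. g x > 0} \<in> sets torus" by measurable
    then have "{x \<in> cbox 0 1. g x > 0} \<in> sets lebesgue"
      by (subst (asm) sets_restrict_space_iff) auto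
    then have "P \<in> sets lebesgue" unfolding P_def by auto
    then obtain C T where CT: "fsigma C" "T \<in> null_sets lebesgue" "C \<union> T = P"
      using lebesgue_set_almost_fsigma by metis
    obtain F :: "nat \<Rightarrow> (real^3) set" where F: "range F \<subseteq> Collect compact" "C = \<Union>(range F)"
      using fsigma_Union_compact CT(1) by metis
    have "AE x in torus. x \<notin> F n" for n
    proof -
      have sub: "F n \<subseteq> P" using F CT by auto
      have "compact (F n)" using F(1) by auto
      then have [measurable]: "F n \<in> sets torus"
        using compact_imp_closed[of "F n"] sub
        by (subst sets_restrict_space_iff) (auto simp: P_def)
      have "(LINT x|torus. g x * indicator (F n) x) = 0"
        by (rule integral_compact_eq_0[OF g 0]) (use F(1) sub in \<open>auto simp: P_def\<close>)
      moreover have "integrable torus (\<lambda>x. g x * indicator (F n) x)"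
        using integrable_mult_indicator[OF _ g, of "F n"] by (simp add: mult.commute)
      moreover have "AE x in torus. 0 \<le> g x * indicator (F n) x"
        using sub by (auto intro!: AE_I2 simp: P_def indicator_def)
      ultimately have "AE x in torus. g x * indicator (F n) x = 0"
        using integral_nonneg_eq_0_iff_AE by blast
      then show ?thesis
        by eventually_elim (use sub in \<open>auto simp: P_def indicator_def split: if_splits\<close>)
    qed
    then have "AE x in torus. \<forall>n. x \<notin> F n" by (simp add: AE_all_countable)
    moreover have "AE x in torus. x \<notin> T"
      using AE_not_in[OF CT(2)] by (subst AE_restrict_space_iff) auto
    moreover have "AE x in torus. x \<notin> cbox 0 1 - box 0 1"
      using AE_not_in[of "cbox 0 1 - box 0 1" lebesgue] negligible_frontier_interval[of 0 "1 :: real^3"]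
      by (subst AE_restrict_space_iff) (auto simp: negligible_iff_null_sets)
    moreover have "AE x in torus. x \<in> cbox 0 1" by (auto intro!: AE_I2)
    ultimately show ?thesis
    proof eventually_elim
      case (elim x)
      then have "x \<notin> P" using CT(3) F(2) by auto
      then show ?case using elim by (auto simp: P_def)
    qed
  qed
  have "AE x in torus. - g x \<le> 0" using g 0 by (intro *) auto
  moreover have "AE x in torus. g x \<le> 0" using g 0 by (intro *) auto
  ultimately show ?thesis by eventually_elim auto
qed

lemma integrable_mult_Linf:
  fixes w \<phi> :: "real^3 \<Rightarrow> real"
  assumes "integrable torus w" "\<phi> \<in> Linf"
  shows "integrable torus (\<lambda>x. w x * \<phi> x)"
proof (rule Bochner_Integration.integrable_bound)
  show "integrable torus (\<lambda>x. norm (w x) * Linf_norm \<phi>)" using assms by auto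
  have [measurable]: "w \<in> borel_measurable torus" "\<phi> \<in> borel_measurable torus"
    using assms by (auto intro: periodic_measurable_torus Linf_measurable)
  show "(\<lambda>x. w x * \<phi> x) \<in> borel_measurable torus" by measurable
  show "AE x in torus. norm (w x * \<phi> x) \<le> norm (norm (w x) * Linf_norm \<phi>)"
    using Linf_AE_norm[OF assms(2)]
    by eventually_elim (auto simp: abs_mult Linf_norm_nonneg intro: mult_left_mono)
qed

lemma integrable_vec_nth:
  "integrable M u \<Longrightarrow> integrable M (\<lambda>x. u x $ i)"
  by (rule integrable_bounded_linear[OF bounded_linear_vec_nth])

text \<open>The difference of the two gradients annihilates all test functions. Consequently the
  arbitrary choice made in \<open>weak_gradient\<close> can be replaced, almost everywhere, by any
  gradient that is at hand.\<close>

lemma weak_gradient_cong: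
  assumes "has_weak_gradient u G" "has_weak_gradient u' G'" "AE x in torus. u x = u' x"
  shows "AE x in torus. G x = G' x"
proof -
  have L: "integrable torus u" "integrable torus u'" "integrable torus G" "integrable torus G'"
    using assms by (auto simp: has_weak_gradient_def Lp1_iff)
  have "AE x in torus. G x $ i $ j - G' x $ i $ j = 0" for i j
  proof (rule fundamental_lemma)
    show "integrable torus (\<lambda>x. G x $ i $ j - G' x $ i $ j)"
      using L by (intro Bochner_Integration.integrable_diff integrable_vec_nth)
    fix \<psi> :: "real^3 \<Rightarrow> real" assume \<psi>: "\<psi> \<in> test_functions"
    have "(LINT x|torus. (G x $ i $ j - G' x $ i $ j) * \<psi> x) =
        (LINT x|torus. G x $ i $ j * \<psi> x) - (LINT x|torus. G' x $ i $ j * \<psi> x)"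
      unfolding left_diff_distrib
      by (intro Bochner_Integration.integral_diff integrable_mult_Linf integrable_vec_nth L test_functions_Linf \<psi>)
    also have "\<dots> = (LINT x|torus. u' x $ i * partial j \<psi> x) - (LINT x|torus. u x $ i * partial j \<psi> x)"
      using assms(1,2) \<psi> by (simp add: has_weak_gradient_def)
    also have "(LINT x|torus. u' x $ i * partial j \<psi> x) = (LINT x|torus. u x $ i * partial j \<psi> x)"
    proof (rule integral_cong_AE)
      show "AE x in torus. u' x $ i * partial j \<psi> x = u x $ i * partial j \<psi> x"
        using assms(3) by eventually_elim simp
    qed (intro borel_measurable_integrable integrable_mult_Linf integrable_vec_nth L test_functions_Linf
        test_functions_partial \<psi>)+
    finally show "(LINT x|torus. (G x $ i $ j - G' x $ i $ j) * \<psi> x) = 0" by simp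
  qed
  then have "AE x in torus. \<forall>i j. G x $ i $ j - G' x $ i $ j = 0" by (simp add: AE_all_countable)
  then show ?thesis by eventually_elim (simp add: vec_eq_iff)
qed

subsection \<open>Weak gradients\<close>

lemma jacobian_nth: "jacobian \<Phi> (at x) $ i $ j = partial j \<Phi> x $ i"
  by (simp add: jacobian_def matrix_def partial_def)

lemma jacobian_const: "jacobian (\<lambda>x. c :: real^3) (at (x :: real^3)) = 0"
  by (simp add: vec_eq_iff jacobian_nth partial_const)

lemma jacobian_comb:
  assumes "\<Phi> \<in> test_functions" "\<Psi> \<in> test_functions"
  shows "jacobian (\<lambda>x. a *\<^sub>R \<Phi> x + b *\<^sub>R \<Psi> x) (at x) = a *\<^sub>R jacobian \<Phi> (at x) + b *\<^sub>R jacobian \<Psi> (at x)"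
  using partial_comb[OF test_functions_differentiable test_functions_differentiable, OF assms]
  by (simp add: vec_eq_iff jacobian_nth)

lemma jacobian_Linf:
  fixes \<Phi> :: "real^3 \<Rightarrow> real^3"
  assumes "\<Phi> \<in> test_functions"
  shows "(\<lambda>x. jacobian \<Phi> (at x)) \<in> Linf"
proof (rule continuous_periodic_Linf)
  have eq: "jacobian \<Phi> (at x) = (\<chi> i j. partial j \<Phi> x $ i)" for x by (simp add: vec_eq_iff jacobian_nth)
  show "continuous_on UNIV (\<lambda>x. jacobian \<Phi> (at x))"
    unfolding eq by (intro continuous_intros test_functions_continuous test_functions_partial assms)
  show "periodic (\<lambda>x. jacobian \<Phi> (at x))"
    using test_functions_periodic[OF test_functions_partial[OF assms]] by (simp add: periodic_def eq)
qed

lemma has_weak_gradient_measurable: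
  assumes "has_weak_gradient u G"
  shows "u \<in> periodic_measurable" "G \<in> periodic_measurable" "integrable torus u" "integrable torus G"
  using assms by (auto simp: has_weak_gradient_def Lp1_iff)

lemma has_weak_gradient_comb:
  assumes "has_weak_gradient u G" "has_weak_gradient v H"
  shows "has_weak_gradient (\<lambda>x. a *\<^sub>R u x + b *\<^sub>R v x) (\<lambda>x. a *\<^sub>R G x + b *\<^sub>R H x)"
  unfolding has_weak_gradient_def
proof (intro conjI ballI allI)
  show "(\<lambda>x. a *\<^sub>R u x + b *\<^sub>R v x) \<in> Lp 1" "(\<lambda>x. a *\<^sub>R G x + b *\<^sub>R H x) \<in> Lp 1"
    using assms by (auto simp: has_weak_gradient_def intro!: Lp_comb)
  fix \<phi> :: "real^3 \<Rightarrow> real" and i j assume \<phi>: "\<phi> \<in> test_functions"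
  note int = has_weak_gradient_measurable(3,4)[OF assms(1)] has_weak_gradient_measurable(3,4)[OF assms(2)]
  have "integrable torus (\<lambda>x. w x * \<phi> x)" "integrable torus (\<lambda>x. w x * partial j \<phi> x)"
    if "integrable torus w" for w
    using that \<phi> by (auto intro!: integrable_mult_Linf test_functions_Linf test_functions_partial)
  then show "(LINT x|torus. (a *\<^sub>R u x + b *\<^sub>R v x) $ i * partial j \<phi> x) =
      - (LINT x|torus. (a *\<^sub>R G x + b *\<^sub>R H x) $ i $ j * \<phi> x)"
    using assms \<phi> int(1,3)[THEN integrable_vec_nth] int(2,4)[THEN integrable_vec_nth, THEN integrable_vec_nth]
    by (simp add: has_weak_gradient_def distrib_right mult.assoc)
qed

lemma has_weak_gradient_zero: "has_weak_gradient (\<lambda>x. 0) (\<lambda>x. 0)"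
  by (simp add: has_weak_gradient_def)

lemma W13_weak_gradient:
  assumes "u \<in> W13"
  shows "has_weak_gradient u (weak_gradient u)" "weak_gradient u \<in> Lp 3"
proof -
  obtain G where G: "has_weak_gradient u G" "G \<in> Lp 3" using assms by (auto simp: W13_def)
  show *: "has_weak_gradient u (weak_gradient u)" unfolding weak_gradient_def using someI[of "has_weak_gradient u", OF G(1)] .
  show "weak_gradient u \<in> Lp 3"
    by (rule Lp_cong_AE(1)[OF _ has_weak_gradient_measurable(2)[OF *] G(2) weak_gradient_cong[OF * G(1)]]) auto
qed

lemma weak_gradient_eq:
  assumes "has_weak_gradient u G" "G \<in> Lp 3"
  shows "u \<in> W13" "AE x in torus. weak_gradient u x = G x" "Lp_norm 3 (weak_gradient u) = Lp_norm 3 G"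
proof -
  show W: "u \<in> W13" using assms by (auto simp: W13_def)
  show *: "AE x in torus. weak_gradient u x = G x"
    by (rule weak_gradient_cong[OF W13_weak_gradient(1)[OF W] assms(1)]) auto
  show "Lp_norm 3 (weak_gradient u) = Lp_norm 3 G"
    by (rule Lp_cong_AE(2)[OF _ has_weak_gradient_measurable(2)[OF W13_weak_gradient(1)[OF W]] assms(2) *]) auto
qed

lemma weak_gradient_comb:
  assumes "u \<in> W13" "v \<in> W13"
  shows "(\<lambda>x. a *\<^sub>R u x + b *\<^sub>R v x) \<in> W13"
    and "AE x in torus. weak_gradient (\<lambda>x. a *\<^sub>R u x + b *\<^sub>R v x) x = a *\<^sub>R weak_gradient u x + b *\<^sub>R weak_gradient v x"
    and "Lp_norm 3 (weak_gradient (\<lambda>x. a *\<^sub>R u x + b *\<^sub>R v x)) \<le>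
      \<bar>a\<bar> * Lp_norm 3 (weak_gradient u) + \<bar>b\<bar> * Lp_norm 3 (weak_gradient v)"
proof -
  let ?G = "\<lambda>x. a *\<^sub>R weak_gradient u x + b *\<^sub>R weak_gradient v x"
  note u = W13_weak_gradient[OF assms(1)] and v = W13_weak_gradient[OF assms(2)]
  have "?G \<in> Lp 3" using u v by (intro Lp_comb) auto
  note * = weak_gradient_eq[OF has_weak_gradient_comb[OF u(1) v(1)] this]
  show "(\<lambda>x. a *\<^sub>R u x + b *\<^sub>R v x) \<in> W13"
    "AE x in torus. weak_gradient (\<lambda>x. a *\<^sub>R u x + b *\<^sub>R v x) x = ?G x" by fact+
  have "Lp_norm 3 ?G \<le> Lp_norm 3 (\<lambda>x. a *\<^sub>R weak_gradient u x) + Lp_norm 3 (\<lambda>x. b *\<^sub>R weak_gradient v x)"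
    using u v by (intro Lp_add Lp_scaleR) auto
  then show "Lp_norm 3 (weak_gradient (\<lambda>x. a *\<^sub>R u x + b *\<^sub>R v x)) \<le>
      \<bar>a\<bar> * Lp_norm 3 (weak_gradient u) + \<bar>b\<bar> * Lp_norm 3 (weak_gradient v)"
    using *(3) Lp_scaleR(2)[OF u(2), of a] Lp_scaleR(2)[OF v(2), of b] by simp
qed

lemma X_comb:
  assumes "u \<in> Linf \<inter> W13" "v \<in> Linf \<inter> W13"
  shows "(\<lambda>x. a *\<^sub>R u x + b *\<^sub>R v x) \<in> Linf \<inter> W13"
    and "X_norm (\<lambda>x. a *\<^sub>R u x + b *\<^sub>R v x) \<le> \<bar>a\<bar> * X_norm u + \<bar>b\<bar> * X_norm v"
proof -
  have "u \<in> Linf" "v \<in> Linf" "u \<in> W13" "v \<in> W13" using assms by auto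
  note * = Linf_comb[OF this(1,2), of a b] weak_gradient_comb[OF this(3,4), of a b]
  then show "(\<lambda>x. a *\<^sub>R u x + b *\<^sub>R v x) \<in> Linf \<inter> W13" by blast
  show "X_norm (\<lambda>x. a *\<^sub>R u x + b *\<^sub>R v x) \<le> \<bar>a\<bar> * X_norm u + \<bar>b\<bar> * X_norm v"
    using *(2,5) unfolding X_norm_def by (simp add: algebra_simps)
qed

lemma X_add:
  assumes "u \<in> Linf \<inter> W13" "v \<in> Linf \<inter> W13"
  shows "(\<lambda>x. u x + v x) \<in> Linf \<inter> W13" "X_norm (\<lambda>x. u x + v x) \<le> X_norm u + X_norm v"
  using X_comb[OF assms, of 1 1] by auto

lemma X_diff:
  assumes "u \<in> Linf \<inter> W13" "v \<in> Linf \<inter> W13"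
  shows "(\<lambda>x. u x - v x) \<in> Linf \<inter> W13" "X_norm (\<lambda>x. u x - v x) \<le> X_norm u + X_norm v"
  using X_comb[OF assms, of 1 "-1"] by auto

lemma X_norm_nonneg: "0 \<le> X_norm u"
  by (simp add: X_norm_def Linf_norm_nonneg)

lemma X_zero: "(\<lambda>x. 0) \<in> Linf \<inter> W13" "X_norm (\<lambda>x. 0) = 0"
proof -
  have L: "(\<lambda>x. 0 :: real^3) \<in> Linf" "Linf_norm (\<lambda>x. 0 :: real^3) \<le> 0"
    by (auto simp: Linf_iff intro: Linf_norm_leI)
  note W = weak_gradient_eq[OF has_weak_gradient_zero]
  show "(\<lambda>x. 0) \<in> Linf \<inter> W13" using L W(1) by auto
  show "X_norm (\<lambda>x. 0) = 0" using L(2) W(3) Linf_norm_nonneg[of "\<lambda>x. 0 :: real^3"] by (simp add: X_norm_def)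
qed

subsection \<open>The weak curl\<close>

lemma linear_curl_of_gradient: "linear curl_of_gradient"
  by (rule linearI) (auto simp: curl_of_gradient_def vec_eq_iff forall_3 algebra_simps)

lemma bounded_linear_curl_of_gradient: "bounded_linear curl_of_gradient"
  using linear_curl_of_gradient by (simp add: linear_conv_bounded_linear)

lemmas curl_of_gradient_simps =
  linear_add[OF linear_curl_of_gradient] linear_diff[OF linear_curl_of_gradient]
  linear_scale[OF linear_curl_of_gradient] linear_0[OF linear_curl_of_gradient]

lemma curl_of_gradient_Lp:
  assumes "G \<in> Lp 3"
  shows "(\<lambda>x. curl_of_gradient (G x)) \<in> Lp 3"
    and "Lp_norm 3 (\<lambda>x. curl_of_gradient (G x)) \<le> onorm curl_of_gradient * Lp_norm 3 G"
  by (rule Lp_linear[OF linear_curl_of_gradient _ assms], simp)+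

lemma weak_curl_Lp:
  assumes "u \<in> W13"
  shows "weak_curl u \<in> Lp 3" and "Lp_norm 3 (weak_curl u) \<le> onorm curl_of_gradient * Lp_norm 3 (weak_gradient u)"
  unfolding weak_curl_def[abs_def] using curl_of_gradient_Lp[OF W13_weak_gradient(2)[OF assms]] .

lemma weak_curl_eq:
  assumes "has_weak_gradient u G" "G \<in> Lp 3"
  shows "AE x in torus. weak_curl u x = curl_of_gradient (G x)"
  using weak_gradient_eq(2)[OF assms] by eventually_elim (simp add: weak_curl_def)

lemma weak_curl_comb:
  assumes "u \<in> W13" "v \<in> W13"
  shows "AE x in torus. weak_curl (\<lambda>x. a *\<^sub>R u x + b *\<^sub>R v x) x = a *\<^sub>R weak_curl u x + b *\<^sub>R weak_curl v x"
  using weak_gradient_comb(2)[OF assms, of a b]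
  by eventually_elim (simp add: weak_curl_def curl_of_gradient_simps)

text \<open>One of the two derivatives is replaced by difference quotients, which commute with the
  other one; no symmetry of second derivatives is needed.\<close>

lemma weak_gradient_mixed:
  assumes u: "has_weak_gradient u G" and \<phi>: "\<phi> \<in> test_functions"
  shows "(LINT x|torus. G x $ k $ i * partial j \<phi> x) = (LINT x|torus. G x $ k $ j * partial i \<phi> x)"
proof -
  have byparts: "(LINT x|torus. u x $ k * partial j \<phi> x) = - (LINT x|torus. G x $ k $ j * \<phi> x)"
    if "\<phi> \<in> test_functions" for \<phi> j using u that by (simp add: has_weak_gradient_def)
  note int = has_weak_gradient_measurable(3,4)[OF u, THEN integrable_vec_nth]
  define q where "q n x = real (Suc n) *\<^sub>R \<phi> (x + (1 / real (Suc n)) *\<^sub>R axis j 1) + (- real (Suc n)) *\<^sub>R \<phi> x" for n x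
  have q: "q n \<in> test_functions" for n
    unfolding q_def by (intro test_functions_comb test_functions_translate \<phi>)
  have pq: "partial i (q n) = (\<lambda>x. real (Suc n) * (partial i \<phi> (x + (1 / real (Suc n)) *\<^sub>R axis j 1) - partial i \<phi> x))" for n
    unfolding q_def using test_functions_differentiable[OF \<phi>] test_functions_differentiable[OF test_functions_translate[OF \<phi>]]
    by (simp only: partial_comb partial_translate) (simp add: algebra_simps)
  have "(\<lambda>n. LINT x|torus. u x $ k * partial i (q n) x) \<longlonglongrightarrow> (LINT x|torus. u x $ k * partial j (partial i \<phi>) x)"
    unfolding pq
    by (intro difference_quotient_limit test_functions_differentiable test_functions_continuous test_functions_partial \<phi> int)
  moreover have "(\<lambda>n. LINT x|torus. G x $ k $ i * q n x) \<longlonglongrightarrow> (LINT x|torus. G x $ k $ i * partial j \<phi> x)"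
  proof -
    have "q n = (\<lambda>x. real (Suc n) * (\<phi> (x + (1 / real (Suc n)) *\<^sub>R axis j 1) - \<phi> x))" for n
      by (auto simp: q_def algebra_simps)
    then show ?thesis
      by (simp only:) (intro difference_quotient_limit test_functions_differentiable test_functions_continuous
        test_functions_partial \<phi> integrable_vec_nth int)
  qed
  then have "(\<lambda>n. - (LINT x|torus. G x $ k $ i * q n x)) \<longlonglongrightarrow> - (LINT x|torus. G x $ k $ i * partial j \<phi> x)"
    by (rule tendsto_minus)
  ultimately have "(LINT x|torus. u x $ k * partial j (partial i \<phi>) x) = - (LINT x|torus. G x $ k $ i * partial j \<phi> x)"
    using byparts[OF q] by (simp add: LIMSEQ_unique)
  then show ?thesis using byparts[OF test_functions_partial[OF \<phi>], of j i] by simp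
qed

text \<open>The divergence of a curl vanishes in the weak sense: tested with the gradient of \<phi>,
  the six terms cancel in pairs by \<open>weak_gradient_mixed\<close>. The mean vanishes because
  testing the weak gradient with the constant 1 shows that all its components have integral
  0.\<close>

lemma curl_Lp_sharp:
  assumes u: "has_weak_gradient u G" and G: "G \<in> Lp 3"
  shows "(\<lambda>x. curl_of_gradient (G x)) \<in> Lp_sharp 3"
proof -
  have L: "(\<lambda>x. curl_of_gradient (G x)) \<in> Lp 3"
    using G by (rule curl_of_gradient_Lp)
  have int: "integrable torus (\<lambda>x. G x $ i $ j)" for i j
    using has_weak_gradient_measurable(4)[OF u] by (intro integrable_vec_nth)
  have "div_free (\<lambda>x. curl_of_gradient (G x))"
    unfolding div_free_def
  proof
    fix \<phi> :: "real^3 \<Rightarrow> real" assume \<phi>: "\<phi> \<in> test_functions"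
    have int2: "integrable torus (\<lambda>x. G x $ i $ j * partial k \<phi> x)" for i j k
      by (intro integrable_mult_Linf int test_functions_Linf test_functions_partial \<phi>)
    have "(LINT x|torus. (\<Sum>i\<in>UNIV. curl_of_gradient (G x) $ i * partial i \<phi> x)) =
      (LINT x|torus. (G x $ 3 $ 2 * partial 1 \<phi> x - G x $ 2 $ 3 * partial 1 \<phi> x) +
        (G x $ 1 $ 3 * partial 2 \<phi> x - G x $ 3 $ 1 * partial 2 \<phi> x) +
        (G x $ 2 $ 1 * partial 3 \<phi> x - G x $ 1 $ 2 * partial 3 \<phi> x))"
      by (simp add: sum_3 curl_of_gradient_def algebra_simps)
    also have "\<dots> = 0"
      using int2 weak_gradient_mixed[OF u \<phi>, of 3 2 1] weak_gradient_mixed[OF u \<phi>, of 2 3 1]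
        weak_gradient_mixed[OF u \<phi>, of 1 3 2] by simp
    finally show "(LINT x|torus. (\<Sum>i\<in>UNIV. curl_of_gradient (G x) $ i * partial i \<phi> x)) = 0" .
  qed
  moreover have "(LINT x|torus. curl_of_gradient (G x)) = 0"
  proof -
    have 0: "(LINT x|torus. G x $ i $ j) = 0" for i j
      using u test_functions_const[of "1 :: real"] by (fastforce simp: has_weak_gradient_def partial_const)
    have intG: "integrable torus G" using has_weak_gradient_measurable(4)[OF u] .
    have "(LINT x|torus. G x) $ i $ j = (LINT x|torus. G x $ i $ j)" for i j
      using integral_bounded_linear[OF bounded_linear_vec_nth intG, of i]
        integral_bounded_linear[OF bounded_linear_vec_nth integrable_vec_nth[OF intG, of i], of j] by simp
    then have "(LINT x|torus. G x) = 0" using 0 by (simp add: vec_eq_iff)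
    then show ?thesis
      using integral_bounded_linear[OF bounded_linear_curl_of_gradient intG] by (simp add: curl_of_gradient_simps)
  qed
  ultimately show ?thesis using L by (simp add: Lp_sharp_def)
qed

lemma Lp_sharp_comb:
  assumes f: "f \<in> Lp_sharp 3" and g: "g \<in> Lp_sharp 3"
  shows "(\<lambda>x. a *\<^sub>R f x + b *\<^sub>R g x) \<in> Lp_sharp 3"
proof -
  have L: "f \<in> Lp 3" "g \<in> Lp 3" using f g by (auto simp: Lp_sharp_def)
  have int: "integrable torus f" "integrable torus g" using L by (auto intro: Lp_integrable1)
  have "div_free (\<lambda>x. a *\<^sub>R f x + b *\<^sub>R g x)"
    unfolding div_free_def
  proof
    fix \<phi> :: "real^3 \<Rightarrow> real" assume \<phi>: "\<phi> \<in> test_functions"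
    have int2: "integrable torus (\<lambda>x. h x $ i * partial i \<phi> x)" if "integrable torus h" for h i
      using that by (intro integrable_mult_Linf integrable_vec_nth test_functions_Linf test_functions_partial \<phi>)
    have int3: "integrable torus (\<lambda>x. \<Sum>i\<in>UNIV. h x $ i * partial i \<phi> x)" if "integrable torus h" for h
      using that int2 by auto
    have "(LINT x|torus. (\<Sum>i\<in>UNIV. (a *\<^sub>R f x + b *\<^sub>R g x) $ i * partial i \<phi> x)) =
      (LINT x|torus. a * (\<Sum>i\<in>UNIV. f x $ i * partial i \<phi> x) + b * (\<Sum>i\<in>UNIV. g x $ i * partial i \<phi> x))"
      by (simp add: distrib_right sum.distrib sum_distrib_left mult.assoc)
    also have "\<dots> = 0"
      using int3[OF int(1)] int3[OF int(2)] f g \<phi> by (simp add: Lp_sharp_def div_free_def)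
    finally show "(LINT x|torus. (\<Sum>i\<in>UNIV. (a *\<^sub>R f x + b *\<^sub>R g x) $ i * partial i \<phi> x)) = 0" .
  qed
  moreover have "(LINT x|torus. a *\<^sub>R f x + b *\<^sub>R g x) = 0"
    using int f g by (simp add: Lp_sharp_def)
  ultimately show ?thesis using L by (auto simp: Lp_sharp_def intro!: Lp_comb)
qed

lemma weak_curl_Lp_sharp: "u \<in> W13 \<Longrightarrow> weak_curl u \<in> Lp_sharp 3"
  unfolding weak_curl_def[abs_def] by (rule curl_Lp_sharp[OF W13_weak_gradient])

section \<open>Closedness of the weak gradient and lower semicontinuity of the energy\<close>

lemma L1_limit_test:
  fixes u :: "nat \<Rightarrow> real^3 \<Rightarrow> 'a::euclidean_space" and l :: "'a \<Rightarrow> real"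
  assumes u: "\<And>n. u n \<in> Lp 1" and v: "v \<in> Lp 1" and lim: "(\<lambda>n. Lp_norm 1 (\<lambda>x. u n x - v x)) \<longlonglongrightarrow> 0"
    and l: "bounded_linear l" and \<phi>: "\<phi> \<in> Linf"
  shows "(\<lambda>n. LINT x|torus. l (u n x) * \<phi> x) \<longlonglongrightarrow> (LINT x|torus. l (v x) * \<phi> x)"
proof (rule LIM_zero_cancel, rule Lim_null_comparison)
  have int: "integrable torus (\<lambda>x. l (w x))" if "w \<in> Lp 1" for w :: "real^3 \<Rightarrow> 'a"
    using that by (simp add: Lp1_iff integrable_bounded_linear[OF l])
  show "\<forall>\<^sub>F n in sequentially. norm ((LINT x|torus. l (u n x) * \<phi> x) - (LINT x|torus. l (v x) * \<phi> x))
      \<le> Lp_norm 1 (\<lambda>x. u n x - v x) * (onorm l * Linf_norm \<phi>)"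
  proof (rule always_eventually, rule allI)
    fix n
    have w: "(\<lambda>x. u n x - v x) \<in> Lp 1" using u v by (intro Lp_diff) auto
    have "(LINT x|torus. l (u n x) * \<phi> x) - (LINT x|torus. l (v x) * \<phi> x) = (LINT x|torus. l (u n x - v x) * \<phi> x)"
      using integrable_mult_Linf[OF int[OF u] \<phi>, of n] integrable_mult_Linf[OF int[OF v] \<phi>]
      by (simp add: linear_diff[OF bounded_linear.linear[OF l]] left_diff_distrib)
    also have "norm \<dots> \<le> (LINT x|torus. norm (l (u n x - v x) * \<phi> x))"
      by (rule integral_norm_bound)
    also have "\<dots> \<le> (LINT x|torus. norm (u n x - v x) * (onorm l * Linf_norm \<phi>))"
    proof (rule integral_mono_AE)
      show "integrable torus (\<lambda>x. norm (l (u n x - v x) * \<phi> x))"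
        using integrable_mult_Linf[OF int[OF w] \<phi>] by (intro integrable_norm)
      show "integrable torus (\<lambda>x. norm (u n x - v x) * (onorm l * Linf_norm \<phi>))"
        using w by (auto simp: Lp1_iff)
      show "AE x in torus. norm (l (u n x - v x) * \<phi> x) \<le> norm (u n x - v x) * (onorm l * Linf_norm \<phi>)"
        using Linf_AE_norm[OF \<phi>]
      proof eventually_elim
        case (elim x)
        have "norm (l (u n x - v x) * \<phi> x) \<le> (onorm l * norm (u n x - v x)) * Linf_norm \<phi>"
          unfolding norm_mult using onorm[OF l] elim onorm_pos_le[OF l] by (intro mult_mono) auto
        then show ?case by (simp add: algebra_simps)
      qed
    qed
    also have "\<dots> = Lp_norm 1 (\<lambda>x. u n x - v x) * (onorm l * Linf_norm \<phi>)"
      by (simp add: Lp1_norm_eq)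
    finally show "norm ((LINT x|torus. l (u n x) * \<phi> x) - (LINT x|torus. l (v x) * \<phi> x))
      \<le> Lp_norm 1 (\<lambda>x. u n x - v x) * (onorm l * Linf_norm \<phi>)" .
  qed
  show "(\<lambda>n. Lp_norm 1 (\<lambda>x. u n x - v x) * (onorm l * Linf_norm \<phi>)) \<longlonglongrightarrow> 0"
    using tendsto_mult_left_zero[OF lim] .
qed

text \<open>Test functions and their derivatives are bounded, so L^1 convergence of the fields and
  of their gradients suffices to pass to the limit in the defining identity.\<close>

lemma has_weak_gradient_limit:
  assumes u: "\<And>n. has_weak_gradient (u n) (G n)" and v: "v \<in> Lp 1" "H \<in> Lp 1"
    and lim: "(\<lambda>n. Lp_norm 1 (\<lambda>x. u n x - v x)) \<longlonglongrightarrow> 0" "(\<lambda>n. Lp_norm 1 (\<lambda>x. G n x - H x)) \<longlonglongrightarrow> 0"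
  shows "has_weak_gradient v H"
  unfolding has_weak_gradient_def
proof (intro conjI ballI allI v)
  fix \<phi> :: "real^3 \<Rightarrow> real" and i j assume \<phi>: "\<phi> \<in> test_functions"
  have uL: "u n \<in> Lp 1" "G n \<in> Lp 1" for n using u by (auto simp: has_weak_gradient_def)
  have "bounded_linear (\<lambda>A :: real^3^3. A $ i $ j)"
    by (intro bounded_linear_compose[OF bounded_linear_vec_nth] bounded_linear_vec_nth)
  from L1_limit_test[OF uL(2) v(2) lim(2) this test_functions_Linf[OF \<phi>]]
  have "(\<lambda>n. - (LINT x|torus. G n x $ i $ j * \<phi> x)) \<longlonglongrightarrow> - (LINT x|torus. H x $ i $ j * \<phi> x)"
    by (rule tendsto_minus)
  moreover have "(\<lambda>n. (LINT x|torus. u n x $ i * partial j \<phi> x)) \<longlonglongrightarrow> (LINT x|torus. v x $ i * partial j \<phi> x)"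
    by (rule L1_limit_test[OF uL(1) v(1) lim(1) bounded_linear_vec_nth test_functions_Linf[OF test_functions_partial[OF \<phi>]]])
  moreover have "(LINT x|torus. u n x $ i * partial j \<phi> x) = - (LINT x|torus. G n x $ i $ j * \<phi> x)" for n
    using u \<phi> by (simp add: has_weak_gradient_def)
  ultimately show "(LINT x|torus. v x $ i * partial j \<phi> x) = - (LINT x|torus. H x $ i $ j * \<phi> x)"
    by (simp add: LIMSEQ_unique)
qed

text \<open>Fatou's lemma applies to each of the three norms separately. To add the results, all
  three must converge along one subsequence; they are bounded, so the triple \<open>t\<close> has a
  convergent one in R^3. With \<open>lam = 0\<close> this is lower semicontinuity of
  \<open>X_norm\<close> alone.\<close>

lemma energy_lsc:
  assumes u: "\<And>n. u n \<in> Linf" "\<And>n. has_weak_gradient (u n) (G n)" "\<And>n. G n \<in> Lp 3"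
    and v: "has_weak_gradient v H"
    and lim: "AE x in torus. (\<lambda>n. u n x) \<longlonglongrightarrow> v x" "AE x in torus. (\<lambda>n. G n x) \<longlonglongrightarrow> H x"
    and r: "r \<in> Lp 3" and lam: "lam \<ge> 0"
    and le: "\<And>n. X_norm (u n) + lam * Lp_norm 3 (\<lambda>x. r x - weak_curl (u n) x) ^ 3 \<le> A n" and A: "A \<longlonglongrightarrow> a"
  shows "v \<in> Linf \<inter> W13" and "X_norm v + lam * Lp_norm 3 (\<lambda>x. r x - weak_curl v x) ^ 3 \<le> a"
proof -
  let ?c = "curl_of_gradient"
  define t where "t n = (Linf_norm (u n), Lp_norm 3 (G n), Lp_norm 3 (\<lambda>x. r x - ?c (G n x)))" for n
  have cL: "(\<lambda>x. r x - ?c (K x)) \<in> Lp 3" if "K \<in> Lp 3" for K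
    using that r by (intro Lp_diff curl_of_gradient_Lp) auto
  have curl_eq: "Lp_norm 3 (\<lambda>x. r x - weak_curl w x) = Lp_norm 3 (\<lambda>x. r x - ?c (K x))"
    if "has_weak_gradient w K" "K \<in> Lp 3" for w K
  proof (rule Lp_cong_AE(2)[OF _ _ cL[OF that(2)]])
    show "(\<lambda>x. r x - weak_curl w x) \<in> periodic_measurable"
      using r weak_curl_Lp(1)[OF weak_gradient_eq(1)[OF that]] by (intro periodic_measurable_diff Lp_measurable)
    show "AE x in torus. r x - weak_curl w x = r x - ?c (K x)"
      using weak_curl_eq[OF that] by eventually_elim simp
  qed auto
  have X_eq: "X_norm w = Linf_norm w + Lp_norm 3 K" if "has_weak_gradient w K" "K \<in> Lp 3" for w K
    using weak_gradient_eq(3)[OF that] by (simp add: X_norm_def)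
  have le': "Linf_norm (u n) + Lp_norm 3 (G n) + lam * Lp_norm 3 (\<lambda>x. r x - ?c (G n x)) ^ 3 \<le> A n" for n
    using le[of n] curl_eq[OF u(2,3)] X_eq[OF u(2,3)] by simp
  obtain K where "\<And>n. norm (A n) \<le> K"
    using convergent_imp_Bseq[OF convergentI[OF A]] unfolding Bseq_def by blast
  then have K: "A n \<le> K" for n by (metis abs_le_D1 real_norm_def)
  have pos: "0 \<le> lam * Lp_norm 3 w ^ 3" for w :: "real^3 \<Rightarrow> real^3" using lam by simp
  have tb: "Linf_norm (u n) \<le> K" "Lp_norm 3 (G n) \<le> K"
    "Lp_norm 3 (\<lambda>x. r x - ?c (G n x)) \<le> Lp_norm 3 r + onorm ?c * K" for n
  proof -
    show 1: "Linf_norm (u n) \<le> K" and 2: "Lp_norm 3 (G n) \<le> K"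
      using le'[of n] K[of n] pos[of "\<lambda>x. r x - ?c (G n x)"] Linf_norm_nonneg[of "u n"] Lp_norm_nonneg[of 3 "G n"]
      by linarith+
    have "Lp_norm 3 (\<lambda>x. r x - ?c (G n x)) \<le> Lp_norm 3 r + Lp_norm 3 (\<lambda>x. ?c (G n x))"
      using r u(3) by (intro Lp_diff curl_of_gradient_Lp) auto
    also have "Lp_norm 3 (\<lambda>x. ?c (G n x)) \<le> onorm ?c * Lp_norm 3 (G n)"
      using u(3) by (rule curl_of_gradient_Lp)
    also have "\<dots> \<le> onorm ?c * K"
      using 2 onorm_pos_le[OF bounded_linear_curl_of_gradient] by (rule mult_left_mono)
    finally show "Lp_norm 3 (\<lambda>x. r x - ?c (G n x)) \<le> Lp_norm 3 r + onorm ?c * K" by simp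
  qed
  have "bounded (range t)"
  proof (rule bounded_subset)
    show "bounded ({0..K} \<times> {0..K} \<times> {0..Lp_norm 3 r + onorm ?c * K})"
      by (intro bounded_Times bounded_closed_interval)
    show "range t \<subseteq> {0..K} \<times> {0..K} \<times> {0..Lp_norm 3 r + onorm ?c * K}"
      using tb Linf_norm_nonneg by (auto simp: t_def)
  qed
  then obtain l s where s: "strict_mono s" "(t \<circ> s) \<longlonglongrightarrow> l"
    using bounded_imp_convergent_subsequence by blast
  obtain \<alpha> \<beta> \<gamma> where l: "l = (\<alpha>, \<beta>, \<gamma>)" by (metis prod_cases3)
  have l1: "(\<lambda>n. Linf_norm (u (s n))) \<longlonglongrightarrow> \<alpha>" using tendsto_fst[OF s(2)] by (simp add: t_def l o_def)
  have l2: "(\<lambda>n. Lp_norm 3 (G (s n))) \<longlonglongrightarrow> \<beta>" using tendsto_fst[OF tendsto_snd[OF s(2)]] by (simp add: t_def l o_def)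
  have l3: "(\<lambda>n. Lp_norm 3 (\<lambda>x. r x - ?c (G (s n) x))) \<longlonglongrightarrow> \<gamma>"
    using tendsto_snd[OF tendsto_snd[OF s(2)]] by (simp add: t_def l o_def)
  have lims: "AE x in torus. (\<lambda>n. u (s n) x) \<longlonglongrightarrow> v x" "AE x in torus. (\<lambda>n. G (s n) x) \<longlonglongrightarrow> H x"
    using lim by (eventually_elim, use LIMSEQ_subseq_LIMSEQ[OF _ s(1)] in \<open>force simp: o_def\<close>)+
  have limc: "AE x in torus. (\<lambda>n. r x - ?c (G (s n) x)) \<longlonglongrightarrow> r x - ?c (H x)"
    using lims(2) by eventually_elim (intro tendsto_diff tendsto_const bounded_linear.tendsto[OF bounded_linear_curl_of_gradient])
  note vm = has_weak_gradient_measurable(1,2)[OF v]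
  have V: "v \<in> Linf" "Linf_norm v \<le> \<alpha>"
    by (rule Linf_Fatou[OF u(1) vm(1) lims(1) order_refl l1])+
  have HL: "H \<in> Lp 3" "Lp_norm 3 H \<le> \<beta>"
    by (rule Lp_Fatou[OF _ u(3) vm(2) lims(2) order_refl l2], simp)+
  have CL: "Lp_norm 3 (\<lambda>x. r x - ?c (H x)) \<le> \<gamma>"
    by (rule Lp_Fatou(2)[OF _ cL[OF u(3)] Lp_measurable[OF cL[OF HL(1)]] limc order_refl l3]) simp
  show "v \<in> Linf \<inter> W13" using V(1) weak_gradient_eq(1)[OF v HL(1)] by blast
  have "X_norm v + lam * Lp_norm 3 (\<lambda>x. r x - weak_curl v x) ^ 3 =
      Linf_norm v + Lp_norm 3 H + lam * Lp_norm 3 (\<lambda>x. r x - ?c (H x)) ^ 3"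
    using X_eq[OF v HL(1)] curl_eq[OF v HL(1)] by simp
  also have "\<dots> \<le> \<alpha> + \<beta> + lam * \<gamma> ^ 3"
    using V HL CL lam by (intro add_mono mult_left_mono power_mono) auto
  also have "\<dots> \<le> a"
  proof (rule LIMSEQ_le)
    show "(\<lambda>n. Linf_norm (u (s n)) + Lp_norm 3 (G (s n)) + lam * Lp_norm 3 (\<lambda>x. r x - ?c (G (s n) x)) ^ 3) \<longlonglongrightarrow> \<alpha> + \<beta> + lam * \<gamma> ^ 3"
      by (intro tendsto_intros l1 l2 l3)
    show "(\<lambda>n. A (s n)) \<longlonglongrightarrow> a" using LIMSEQ_subseq_LIMSEQ[OF A s(1)] by (simp add: o_def)
  qed (use le' in auto)
  finally show "X_norm v + lam * Lp_norm 3 (\<lambda>x. r x - weak_curl v x) ^ 3 \<le> a" .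
qed

subsection \<open>Solvability of the curl equation\<close>

text \<open>A pair \<open>c = (a, B)\<close> of fields represents the functional that maps \<open>\<Phi>\<close> to the integral of
  \<open>a \<bullet> \<Phi> + B \<bullet> \<nabla>\<Phi>\<close>, so that \<open>split_norm c\<close> bounds its norm in \<open>L\<^sup>1 + W^{-1,3/2}\<close>.\<close>

definition jet :: "(real^3 \<Rightarrow> real^3) \<Rightarrow> real^3 \<Rightarrow> (real^3) \<times> (real^3^3)" where
  "jet \<Phi> x = (\<Phi> x, jacobian \<Phi> (at x))"

definition split_norm :: "(real^3 \<Rightarrow> (real^3) \<times> (real^3^3)) \<Rightarrow> real" where
  "split_norm c = Lp_norm 1 (\<lambda>x. fst (c x)) + Lp_norm (3/2) (\<lambda>x. snd (c x))"

definition represents :: "(real^3 \<Rightarrow> (real^3) \<times> (real^3^3)) \<Rightarrow> ((real^3 \<Rightarrow> real^3) \<Rightarrow> real) \<Rightarrow> bool" where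
  "represents c T \<longleftrightarrow> (\<forall>\<Phi> \<in> test_functions. T \<Phi> = (LINT x|torus. c x \<bullet> jet \<Phi> x))"

lemma Lp_pair:
  assumes "c \<in> Lp p" "p > 0"
  shows "(\<lambda>x. fst (c x)) \<in> Lp p" "Lp_norm p (\<lambda>x. fst (c x)) \<le> Lp_norm p c"
    "(\<lambda>x. snd (c x)) \<in> Lp p" "Lp_norm p (\<lambda>x. snd (c x)) \<le> Lp_norm p c"
proof -
  have m: "(\<lambda>x. fst (c x)) \<in> periodic_measurable" "(\<lambda>x. snd (c x)) \<in> periodic_measurable"
    using periodic_measurable_linear[OF linear_fst Lp_measurable[OF assms(1)]]
      periodic_measurable_linear[OF linear_snd Lp_measurable[OF assms(1)]] by auto
  have le: "AE x in torus. norm (fst (c x)) \<le> norm (c x)" "AE x in torus. norm (snd (c x)) \<le> norm (c x)"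
    using norm_fst_le[of "fst (c x)" "snd (c x)" for x] norm_snd_le[of "snd (c x)" "fst (c x)" for x]
    by (auto intro!: AE_I2)
  show "(\<lambda>x. fst (c x)) \<in> Lp p" "Lp_norm p (\<lambda>x. fst (c x)) \<le> Lp_norm p c"
    by (rule Lp_dominated[OF assms(2) m(1) assms(1) le(1)])+
  show "(\<lambda>x. snd (c x)) \<in> Lp p" "Lp_norm p (\<lambda>x. snd (c x)) \<le> Lp_norm p c"
    by (rule Lp_dominated[OF assms(2) m(2) assms(1) le(2)])+
qed

lemma Lp_PairI:
  assumes "u \<in> Lp p" "v \<in> Lp p" "p \<ge> 1"
  shows "(\<lambda>x. (u x, v x)) \<in> Lp p"
proof -
  have p: "p > 0" using assms by simp
  have lin: "linear (\<lambda>y. (y, 0))" "linear (\<lambda>y. (0, y))" by (auto intro!: linearI)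
  have "(\<lambda>x. (u x, 0) + (0, v x)) \<in> Lp p"
    by (rule Lp_add(1)[OF assms(3) Lp_linear(1)[OF lin(1) p assms(1)] Lp_linear(1)[OF lin(2) p assms(2)]])
  then show ?thesis by simp
qed

lemma Lp_norm_Pair:
  assumes "u \<in> Lp p" "v \<in> Lp p" "p \<ge> 1"
  shows "Lp_norm p (\<lambda>x. (u x, v x)) \<le> Lp_norm p u + Lp_norm p v"
proof -
  have p: "p > 0" using assms by simp
  have L: "(\<lambda>x. (u x, 0 :: 'b)) \<in> Lp p" "(\<lambda>x. (0 :: 'a, v x)) \<in> Lp p"
    using assms by (auto intro!: Lp_PairI)
  have "Lp_norm p (\<lambda>x. (u x, 0) + (0, v x)) \<le> Lp_norm p (\<lambda>x. (u x, 0 :: 'b)) + Lp_norm p (\<lambda>x. (0 :: 'a, v x))"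
    using assms(3) L by (rule Lp_add)
  then show ?thesis by (simp add: Lp_norm_def norm_Pair)
qed

text \<open>The bridge between the two geometries: a lower bound on the split norm gives half that
  bound on the L^2 norm, where projections exist.\<close>

lemma split_norm_L2:
  assumes "c \<in> Lp 2"
  shows "(\<lambda>x. fst (c x)) \<in> Lp 1" "(\<lambda>x. snd (c x)) \<in> Lp (3/2)" "split_norm c \<le> 2 * Lp_norm 2 c"
proof -
  have p: "(0::real) < 2" by simp
  have *: "(0::real) < 1" "(1::real) \<le> 2" "(0::real) < 3/2" "(3/2::real) \<le> 2" by auto
  note P = Lp_pair[OF assms p]
  note 1 = Lp_subset[OF *(1,2) P(1)] and 2 = Lp_subset[OF *(3,4) P(3)]
  show "(\<lambda>x. fst (c x)) \<in> Lp 1" "(\<lambda>x. snd (c x)) \<in> Lp (3/2)" by (fact 1 2)+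
  show "split_norm c \<le> 2 * Lp_norm 2 c"
    unfolding split_norm_def using 1(2) 2(2) P(2,4) by linarith
qed

lemma split_norm_nonneg: "0 \<le> split_norm c"
  by (simp add: split_norm_def)

lemma split_norm_comb:
  assumes "c \<in> Lp 2" "d \<in> Lp 2"
  shows "split_norm (\<lambda>x. a *\<^sub>R c x + b *\<^sub>R d x) \<le> \<bar>a\<bar> * split_norm c + \<bar>b\<bar> * split_norm d"
proof -
  note c = split_norm_L2[OF assms(1)] and d = split_norm_L2[OF assms(2)]
  have le: "Lp_norm p (\<lambda>x. a *\<^sub>R f x + b *\<^sub>R g x) \<le> \<bar>a\<bar> * Lp_norm p f + \<bar>b\<bar> * Lp_norm p g"
    if "f \<in> Lp p" "g \<in> Lp p" "p \<ge> 1" for p and f g :: "real^3 \<Rightarrow> 'a::euclidean_space"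
    using Lp_add(2)[OF that(3) Lp_scaleR(1)[OF that(1), of a] Lp_scaleR(1)[OF that(2), of b]]
      Lp_scaleR(2)[OF that(1), of a] Lp_scaleR(2)[OF that(2), of b] that(3) by simp
  have "Lp_norm 1 (\<lambda>x. fst (a *\<^sub>R c x + b *\<^sub>R d x)) \<le> \<bar>a\<bar> * Lp_norm 1 (\<lambda>x. fst (c x)) + \<bar>b\<bar> * Lp_norm 1 (\<lambda>x. fst (d x))"
    using le[OF c(1) d(1)] by simp
  moreover have "Lp_norm (3/2) (\<lambda>x. snd (a *\<^sub>R c x + b *\<^sub>R d x)) \<le>
      \<bar>a\<bar> * Lp_norm (3/2) (\<lambda>x. snd (c x)) + \<bar>b\<bar> * Lp_norm (3/2) (\<lambda>x. snd (d x))"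
    using le[OF c(2) d(2)] by simp
  ultimately show ?thesis by (simp add: split_norm_def algebra_simps)
qed

lemma jet_L2:
  assumes "\<Phi> \<in> test_functions"
  shows "jet \<Phi> \<in> Lp 2"
  unfolding jet_def[abs_def]
  by (intro Lp_PairI Linf_subset_Lp(1) test_functions_Linf jacobian_Linf assms) auto

lemma represents_comb:
  assumes "represents c T" "represents d R" "c \<in> Lp 2" "d \<in> Lp 2"
  shows "represents (\<lambda>x. a *\<^sub>R c x + b *\<^sub>R d x) (\<lambda>\<Phi>. a * T \<Phi> + b * R \<Phi>)"
  unfolding represents_def
proof
  fix \<Phi> :: "real^3 \<Rightarrow> real^3" assume \<Phi>: "\<Phi> \<in> test_functions"
  have "integrable torus (\<lambda>x. c x \<bullet> jet \<Phi> x)" "integrable torus (\<lambda>x. d x \<bullet> jet \<Phi> x)"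
    using assms jet_L2[OF \<Phi>] by (auto intro: L2_Cauchy_Schwarz)
  then show "a * T \<Phi> + b * R \<Phi> = (LINT x|torus. (a *\<^sub>R c x + b *\<^sub>R d x) \<bullet> jet \<Phi> x)"
    using assms(1,2) \<Phi> by (simp add: represents_def inner_add_left)
qed

text \<open>Moving the curl to the other side with the adjoint of the algebraic map from gradients
  to curls puts all of curl g into the W^{-1,3/2} part.\<close>

lemma represents_curl:
  assumes "g \<in> Lp 3"
  shows "(\<lambda>x. (0, adjoint curl_of_gradient (g x))) \<in> Lp 2"
    and "represents (\<lambda>x. (0, adjoint curl_of_gradient (g x))) (distr_curl g)"
proof -
  have "g \<in> Lp 2" using Lp_subset(1)[of 2 3 g] assms by simp
  then show "(\<lambda>x. (0, adjoint curl_of_gradient (g x))) \<in> Lp 2"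
    by (intro Lp_PairI Lp_zero Lp_linear(1)[OF adjoint_linear[OF linear_curl_of_gradient]]) auto
  show "represents (\<lambda>x. (0, adjoint curl_of_gradient (g x))) (distr_curl g)"
    by (simp add: represents_def distr_curl_def jet_def adjoint_clauses[OF linear_curl_of_gradient])
qed

lemma distr_curl_comb:
  assumes "f \<in> Lp 3" "g \<in> Lp 3" "\<Phi> \<in> test_functions"
  shows "distr_curl (\<lambda>x. a *\<^sub>R f x + b *\<^sub>R g x) \<Phi> = a * distr_curl f \<Phi> + b * distr_curl g \<Phi>"
proof -
  have "(\<lambda>x. curl_of_gradient (jacobian \<Phi> (at x))) \<in> Lp 2"
    by (intro Lp_linear(1)[OF linear_curl_of_gradient] Linf_subset_Lp(1) jacobian_Linf assms) auto
  then have "integrable torus (\<lambda>x. h x \<bullet> curl_of_gradient (jacobian \<Phi> (at x)))" if "h \<in> Lp 3" for h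
    using that Lp_subset(1)[of 2 3 h] by (intro L2_Cauchy_Schwarz) auto
  then show ?thesis using assms by (simp add: distr_curl_def inner_add_left)
qed

text \<open>The real supremum is meaningful because membership in \<open>Wm\<close> bounds the set,
  and the zero field contributes a nonnegative element. This bounds the infimum in
  \<open>sum_norm\<close> from below.\<close>

lemma Wm_norm_nonneg:
  assumes "b \<in> Wm"
  shows "0 \<le> Wm_norm b"
proof -
  let ?S = "{\<Phi> \<in> test_functions. Lp_norm 3 (\<lambda>x. jacobian \<Phi> (at x)) \<le> 1} :: (real^3 \<Rightarrow> real^3) set"
  obtain C where C: "\<And>\<Phi>. \<Phi> \<in> test_functions \<Longrightarrow> \<bar>b \<Phi>\<bar> \<le> C * Lp_norm 3 (\<lambda>x. jacobian \<Phi> (at x))"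
    using assms unfolding Wm_def by blast
  have "\<bar>b \<Phi>\<bar> \<le> \<bar>C\<bar>" if "\<Phi> \<in> ?S" for \<Phi>
  proof -
    have "\<bar>b \<Phi>\<bar> \<le> \<bar>C\<bar> * Lp_norm 3 (\<lambda>x. jacobian \<Phi> (at x))"
      using C[of \<Phi>] that mult_right_mono[OF abs_ge_self Lp_norm_nonneg, of C 3 "\<lambda>x. jacobian \<Phi> (at x)"] by simp
    also have "\<dots> \<le> \<bar>C\<bar> * 1" using that by (intro mult_left_mono) auto
    finally show ?thesis by simp
  qed
  then have bdd: "bdd_above ((\<lambda>\<Phi>. \<bar>b \<Phi>\<bar>) ` ?S)" by (intro bdd_aboveI2[of _ _ "\<bar>C\<bar>"])
  have "(\<lambda>x. 0) \<in> ?S" using test_functions_const by (simp add: jacobian_const)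
  then have "\<bar>b (\<lambda>x. 0)\<bar> \<le> Wm_norm b" unfolding Wm_norm_def by (rule cSUP_upper[OF _ bdd])
  then show ?thesis by linarith
qed

text \<open>The pair is one admissible decomposition: its first component is the L^1 part, and its
  second, integrated against the Jacobian, is a functional whose norm is at most the L^{3/2} norm by
  Hoelder's inequality.\<close>

lemma sum_norm_le:
  assumes c: "c \<in> Lp 2" and T: "represents c T"
  shows "sum_norm T \<le> split_norm c"
proof -
  let ?J = "\<lambda>\<Phi> x. jacobian \<Phi> (at x) :: real^3^3"
  let ?B = "\<lambda>x. snd (c x)"
  define b where "b \<Phi> = (LINT x|torus. ?B x \<bullet> ?J \<Phi> x)" for \<Phi> :: "real^3 \<Rightarrow> real^3"
  note L = split_norm_L2[OF c]
  have JL: "?J \<Phi> \<in> Lp p" if "\<Phi> \<in> test_functions" "p > 0" for \<Phi> p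
    using jacobian_Linf[OF that(1)] that(2) by (rule Linf_subset_Lp)
  have H: "integrable torus (\<lambda>x. ?B x \<bullet> ?J \<Phi> x)"
    "\<bar>b \<Phi>\<bar> \<le> Lp_norm (3/2) ?B * Lp_norm 3 (?J \<Phi>)" if "\<Phi> \<in> test_functions" for \<Phi>
    using Lp_Holder(3,4)[OF _ _ _ L(2) JL[OF that, of 3]] by (auto simp: b_def)
  have b1: "b (\<lambda>x. s *\<^sub>R \<Phi> x + t *\<^sub>R \<Psi> x) = s * b \<Phi> + t * b \<Psi>"
    if "\<Phi> \<in> test_functions" "\<Psi> \<in> test_functions" for \<Phi> \<Psi> s t
    unfolding b_def using that H(1)[OF that(1)] H(1)[OF that(2)] by (simp add: jacobian_comb inner_add_right)
  have "b \<in> Wm"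
    unfolding Wm_def
  proof (intro CollectI conjI ballI allI)
    fix \<Phi> \<Psi> :: "real^3 \<Rightarrow> real^3" and s :: real assume *: "\<Phi> \<in> test_functions" "\<Psi> \<in> test_functions"
    show "b (\<lambda>x. \<Phi> x + \<Psi> x) = b \<Phi> + b \<Psi>" using b1[OF *, of 1 1] by simp
  next
    fix \<Phi> :: "real^3 \<Rightarrow> real^3" and s :: real assume *: "\<Phi> \<in> test_functions"
    show "b (\<lambda>x. s *\<^sub>R \<Phi> x) = s * b \<Phi>" using b1[OF * *, of s 0] by simp
  qed (use H(2) in blast)
  have "Wm_norm b \<le> Lp_norm (3/2) ?B"
    unfolding Wm_norm_def
  proof (rule cSUP_least)
    have "(\<lambda>x. 0) \<in> {\<Phi> \<in> test_functions. Lp_norm 3 (?J \<Phi>) \<le> 1}"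
      using test_functions_const by (simp add: jacobian_const)
    then show "{\<Phi> \<in> test_functions. Lp_norm 3 (?J \<Phi>) \<le> 1} \<noteq> {}" by blast
    fix \<Phi> assume *: "\<Phi> \<in> {\<Phi> \<in> test_functions. Lp_norm 3 (?J \<Phi>) \<le> 1}"
    then have "\<bar>b \<Phi>\<bar> \<le> Lp_norm (3/2) ?B * Lp_norm 3 (?J \<Phi>)" by (intro H) auto
    also have "\<dots> \<le> Lp_norm (3/2) ?B * 1" using * by (intro mult_left_mono) auto
    finally show "\<bar>b \<Phi>\<bar> \<le> Lp_norm (3/2) ?B" by simp
  qed
  moreover have "sum_norm T \<le> Lp_norm 1 (\<lambda>x. fst (c x)) + Wm_norm b"
    unfolding sum_norm_def
  proof (rule cInf_lower)
    have "T \<Phi> = (LINT x|torus. fst (c x) \<bullet> \<Phi> x) + b \<Phi>" if \<Phi>: "\<Phi> \<in> test_functions" for \<Phi>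
    proof -
      have 1: "integrable torus (\<lambda>x. fst (c x) \<bullet> \<Phi> x)"
      proof (rule L2_Cauchy_Schwarz(1))
        show "(\<lambda>x. fst (c x)) \<in> Lp 2" using c by (rule Lp_pair) simp
        show "\<Phi> \<in> Lp 2" using test_functions_Linf[OF \<Phi>] by (rule Linf_subset_Lp) simp
      qed
      have "T \<Phi> = (LINT x|torus. fst (c x) \<bullet> \<Phi> x + ?B x \<bullet> ?J \<Phi> x)"
        using T \<Phi> by (simp add: represents_def jet_def inner_prod_def)
      also have "\<dots> = (LINT x|torus. fst (c x) \<bullet> \<Phi> x) + b \<Phi>"
        using 1 H(1)[OF \<Phi>] by (simp add: b_def)
      finally show ?thesis .
    qed
    then show "Lp_norm 1 (\<lambda>x. fst (c x)) + Wm_norm b \<in> {Lp_norm 1 a + Wm_norm b | a b. a \<in> Lp 1 \<and> b \<in> Wm \<and>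
       (\<forall>\<Phi> \<in> test_functions. T \<Phi> = (LINT x|torus. a x \<bullet> \<Phi> x) + b \<Phi>)}"
      using L(1) \<open>b \<in> Wm\<close> by blast
    show "bdd_below {Lp_norm 1 a + Wm_norm b | a b. a \<in> Lp 1 \<and> b \<in> Wm \<and>
       (\<forall>\<Phi> \<in> test_functions. T \<Phi> = (LINT x|torus. a x \<bullet> \<Phi> x) + b \<Phi>)}"
      by (rule bdd_belowI[of _ 0]) (auto intro!: add_nonneg_nonneg Wm_norm_nonneg)
  qed
  ultimately show ?thesis by (simp add: split_norm_def)
qed

lemma L2_inner_comb:
  assumes "h \<in> Lp 2" "u \<in> Lp 2" "v \<in> Lp 2"
  shows "(LINT x|torus. h x \<bullet> (a *\<^sub>R u x + b *\<^sub>R v x)) = a * (LINT x|torus. h x \<bullet> u x) + b * (LINT x|torus. h x \<bullet> v x)"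
  using L2_Cauchy_Schwarz(1)[OF assms(1,2)] L2_Cauchy_Schwarz(1)[OF assms(1,3)] by (simp add: inner_add_right)

text \<open>The Hahn-Banach step: the functional that maps \<open>curl g\<close> to the integral of \<open>f \<bullet> g\<close> is
  extended from the space of curls to all of \<open>L\<^sup>1 + W^{-1,3/2}\<close>. The extension is a multiple of the shortest
  vector between a level set of the functional and a ball.\<close>

lemma dual_potential:
  assumes \<beta>: "\<beta> > 0" "bourgain_brezis \<beta>" and f: "f \<in> Lp_sharp 3" and N: "Lp_norm 3 f > 0"
  obtains k where "k \<in> Lp 2"
    "\<And>g c. g \<in> Lp_sharp 3 \<Longrightarrow> c \<in> Lp 2 \<Longrightarrow> represents c (distr_curl g) \<Longrightarrow>
      (LINT x|torus. k x \<bullet> c x) = (LINT x|torus. f x \<bullet> g x)"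
    "\<And>c. c \<in> Lp 2 \<Longrightarrow> (LINT x|torus. k x \<bullet> c x) \<le> 2 * \<beta> * Lp_norm 3 f * split_norm c"
proof -
  let ?I = "\<lambda>g. LINT x|torus. f x \<bullet> g x"
  have sL: "g \<in> Lp 3" "g \<in> Lp 2" "g \<in> Lp (3/2)" if "g \<in> Lp_sharp 3" for g
    using that Lp_subset(1)[of 2 3 g] Lp_subset(1)[of "3/2" 3 g] by (auto simp: Lp_sharp_def)
  have I_comb: "?I (\<lambda>x. a *\<^sub>R g x + b *\<^sub>R h x) = a * ?I g + b * ?I h" if "g \<in> Lp_sharp 3" "h \<in> Lp_sharp 3" for g h a b
    using sL f that by (intro L2_inner_comb)
  have rep_comb: "represents (\<lambda>x. a *\<^sub>R c x + b *\<^sub>R d x) (distr_curl (\<lambda>x. a *\<^sub>R g x + b *\<^sub>R h x))"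
    if "represents c (distr_curl g)" "represents d (distr_curl h)" "c \<in> Lp 2" "d \<in> Lp 2" "g \<in> Lp_sharp 3" "h \<in> Lp_sharp 3"
    for a b c d g h
    using represents_comb[OF that(1-4), of a b] distr_curl_comb[OF sL(1)[OF that(5)] sL(1)[OF that(6)], of _ a b]
    by (simp add: represents_def)
  \<comment> \<open>A curl is represented by many pairs, and \<open>S\<close> contains them all. The
    functional found below is therefore also controlled on the representations of 0.\<close>
  define S where "S = {c \<in> Lp 2. \<exists>g \<in> Lp_sharp 3. ?I g = 1 \<and> represents c (distr_curl g)}"
  define \<rho> where "\<rho> = 1 / (\<beta> * Lp_norm 3 f)"
  have \<rho>: "\<rho> > 0" using \<beta> N by (simp add: \<rho>_def)
  \<comment> \<open>Here the Bourgain-Brezis estimate enters: 1 is the integral of f . g, hence at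
    most |f|_3 |g|_{3/2}, hence at most |f|_3 times \<beta> times the split norm of any
    representation of curl g.\<close>
  have S\<rho>: "split_norm c \<ge> \<rho>" if cS: "c \<in> S" for c
  proof -
    obtain g where g: "c \<in> Lp 2" "g \<in> Lp_sharp 3" "?I g = 1" "represents c (distr_curl g)"
      using cS unfolding S_def by blast
    have "1 \<le> Lp_norm 3 f * Lp_norm (3/2) g"
      using Lp_Holder(4)[of 3 "3/2" f g] sL[OF f] sL[OF g(2)] g(3) by simp
    also have "Lp_norm (3/2) g \<le> \<beta> * sum_norm (distr_curl g)"
      using \<beta>(2) g(2) sL(3)[OF g(2)] by (simp add: bourgain_brezis_def Lp_sharp_def)
    also have "\<dots> \<le> \<beta> * split_norm c"
      using sum_norm_le[OF g(1,4)] \<beta> by (intro mult_left_mono) auto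
    finally have "1 \<le> Lp_norm 3 f * (\<beta> * split_norm c)" using N by simp
    then show ?thesis using \<beta> N by (simp add: \<rho>_def divide_le_eq algebra_simps)
  qed
  have If: "?I f > 0"
  proof -
    have "Lp_norm 2 f \<noteq> 0"
      using Lp_norm_eq_0_iff[of 2 f] Lp_norm_eq_0_iff[of 3 f] sL[OF f] N by auto
    then show ?thesis by (simp flip: L2_norm_sq)
  qed
  \<comment> \<open>The multiple of \<open>f\<close> on which the functional equals 1; the summand
    \<open>0 *\<^sub>R f x\<close> gives it the shape of the combination lemmas.\<close>
  define g0 where "g0 = (\<lambda>x. (1 / ?I f) *\<^sub>R f x + 0 *\<^sub>R f x)"
  have g0: "g0 \<in> Lp_sharp 3" "?I g0 = 1"
    unfolding g0_def using Lp_sharp_comb[OF f f] I_comb[OF f f, of "1 / ?I f" 0] If by (blast, simp)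
  define s0 where "s0 = (\<lambda>x. (0 :: real^3, adjoint curl_of_gradient (g0 x)))"
  have s0L: "s0 \<in> Lp 2" and s0r: "represents s0 (distr_curl g0)"
    using represents_curl[OF sL(1)[OF g0(1)]] by (auto simp: s0_def)
  have s0: "s0 \<in> S" using s0L s0r g0 by (auto simp: S_def)
  \<comment> \<open>Differences between the level set and the ball of radius \<rho> / 2. Half the
    critical radius keeps them away from 0: their split norm is at least \<rho> / 2 and their L^2
    norm at least \<rho> / 4, so the shortest vector \<open>h\<close> is nonzero.\<close>
  define C where "C = {(\<lambda>x. s x - a x) | s a. s \<in> S \<and> a \<in> Lp 2 \<and> split_norm a \<le> \<rho> / 2}"
  have SL: "s \<in> Lp 2" if "s \<in> S" for s using that by (simp add: S_def)
  have CL: "C \<subseteq> Lp 2" by (auto simp: C_def intro!: Lp_diff(1) dest: SL)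
  have CI: "(\<lambda>x. s x - a x) \<in> C" if "s \<in> S" "a \<in> Lp 2" "split_norm a \<le> \<rho> / 2" for s a
    using that by (auto simp: C_def)
  have Cconv: "(\<lambda>x. (1 - t) *\<^sub>R u x + t *\<^sub>R v x) \<in> C" if uv: "u \<in> C" "v \<in> C" and t: "0 < t" "t < 1" for u v t
  proof -
    obtain s a where u: "u = (\<lambda>x. s x - a x)" "s \<in> S" "a \<in> Lp 2" "split_norm a \<le> \<rho> / 2" using uv(1) by (auto simp: C_def)
    obtain s' a' where v: "v = (\<lambda>x. s' x - a' x)" "s' \<in> S" "a' \<in> Lp 2" "split_norm a' \<le> \<rho> / 2" using uv(2) by (auto simp: C_def)
    obtain g where g: "g \<in> Lp_sharp 3" "?I g = 1" "represents s (distr_curl g)" using u(2) by (auto simp: S_def)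
    obtain g' where g': "g' \<in> Lp_sharp 3" "?I g' = 1" "represents s' (distr_curl g')" using v(2) by (auto simp: S_def)
    let ?s = "\<lambda>x. (1 - t) *\<^sub>R s x + t *\<^sub>R s' x" and ?a = "\<lambda>x. (1 - t) *\<^sub>R a x + t *\<^sub>R a' x"
    have sS: "?s \<in> S"
      unfolding S_def
    proof (intro CollectI conjI bexI)
      show "?s \<in> Lp 2" using SL u(2) v(2) by (intro Lp_comb) auto
      show "?I (\<lambda>x. (1 - t) *\<^sub>R g x + t *\<^sub>R g' x) = 1" using I_comb[OF g(1) g'(1)] g(2) g'(2) by simp
      show "represents ?s (distr_curl (\<lambda>x. (1 - t) *\<^sub>R g x + t *\<^sub>R g' x))"
        using SL u(2) v(2) g g' by (intro rep_comb) auto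
      show "(\<lambda>x. (1 - t) *\<^sub>R g x + t *\<^sub>R g' x) \<in> Lp_sharp 3" using g(1) g'(1) by (rule Lp_sharp_comb)
    qed
    have aL: "?a \<in> Lp 2" using u v by (intro Lp_comb) auto
    have ap: "split_norm ?a \<le> \<rho> / 2"
    proof -
      have "split_norm ?a \<le> \<bar>1 - t\<bar> * split_norm a + \<bar>t\<bar> * split_norm a'" using u v by (intro split_norm_comb)
      also have "\<dots> \<le> \<bar>1 - t\<bar> * (\<rho> / 2) + \<bar>t\<bar> * (\<rho> / 2)" using u v by (intro add_mono mult_left_mono) auto
      also have "\<dots> = \<rho> / 2" using t by (simp add: field_simps)
      finally show ?thesis .
    qed
    have "(\<lambda>x. (1 - t) *\<^sub>R u x + t *\<^sub>R v x) = (\<lambda>x. ?s x - ?a x)" by (auto simp: u v algebra_simps)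
    with CI[OF sS aL ap] show ?thesis by simp
  qed
  have zero: "split_norm (\<lambda>x. 0) = 0" by (simp add: split_norm_def)
  have SC: "s \<in> C" if "s \<in> S" for s using CI[OF that, of "\<lambda>x. 0"] \<rho> by (simp add: zero)
  obtain c h where c: "\<And>n. c n \<in> C" and h: "h \<in> Lp 2" and lim: "(\<lambda>n. Lp_norm 2 (\<lambda>x. c n x - h x)) \<longlonglongrightarrow> 0"
    and hC: "\<And>v. v \<in> C \<Longrightarrow> (Lp_norm 2 h)\<^sup>2 \<le> (LINT x|torus. h x \<bullet> v x)"
    using L2_projection[OF CL _ Cconv] SC[OF s0] by blast
  have "\<rho> / 4 \<le> Lp_norm 2 (c n)" for n
  proof -
    obtain s a where *: "c n = (\<lambda>x. s x - a x)" "s \<in> S" "a \<in> Lp 2" "split_norm a \<le> \<rho> / 2" using c[of n] by (auto simp: C_def)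
    have cn: "c n \<in> Lp 2" using c CL by blast
    have "s = (\<lambda>x. 1 *\<^sub>R c n x + 1 *\<^sub>R a x)" using * by auto
    then have "split_norm s \<le> split_norm (c n) + split_norm a"
      using split_norm_comb[OF cn *(3), of 1 1] by simp
    then show ?thesis using S\<rho>[OF *(2)] *(4) split_norm_L2(3)[OF cn] by simp
  qed
  moreover have "(\<lambda>n. Lp_norm 2 (c n)) \<longlonglongrightarrow> Lp_norm 2 h"
    using c CL h lim by (intro Lp_norm_tendsto) auto
  ultimately have "\<rho> / 4 \<le> Lp_norm 2 h" by (intro LIMSEQ_le_const) auto
  then have pos: "(Lp_norm 2 h)\<^sup>2 > 0" using \<rho> by simp
  let ?H = "\<lambda>c. LINT x|torus. h x \<bullet> c x"
  define \<kappa> where "\<kappa> = ?H s0"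
  have \<kappa>: "\<kappa> > 0" unfolding \<kappa>_def by (rule less_le_trans[OF pos hC[OF SC[OF s0]]])
  \<comment> \<open>Adding multiples of \<open>c\<close> to \<open>s0\<close> does not leave
    \<open>S\<close>, where \<open>?H\<close> is positive. A nonconstant affine function of the
    multiple has a zero, and \<open>t\<close> is chosen to be that zero.\<close>
  have tangent: "?H c = 0" if "g \<in> Lp_sharp 3" "c \<in> Lp 2" "represents c (distr_curl g)" "?I g = 0" for g c
  proof (rule ccontr)
    assume nz: "?H c \<noteq> 0"
    define t where "t = - \<kappa> / ?H c"
    have "(\<lambda>x. 1 *\<^sub>R s0 x + t *\<^sub>R c x) \<in> S"
      unfolding S_def
    proof (intro CollectI conjI bexI)
      show "(\<lambda>x. 1 *\<^sub>R s0 x + t *\<^sub>R c x) \<in> Lp 2" using s0L that by (intro Lp_comb) auto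
      show "?I (\<lambda>x. 1 *\<^sub>R g0 x + t *\<^sub>R g x) = 1" using I_comb[OF g0(1) that(1), of 1 t] g0(2) that(4) by simp
      show "represents (\<lambda>x. 1 *\<^sub>R s0 x + t *\<^sub>R c x) (distr_curl (\<lambda>x. 1 *\<^sub>R g0 x + t *\<^sub>R g x))"
        using s0L s0r g0 that by (intro rep_comb) auto
      show "(\<lambda>x. 1 *\<^sub>R g0 x + t *\<^sub>R g x) \<in> Lp_sharp 3" using g0(1) that(1) by (rule Lp_sharp_comb)
    qed
    from hC[OF SC[OF this]] pos have "0 < 1 * ?H s0 + t * ?H c"
      by (subst (asm) L2_inner_comb[OF h s0L that(2)]) linarith
    then show False using nz by (simp add: t_def \<kappa>_def)
  qed
  have main: "?H c = \<kappa> * ?I g" if "g \<in> Lp_sharp 3" "c \<in> Lp 2" "represents c (distr_curl g)" for g c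
  proof -
    let ?g = "\<lambda>x. 1 *\<^sub>R g x + (- ?I g) *\<^sub>R g0 x" and ?c = "\<lambda>x. 1 *\<^sub>R c x + (- ?I g) *\<^sub>R s0 x"
    have "?H ?c = 0"
    proof (rule tangent)
      show "?g \<in> Lp_sharp 3" using that(1) g0(1) by (rule Lp_sharp_comb)
      show "?c \<in> Lp 2" using s0L that by (intro Lp_comb) auto
      show "represents ?c (distr_curl ?g)" using s0L s0r g0 that by (intro rep_comb) auto
      show "?I ?g = 0" using I_comb[OF that(1) g0(1), of 1 "- ?I g"] g0(2) by simp
    qed
    then show ?thesis using L2_inner_comb[OF h that(2) s0L, of 1 "- ?I g"] by (simp add: \<kappa>_def)
  qed
  \<comment> \<open>Since \<open>s0 - a\<close> belongs to \<open>C\<close>, the variational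
    inequality makes \<open>?H s0 - ?H a\<close> positive.\<close>
  have small: "?H a < \<kappa>" if "a \<in> Lp 2" "split_norm a \<le> \<rho> / 2" for a
  proof -
    have "(\<lambda>x. 1 *\<^sub>R s0 x + (-1) *\<^sub>R a x) \<in> C" using CI[OF s0 that] by simp
    from hC[OF this] pos have "0 < 1 * ?H s0 + (-1) * ?H a"
      by (subst (asm) L2_inner_comb[OF h s0L that(1)]) linarith
    then show ?thesis by (simp add: \<kappa>_def)
  qed
  have bound: "?H a \<le> \<kappa> * (2 / \<rho>) * split_norm a" if a: "a \<in> Lp 2" for a
  proof (rule field_le_epsilon)
    fix e :: real assume e: "e > 0"
    \<comment> \<open>Scaling \<open>a\<close> by \<rho> / (2 q) brings it into the ball. The extra
      summand keeps \<open>q\<close> positive when the split norm vanishes, and is sized so that it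
      contributes exactly \<open>e\<close> to the final bound.\<close>
    define q where "q = split_norm a + e * \<rho> / (2 * \<kappa>)"
    have q: "q > 0" "split_norm a \<le> q"
      using e \<rho> \<kappa> split_norm_nonneg[of a] by (auto simp: q_def intro: add_nonneg_pos)
    let ?a = "\<lambda>x. (\<rho> / (2 * q)) *\<^sub>R a x + 0 *\<^sub>R a x"
    have "split_norm ?a \<le> \<rho> / (2 * q) * split_norm a"
      using split_norm_comb[OF a a, of "\<rho> / (2 * q)" 0] \<rho> q by simp
    also have "\<dots> \<le> \<rho> / (2 * q) * q" using q \<rho> by (intro mult_left_mono) auto
    finally have "?H ?a < \<kappa>" using q a by (intro small Lp_comb) auto
    then have "\<rho> / (2 * q) * ?H a < \<kappa>" using L2_inner_comb[OF h a a, of "\<rho> / (2 * q)" 0] by simp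
    then have "?H a < \<kappa> * (2 / \<rho>) * q" using \<rho> q by (simp add: field_simps)
    also have "\<dots> = \<kappa> * (2 / \<rho>) * split_norm a + e" using \<rho> \<kappa> by (simp add: q_def field_simps)
    finally show "?H a \<le> \<kappa> * (2 / \<rho>) * split_norm a + e" by simp
  qed
  have kI: "(LINT x|torus. ((1 / \<kappa>) *\<^sub>R h x) \<bullet> c x) = ?H c / \<kappa>" for c by simp
  show ?thesis
  proof (rule that[of "\<lambda>x. (1 / \<kappa>) *\<^sub>R h x"])
    show "(\<lambda>x. (1 / \<kappa>) *\<^sub>R h x) \<in> Lp 2" using h by (rule Lp_scaleR)
    show "(LINT x|torus. ((1 / \<kappa>) *\<^sub>R h x) \<bullet> c x) = ?I g"
      if "g \<in> Lp_sharp 3" "c \<in> Lp 2" "represents c (distr_curl g)" for g c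
      using main[OF that] \<kappa> unfolding kI by simp
    show "(LINT x|torus. ((1 / \<kappa>) *\<^sub>R h x) \<bullet> c x) \<le> 2 * \<beta> * Lp_norm 3 f * split_norm c" if "c \<in> Lp 2" for c
      using bound[OF that] \<kappa> unfolding kI by (simp add: \<rho>_def field_simps)
  qed
qed

text \<open>The test field is the unit direction of the first component on the set A where its norm
  exceeds M. Its split norm is the measure of A, so the integral of the excess over M on A is at
  most 0 and A is null. The test field is bounded and so belongs to L^2.\<close>

lemma dual_bound_Linf:
  assumes k: "k \<in> Lp 2" and M: "M \<ge> 0"
    and le: "\<And>c. c \<in> Lp 2 \<Longrightarrow> (LINT x|torus. k x \<bullet> c x) \<le> M * split_norm c"
  shows "AE x in torus. norm (fst (k x)) \<le> M"
proof -
  have [measurable]: "(\<lambda>x. fst (k x)) \<in> borel_measurable torus"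
    using Lp_measurable[OF split_norm_L2(1)[OF k]] by (rule periodic_measurable_torus)
  define e :: "(real^3) \<times> (real^3^3) \<Rightarrow> (real^3) \<times> (real^3^3)" where
    "e z = (if M < norm (fst z) then (1 / norm (fst z)) *\<^sub>R fst z else 0, 0)" for z
  have ne: "norm (e z) \<le> 1" for z by (auto simp: e_def norm_Pair)
  have em: "e \<in> borel_measurable borel" unfolding e_def borel_prod[symmetric] by measurable
  have "(\<lambda>x. e (k x)) \<in> periodic_measurable"
    using em Lp_measurable[OF k] by (rule periodic_measurable_compose)
  then have eL: "(\<lambda>x. e (k x)) \<in> Lp 2" using ne by (intro Lp_bounded(1)[where C = 1]) auto
  let ?A = "\<lambda>x. if M < norm (fst (k x)) then 1 else 0 :: real"
  have "k x \<bullet> e (k x) = ?A x * norm (fst (k x))" for x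
    using M by (auto simp: e_def inner_prod_def power2_norm_eq_inner[symmetric] power2_eq_square)
  moreover have "norm (fst (e (k x))) = ?A x" "snd (e (k x)) = 0" for x using M by (auto simp: e_def)
  ultimately have 1: "(LINT x|torus. ?A x * norm (fst (k x))) \<le> M * (LINT x|torus. ?A x)"
    using le[OF eL] by (simp add: split_norm_def Lp1_norm_eq)
  have i1: "integrable torus ?A"
    by (rule torus.integrable_const_bound[where B = 1]) auto
  have i2: "integrable torus (\<lambda>x. ?A x * norm (fst (k x)))"
  proof -
    have "integrable torus (\<lambda>x. norm (fst (k x)))"
      using split_norm_L2(1)[OF k] by (auto simp: Lp1_iff)
    then show ?thesis by (rule Bochner_Integration.integrable_bound) auto
  qed
  have "(LINT x|torus. ?A x * (norm (fst (k x)) - M)) \<le> 0"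
    using 1 i1 i2 by (simp add: right_diff_distrib mult.commute[of M])
  moreover have nn: "AE x in torus. 0 \<le> ?A x * (norm (fst (k x)) - M)" by auto
  ultimately have "(LINT x|torus. ?A x * (norm (fst (k x)) - M)) = 0"
    using integral_nonneg_AE[OF nn] by simp
  moreover have "integrable torus (\<lambda>x. ?A x * (norm (fst (k x)) - M))"
    using i1 i2 by (simp add: right_diff_distrib)
  ultimately have "AE x in torus. ?A x * (norm (fst (k x)) - M) = 0"
    using integral_nonneg_eq_0_iff_AE nn by blast
  then show ?thesis by eventually_elim (auto split: if_splits)
qed

text \<open>The test field |G| G gives equality in Hoelder's inequality: with I the integral of
  |G|^3, the pairing is I and the split norm I^{2/3}, whence I^{1/3} is at most M. Truncating
  \<open>G\<close> at height n makes the test field square integrable and I finite; Fatou removes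
  the truncation.\<close>

lemma dual_bound_L3:
  assumes k: "k \<in> Lp 2" and M: "M \<ge> 0"
    and le: "\<And>c. c \<in> Lp 2 \<Longrightarrow> (LINT x|torus. k x \<bullet> c x) \<le> M * split_norm c"
  shows "(\<lambda>x. snd (k x)) \<in> Lp 3" "Lp_norm 3 (\<lambda>x. snd (k x)) \<le> M"
proof -
  have km: "k \<in> periodic_measurable" using k by (rule Lp_measurable)
  have sm: "(\<lambda>x. snd (k x)) \<in> periodic_measurable" using linear_snd km by (rule periodic_measurable_linear)
  define G where "G n x = (if norm (snd (k x)) \<le> real n then snd (k x) else 0)" for n x
  have Gm: "G n \<in> periodic_measurable" for n
    unfolding G_def
    by (rule periodic_measurable_compose[of "\<lambda>z. if norm (snd z) \<le> real n then snd z else 0", OF _ km])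
      (unfold borel_prod[symmetric], measurable)
  have Gn: "norm (G n x) \<le> real n" for n x by (simp add: G_def)
  have GL: "G n \<in> Lp 3" for n by (rule Lp_bounded(1)[OF _ Gm]) (use Gn in auto)
  have GM: "Lp_norm 3 (G n) \<le> M" for n
  proof -
    define I where "I = (LINT x|torus. norm (G n x) powr 3)"
    let ?c = "\<lambda>x. (0 :: real^3, norm (G n x) *\<^sub>R G n x)"
    have "(\<lambda>x. norm (G n x) *\<^sub>R G n x) \<in> periodic_measurable"
      by (intro periodic_measurable_scaleR Gm periodic_measurable_compose[of norm]) auto
    then have "(\<lambda>x. norm (G n x) *\<^sub>R G n x) \<in> Lp 2"
      by (intro Lp_bounded(1)[where C = "real n * real n"]) (auto intro!: AE_I2 mult_mono Gn)
    then have cL: "?c \<in> Lp 2" by (intro Lp_PairI Lp_zero) auto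
    have "k x \<bullet> ?c x = norm (G n x) powr 3" for x
      by (auto simp: G_def inner_prod_def power3_eq_cube power2_norm_eq_inner[symmetric] power2_eq_square)
    then have "(LINT x|torus. k x \<bullet> ?c x) = I" by (simp add: I_def)
    moreover have "split_norm ?c = I powr (2/3)"
    proof -
      have "(norm (G n x) * norm (G n x)) powr (3/2) = norm (G n x) powr 3" for x
        by (subst powr_mult) (auto simp flip: powr_add)
      then show ?thesis by (simp add: split_norm_def I_def Lp_norm_def)
    qed
    ultimately have *: "I \<le> M * I powr (2/3)" using le[OF cL] by simp
    have L: "Lp_norm 3 (G n) = I powr (1/3)" by (simp add: Lp_norm_def I_def)
    have I0: "I \<ge> 0" by (simp add: I_def)
    show ?thesis
    proof (cases "I = 0")
      case False
      then have "I = I powr (2/3) * I powr (1/3)" using I0 by (simp flip: powr_add)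
      then have "I powr (2/3) * I powr (1/3) \<le> I powr (2/3) * M" using * by (simp add: mult.commute)
      then show ?thesis using False I0 L by simp
    qed (use M L in simp)
  qed
  have "AE x in torus. (\<lambda>n. G n x) \<longlonglongrightarrow> snd (k x)"
  proof (rule AE_I2)
    fix x
    have "\<forall>\<^sub>F n in sequentially. G n x = snd (k x)"
      using eventually_ge_at_top[of "nat \<lceil>norm (snd (k x))\<rceil>"]
      by eventually_elim (auto simp: G_def nat_le_iff ceiling_le_iff)
    then show "(\<lambda>n. G n x) \<longlonglongrightarrow> snd (k x)" by (rule tendsto_eventually)
  qed
  note F = Lp_Fatou[OF _ GL sm this GM tendsto_const]
  show "(\<lambda>x. snd (k x)) \<in> Lp 3" "Lp_norm 3 (\<lambda>x. snd (k x)) \<le> M" by (rule F, simp)+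
qed

text \<open>For a test function \<psi>, the pair \<open>?c\<close> pairs with the jet of any smooth
  field to the integral of the j-th derivative of \<psi> times its i-th component, which is 0. It
  thus represents the zero functional, and that \<open>k\<close> annihilates it is exactly the
  defining identity of a weak derivative.\<close>

lemma dual_weak_gradient:
  assumes k: "k \<in> Lp 2"
    and 0: "\<And>c. c \<in> Lp 2 \<Longrightarrow> represents c (\<lambda>\<Phi>. 0) \<Longrightarrow> (LINT x|torus. k x \<bullet> c x) = 0"
  shows "has_weak_gradient (\<lambda>x. fst (k x)) (\<lambda>x. snd (k x))"
  unfolding has_weak_gradient_def
proof (intro conjI ballI allI)
  have P: "(\<lambda>x. fst (k x)) \<in> Lp 2" "(\<lambda>x. snd (k x)) \<in> Lp 2" using Lp_pair[OF k] by auto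
  then show L: "(\<lambda>x. fst (k x)) \<in> Lp 1" "(\<lambda>x. snd (k x)) \<in> Lp 1"
    using Lp_subset(1)[of 1 2 "\<lambda>x. fst (k x)"] Lp_subset(1)[of 1 2 "\<lambda>x. snd (k x)"] by auto
  fix \<psi> :: "real^3 \<Rightarrow> real" and i j assume \<psi>: "\<psi> \<in> test_functions"
  let ?c = "\<lambda>x. (partial j \<psi> x *\<^sub>R axis i 1, \<psi> x *\<^sub>R axis i (axis j 1)) :: (real^3) \<times> (real^3^3)"
  have lin: "linear (\<lambda>t. t *\<^sub>R a)" for a :: "'a::euclidean_space" by (rule linear_scaleR_left) 
  have cL: "?c \<in> Lp 2"
    by (intro Lp_PairI Lp_linear(1)[OF lin] Linf_subset_Lp(1) test_functions_Linf test_functions_partial \<psi>) auto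
  have "represents ?c (\<lambda>\<Phi>. 0)"
    unfolding represents_def
  proof
    fix \<Phi> :: "real^3 \<Rightarrow> real^3" assume \<Phi>: "\<Phi> \<in> test_functions"
    let ?v = "\<lambda>x. \<psi> x * \<Phi> x $ i"
    have der: "(?v has_derivative (\<lambda>h. \<psi> x * frechet_derivative \<Phi> (at x) h $ i + frechet_derivative \<psi> (at x) h * \<Phi> x $ i)) (at x)" for x
      by (intro has_derivative_mult test_functions_derivative[OF \<psi>]
          bounded_linear.has_derivative[OF bounded_linear_vec_nth] test_functions_derivative[OF \<Phi>])
    have p: "partial j ?v = (\<lambda>x. \<psi> x * partial j \<Phi> x $ i + partial j \<psi> x * \<Phi> x $ i)"
      using partial_eqI[OF der] by (auto simp: partial_def)
    have "(LINT x|torus. partial j ?v x) = 0"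
    proof (rule integral_partial_eq_0)
      show "periodic ?v" using test_functions_periodic[OF \<psi>] test_functions_periodic[OF \<Phi>] by (simp add: periodic_def)
      show "?v differentiable (at x)" for x using der by (auto simp: differentiable_def)
      show "continuous_on UNIV (partial j ?v)"
        unfolding p by (intro continuous_intros test_functions_continuous test_functions_partial \<psi> \<Phi>)
    qed
    moreover have "?c x \<bullet> jet \<Phi> x = partial j ?v x" for x
      unfolding p by (simp add: jet_def inner_axis' jacobian_nth)
    ultimately show "0 = (LINT x|torus. ?c x \<bullet> jet \<Phi> x)" by simp
  qed
  from 0[OF cL this] have "(LINT x|torus. k x \<bullet> ?c x) = 0" .
  moreover have "k x \<bullet> ?c x = fst (k x) $ i * partial j \<psi> x + snd (k x) $ i $ j * \<psi> x" for x
    by (simp add: inner_prod_def inner_axis mult.commute)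
  moreover have "integrable torus (\<lambda>x. fst (k x) $ i * partial j \<psi> x)" "integrable torus (\<lambda>x. snd (k x) $ i $ j * \<psi> x)"
    using L \<psi> by (auto simp: Lp1_iff intro!: integrable_mult_Linf integrable_vec_nth test_functions_Linf test_functions_partial)
  ultimately show "(LINT x|torus. fst (k x) $ i * partial j \<psi> x) = - (LINT x|torus. snd (k x) $ i $ j * \<psi> x)"
    by simp
qed

text \<open>The factor 4 is twice the factor 2 of \<open>dual_potential\<close>, once for each
  summand of \<open>X_norm\<close>. The case of norm 0 is separate because the critical radius there
  is the reciprocal of \<beta> times the norm of f.\<close>

lemma curl_solvable:
  assumes \<beta>: "\<beta> > 0" "bourgain_brezis \<beta>" and f: "f \<in> Lp_sharp 3"
  obtains U where "U \<in> Linf \<inter> W13" "AE x in torus. weak_curl U x = f x" "X_norm U \<le> 4 * \<beta> * Lp_norm 3 f"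
proof (cases "Lp_norm 3 f = 0")
  case True
  have fL: "f \<in> Lp 3" using f by (simp add: Lp_sharp_def)
  show ?thesis
  proof (rule that[OF X_zero(1)])
    have "AE x in torus. f x = 0" using True fL Lp_norm_eq_0_iff[of 3 f] by simp
    moreover have "AE x in torus. weak_curl (\<lambda>x. 0) x = curl_of_gradient 0"
      by (rule weak_curl_eq[OF has_weak_gradient_zero]) simp
    ultimately show "AE x in torus. weak_curl (\<lambda>x. 0) x = f x"
      by eventually_elim (simp add: curl_of_gradient_simps)
    show "X_norm (\<lambda>x. 0) \<le> 4 * \<beta> * Lp_norm 3 f" using True by (simp add: X_zero)
  qed
next
  case False
  let ?M = "2 * \<beta> * Lp_norm 3 f"
  have N: "Lp_norm 3 f > 0" using False Lp_norm_nonneg[of 3 f] by linarith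
  have M: "?M \<ge> 0" using \<beta> N by simp
  obtain k where k: "k \<in> Lp 2"
    and kg: "\<And>g c. g \<in> Lp_sharp 3 \<Longrightarrow> c \<in> Lp 2 \<Longrightarrow> represents c (distr_curl g) \<Longrightarrow>
      (LINT x|torus. k x \<bullet> c x) = (LINT x|torus. f x \<bullet> g x)"
    and kb: "\<And>c. c \<in> Lp 2 \<Longrightarrow> (LINT x|torus. k x \<bullet> c x) \<le> ?M * split_norm c"
    using dual_potential[OF \<beta> f N] by blast
  let ?U = "\<lambda>x. fst (k x)" and ?G = "\<lambda>x. snd (k x)"
  let ?C = "\<lambda>x. curl_of_gradient (?G x)"
  \<comment> \<open>With g = 0 the identity \<open>kg\<close> says that \<open>k\<close> annihilates
    all representations of the zero functional, which is what makes \<open>?G\<close> the gradient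
    of \<open>?U\<close>.\<close>
  have z: "(\<lambda>x. 0) \<in> Lp_sharp 3" "distr_curl (\<lambda>x. 0) = (\<lambda>\<Phi>. 0)"
    by (auto simp: Lp_sharp_def div_free_def distr_curl_def)
  have w: "has_weak_gradient ?U ?G"
    using kg[OF z(1)] by (intro dual_weak_gradient k) (simp add: z(2))
  have G: "?G \<in> Lp 3" "Lp_norm 3 ?G \<le> ?M"
    by (rule dual_bound_L3[OF k M], erule kb)+
  have Um: "?U \<in> periodic_measurable" using has_weak_gradient_measurable(1)[OF w] .
  have U: "AE x in torus. norm (?U x) \<le> ?M" by (rule dual_bound_Linf[OF k M], erule kb)
  have UL: "?U \<in> Linf" using Um U by (auto simp: Linf_iff)
  \<comment> \<open>The residual f - curl U is itself divergence-free with mean zero, hence an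
    admissible \<open>g\<close> in \<open>kg\<close>. This choice shows that it is orthogonal to
    itself.\<close>
  let ?h = "\<lambda>x. 1 *\<^sub>R f x + (-1) *\<^sub>R ?C x"
  have h: "?h \<in> Lp_sharp 3" using f curl_Lp_sharp[OF w G(1)] by (rule Lp_sharp_comb)
  have L2: "f \<in> Lp 2" "?h \<in> Lp 2" "?C \<in> Lp 2"
    using f h curl_of_gradient_Lp(1)[OF G(1)] Lp_subset(1)[of 2 3] by (auto simp: Lp_sharp_def)
  have "(LINT x|torus. k x \<bullet> (0, adjoint curl_of_gradient (?h x))) = (LINT x|torus. f x \<bullet> ?h x)"
    using h represents_curl[of ?h] by (intro kg) (auto simp: Lp_sharp_def)
  then have eq: "(LINT x|torus. ?C x \<bullet> ?h x) = (LINT x|torus. f x \<bullet> ?h x)"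
    by (simp add: inner_prod_def adjoint_clauses[OF linear_curl_of_gradient])
  have "(LINT x|torus. ?h x \<bullet> ?h x) = 1 * (LINT x|torus. ?h x \<bullet> f x) + (-1) * (LINT x|torus. ?h x \<bullet> ?C x)"
    by (rule L2_inner_comb[OF L2(2) L2(1) L2(3)])
  also have "\<dots> = 0" using eq by (simp add: inner_commute)
  finally have "Lp_norm 2 ?h = 0" using L2_norm_sq[of ?h] by simp
  then have "AE x in torus. ?h x = 0" using Lp_norm_eq_0_iff[of 2 ?h] L2(2) by simp
  then have "AE x in torus. weak_curl ?U x = f x"
    using weak_curl_eq[OF w G(1)] by eventually_elim simp
  moreover have "X_norm ?U \<le> 4 * \<beta> * Lp_norm 3 f"
    using Linf_norm_leI[OF Um U] G(2) weak_gradient_eq(3)[OF w G(1)] by (simp add: X_norm_def)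
  moreover have "?U \<in> Linf \<inter> W13" using UL weak_gradient_eq(1)[OF w G(1)] by blast
  ultimately show ?thesis using that by blast
qed

subsection \<open>Existence of minimizers\<close>

lemma X_graph_L2:
  assumes "v \<in> Linf \<inter> W13"
  shows "(\<lambda>x. (v x, weak_gradient v x)) \<in> Lp 2" "Lp_norm 2 (\<lambda>x. (v x, weak_gradient v x)) \<le> X_norm v"
proof -
  have 1: "v \<in> Lp 2" "Lp_norm 2 v \<le> Linf_norm v" using assms Linf_subset_Lp[of v 2] by auto
  have 2: "weak_gradient v \<in> Lp 2" "Lp_norm 2 (weak_gradient v) \<le> Lp_norm 3 (weak_gradient v)"
    using assms W13_weak_gradient(2) Lp_subset[of 2 3 "weak_gradient v"] by auto
  show "(\<lambda>x. (v x, weak_gradient v x)) \<in> Lp 2" using 1 2 by (intro Lp_PairI) auto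
  show "Lp_norm 2 (\<lambda>x. (v x, weak_gradient v x)) \<le> X_norm v"
    using Lp_norm_Pair[OF 1(1) 2(1)] 1 2 by (simp add: X_norm_def)
qed

lemma cube_midpoint_convex:
  fixes a b :: real
  assumes "a \<ge> 0" "b \<ge> 0"
  shows "((1/2) * a + (1/2) * b) ^ 3 \<le> (1/2) * a ^ 3 + (1/2) * b ^ 3"
proof -
  have "(1/2) * a ^ 3 + (1/2) * b ^ 3 - ((1/2) * a + (1/2) * b) ^ 3 = 3/8 * (a + b) * (a - b)\<^sup>2"
    by (simp add: power2_eq_square power3_eq_cube algebra_simps)
  moreover have "\<dots> \<ge> 0" using assms by simp
  ultimately show ?thesis by linarith
qed

lemma residual_Lp:
  assumes "r \<in> Lp 3" "v \<in> W13"
  shows "(\<lambda>x. r x - weak_curl v x) \<in> Lp 3"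
  using assms by (intro Lp_diff weak_curl_Lp) auto

lemma energy_midpoint:
  assumes r: "r \<in> Lp 3" and lam: "lam \<ge> 0" and u: "u \<in> Linf \<inter> W13" and v: "v \<in> Linf \<inter> W13"
    and J: "\<And>w. J w = X_norm w + lam * Lp_norm 3 (\<lambda>x. r x - weak_curl w x) ^ 3"
  shows "J (\<lambda>x. (1/2) *\<^sub>R u x + (1/2) *\<^sub>R v x) \<le> (1/2) * J u + (1/2) * J v"
proof -
  let ?w = "\<lambda>x. (1/2) *\<^sub>R u x + (1/2) *\<^sub>R v x"
  let ?r = "\<lambda>w x. r x - weak_curl w x"
  have rL: "?r u \<in> Lp 3" "?r v \<in> Lp 3" using r u v by (auto intro: residual_Lp)
  have w: "?w \<in> Linf \<inter> W13" using u v by (rule X_comb)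
  have "Lp_norm 3 (?r ?w) = Lp_norm 3 (\<lambda>x. (1/2) *\<^sub>R ?r u x + (1/2) *\<^sub>R ?r v x)"
  proof (rule Lp_cong_AE(2))
    show "?r ?w \<in> periodic_measurable" using residual_Lp[OF r] w by (intro Lp_measurable) auto
    show "(\<lambda>x. (1/2) *\<^sub>R ?r u x + (1/2) *\<^sub>R ?r v x) \<in> Lp 3" using rL by (intro Lp_comb) auto
    have "AE x in torus. weak_curl ?w x = (1/2) *\<^sub>R weak_curl u x + (1/2) *\<^sub>R weak_curl v x"
      using u v by (intro weak_curl_comb) auto
    then show "AE x in torus. ?r ?w x = (1/2) *\<^sub>R ?r u x + (1/2) *\<^sub>R ?r v x"
    proof eventually_elim
      case (elim x)
      have "r x = (1/2) *\<^sub>R r x + (1/2) *\<^sub>R r x" by (simp flip: scaleR_add_left)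
      then show ?case unfolding elim by (simp add: algebra_simps)
    qed
  qed auto
  also have "\<dots> \<le> Lp_norm 3 (\<lambda>x. (1/2) *\<^sub>R ?r u x) + Lp_norm 3 (\<lambda>x. (1/2) *\<^sub>R ?r v x)"
    using rL by (intro Lp_add Lp_scaleR) auto
  also have "\<dots> = (1/2) * Lp_norm 3 (?r u) + (1/2) * Lp_norm 3 (?r v)"
    using Lp_scaleR(2)[OF rL(1), of "1/2"] Lp_scaleR(2)[OF rL(2), of "1/2"] by simp
  finally have "Lp_norm 3 (?r ?w) ^ 3 \<le> ((1/2) * Lp_norm 3 (?r u) + (1/2) * Lp_norm 3 (?r v)) ^ 3"
    by (intro power_mono) auto
  also have "\<dots> \<le> (1/2) * Lp_norm 3 (?r u) ^ 3 + (1/2) * Lp_norm 3 (?r v) ^ 3"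
    by (intro cube_midpoint_convex) auto
  finally have "lam * Lp_norm 3 (?r ?w) ^ 3 \<le> lam * ((1/2) * Lp_norm 3 (?r u) ^ 3 + (1/2) * Lp_norm 3 (?r v) ^ 3)"
    using lam by (rule mult_left_mono)
  moreover have "X_norm ?w \<le> (1/2) * X_norm u + (1/2) * X_norm v"
    using X_comb(2)[OF u v, of "1/2" "1/2"] by simp
  ultimately show ?thesis by (simp add: J algebra_simps)
qed

text \<open>Near minimizers are only bounded in X, which by itself yields no limit. Since the energy
  is midpoint-convex, their pairs with a gradient form shrinking midpoint-convex sets in L^2;
  \<open>L2_nested_convex\<close> selects a sequence converging in norm and almost everywhere, and
  lower semicontinuity makes its limit a minimizer.\<close>

lemma minimizer_exists:
  assumes r: "r \<in> Lp 3" and lam: "lam \<ge> 0"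
  shows "\<exists>v. is_arg_min (\<lambda>v. X_norm v + lam * Lp_norm 3 (\<lambda>x. r x - weak_curl v x) ^ 3) (\<lambda>v. v \<in> Linf \<inter> W13) v"
proof -
  define J where "J v = X_norm v + lam * Lp_norm 3 (\<lambda>x. r x - weak_curl v x) ^ 3" for v
  define m where "m = (INF v\<in>Linf \<inter> W13. J v)"
  have J0: "X_norm v \<le> J v" "0 \<le> J v" for v using lam X_norm_nonneg[of v] by (auto simp: J_def)
  have bdd: "bdd_below (J ` (Linf \<inter> W13))" using J0 by (intro bdd_belowI2[of _ 0])
  have ne: "Linf \<inter> W13 \<noteq> ({} :: (real^3 \<Rightarrow> real^3) set)" using X_zero(1) by blast
  have m_le: "m \<le> J v" if "v \<in> Linf \<inter> W13" for v unfolding m_def using bdd that by (rule cINF_lower)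
  let ?u = "\<lambda>(c :: real^3 \<Rightarrow> (real^3) \<times> (real^3^3)) x. fst (c x)" and ?G = "\<lambda>(c :: real^3 \<Rightarrow> (real^3) \<times> (real^3^3)) x. snd (c x)"
  \<comment> \<open>The second component is any weak gradient, not \<open>weak_gradient\<close>
    itself: the chosen gradient respects midpoints only almost everywhere, while \<open>C n\<close>
    must be closed under the midpoints of actual functions.\<close>
  define C where "C n = {c \<in> Lp 2. ?u c \<in> Linf \<inter> W13 \<and> has_weak_gradient (?u c) (?G c) \<and> ?G c \<in> Lp 3 \<and>
    J (?u c) \<le> m + 1 / real (Suc n)}" for n
  have sub: "C n \<subseteq> Lp 2" for n by (auto simp: C_def)
  have dec: "C (Suc n) \<subseteq> C n" for n
  proof -
    have "1 / real (Suc (Suc n)) \<le> 1 / real (Suc n)" by (simp add: field_simps)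
    then show ?thesis unfolding C_def by fastforce
  qed
  have mid: "(\<lambda>x. (1/2) *\<^sub>R u x + (1/2) *\<^sub>R v x) \<in> C n" if "u \<in> C n" "v \<in> C n" for n u v
  proof -
    let ?c = "\<lambda>x. (1/2) *\<^sub>R u x + (1/2) *\<^sub>R v x"
    have u: "u \<in> Lp 2" "?u u \<in> Linf \<inter> W13" "has_weak_gradient (?u u) (?G u)" "?G u \<in> Lp 3" "J (?u u) \<le> m + 1 / real (Suc n)"
      and v: "v \<in> Lp 2" "?u v \<in> Linf \<inter> W13" "has_weak_gradient (?u v) (?G v)" "?G v \<in> Lp 3" "J (?u v) \<le> m + 1 / real (Suc n)"
      using that unfolding C_def by blast+
    have 1: "?u ?c = (\<lambda>x. (1/2) *\<^sub>R ?u u x + (1/2) *\<^sub>R ?u v x)" "?G ?c = (\<lambda>x. (1/2) *\<^sub>R ?G u x + (1/2) *\<^sub>R ?G v x)"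
      by auto
    show ?thesis
      unfolding C_def
    proof (intro CollectI conjI)
      show "?c \<in> Lp 2" using u v by (intro Lp_comb) auto
      show "?u ?c \<in> Linf \<inter> W13" unfolding 1 using u(2) v(2) by (rule X_comb)
      show "has_weak_gradient (?u ?c) (?G ?c)" unfolding 1 using u(3) v(3) by (rule has_weak_gradient_comb)
      show "?G ?c \<in> Lp 3" unfolding 1 using u(4) v(4) by (intro Lp_comb) auto
      show "J (?u ?c) \<le> m + 1 / real (Suc n)"
        unfolding 1 using energy_midpoint[OF r lam u(2) v(2) J_def] u(5) v(5) by linarith
    qed
  qed
  have bd: "\<exists>u\<in>C n. Lp_norm 2 u \<le> m + 1" for n
  proof -
    have "(INF v\<in>Linf \<inter> W13. J v) < m + 1 / real (Suc n)" by (simp add: m_def)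
    then obtain v where v: "v \<in> Linf \<inter> W13" "J v < m + 1 / real (Suc n)"
      using cINF_less_iff[OF ne bdd] by blast
    have "(\<lambda>x. (v x, weak_gradient v x)) \<in> C n"
      using v X_graph_L2(1)[OF v(1)] W13_weak_gradient[of v] unfolding C_def by auto
    moreover have "1 / real (Suc n) \<le> 1" by simp
    then have "Lp_norm 2 (\<lambda>x. (v x, weak_gradient v x)) \<le> m + 1"
      using X_graph_L2(2)[OF v(1)] J0(1)[of v] v(2) by linarith
    ultimately show ?thesis by blast
  qed
  obtain c h where c: "\<And>n. c n \<in> C n" and h: "h \<in> Lp 2" and lim: "AE x in torus. (\<lambda>n. c n x) \<longlonglongrightarrow> h x"
    and lim2: "(\<lambda>n. Lp_norm 2 (\<lambda>x. c n x - h x)) \<longlonglongrightarrow> 0"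
    by (rule L2_nested_convex[of C "m + 1"]) (rule sub, rule dec, erule (1) mid, rule bd, rule that)
  have cn: "c n \<in> Lp 2" "?u (c n) \<in> Linf \<inter> W13" "has_weak_gradient (?u (c n)) (?G (c n))" "?G (c n) \<in> Lp 3"
    "J (?u (c n)) \<le> m + 1 / real (Suc n)" for n
    using c[of n] unfolding C_def by blast+
  have d: "(\<lambda>x. c n x - h x) \<in> Lp 2" for n using cn(1) h by (intro Lp_diff) auto
  have lim1: "(\<lambda>n. Lp_norm 1 (\<lambda>x. fst (c n x) - fst (h x))) \<longlonglongrightarrow> 0" "(\<lambda>n. Lp_norm 1 (\<lambda>x. snd (c n x) - snd (h x))) \<longlonglongrightarrow> 0"
  proof -
    have "Lp_norm 1 (\<lambda>x. fst (c n x) - fst (h x)) \<le> Lp_norm 2 (\<lambda>x. c n x - h x)"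
      "Lp_norm 1 (\<lambda>x. snd (c n x) - snd (h x)) \<le> Lp_norm 2 (\<lambda>x. c n x - h x)" for n
      using Lp_pair[OF d[of n]] Lp_subset(2)[of 1 2 "\<lambda>x. fst (c n x) - fst (h x)"]
        Lp_subset(2)[of 1 2 "\<lambda>x. snd (c n x) - snd (h x)"] by auto
    then show "(\<lambda>n. Lp_norm 1 (\<lambda>x. fst (c n x) - fst (h x))) \<longlonglongrightarrow> 0" "(\<lambda>n. Lp_norm 1 (\<lambda>x. snd (c n x) - snd (h x))) \<longlonglongrightarrow> 0"
      by (intro Lim_null_comparison[OF always_eventually lim2]; simp)+
  qed
  have hL: "?u h \<in> Lp 1" "?G h \<in> Lp 1"
    using Lp_pair[OF h] Lp_subset(1)[of 1 2 "?u h"] Lp_subset(1)[of 1 2 "?G h"] by auto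
  have w: "has_weak_gradient (?u h) (?G h)"
    by (rule has_weak_gradient_limit[OF cn(3) hL lim1])
  have AE: "AE x in torus. (\<lambda>n. fst (c n x)) \<longlonglongrightarrow> fst (h x)" "AE x in torus. (\<lambda>n. snd (c n x)) \<longlonglongrightarrow> snd (h x)"
  proof -
    show "AE x in torus. (\<lambda>n. fst (c n x)) \<longlonglongrightarrow> fst (h x)"
      using lim by eventually_elim (rule tendsto_fst)
    show "AE x in torus. (\<lambda>n. snd (c n x)) \<longlonglongrightarrow> snd (h x)"
      using lim by eventually_elim (rule tendsto_snd)
  qed
  have cn': "?u (c n) \<in> Linf" for n using cn(2) by blast
  have "(\<lambda>n. m + 1 / real (Suc n)) \<longlonglongrightarrow> m + 0"
    by (intro tendsto_add tendsto_const LIMSEQ_Suc[OF lim_1_over_n])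
  note E = energy_lsc[OF cn' cn(3,4) w AE r lam cn(5)[unfolded J_def] this]
  have "?u h \<in> Linf \<inter> W13" "J (?u h) \<le> m" using E by (simp_all add: J_def)
  then have "is_arg_min J (\<lambda>v. v \<in> Linf \<inter> W13) (?u h)"
    using m_le unfolding is_arg_min_def by force
  then show ?thesis unfolding J_def[abs_def] by blast
qed

section \<open>Completeness of the intersection space\<close>

lemma X_norm_uminus:
  assumes "u \<in> Linf \<inter> W13"
  shows "(\<lambda>x. - u x) \<in> Linf \<inter> W13" "X_norm (\<lambda>x. - u x) \<le> X_norm u"
  using X_comb[OF assms assms, of "-1" 0] by auto

text \<open>The limit is found in L^3, for the fields together with their gradients. The bound in X
  follows from lower semicontinuity applied to v_n - v_{n+k} as k grows, with the partial sums of
  the steps as bounds.\<close>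

lemma X_complete:
  assumes v: "\<And>n. v n \<in> Linf \<inter> W13" and le: "\<And>n. X_norm (\<lambda>x. v (Suc n) x - v n x) \<le> a n" and a: "summable a"
  obtains U where "U \<in> Linf \<inter> W13" "\<And>n. X_norm (\<lambda>x. v n x - U x) \<le> (\<Sum>i. a (i + n))"
proof -
  let ?g = "\<lambda>n. weak_gradient (v n)"
  have vI: "v n \<in> Linf" and vW: "v n \<in> W13" for n using v by auto
  have vL: "v n \<in> Lp 3" for n using Linf_subset_Lp[OF vI] by simp
  note gL = W13_weak_gradient[OF vW]
  define c where "c n x = (v n x, ?g n x)" for n x
  have cL: "c n \<in> Lp 3" for n unfolding c_def using vL gL by (intro Lp_PairI) auto
  have g_diff: "has_weak_gradient (\<lambda>x. v n x - v k x) (\<lambda>x. ?g n x - ?g k x)" "(\<lambda>x. ?g n x - ?g k x) \<in> Lp 3" for n k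
    using has_weak_gradient_comb[OF gL(1)[of n] gL(1)[of k], of 1 "-1"] gL(2) by (auto intro!: Lp_diff)
  have cd: "Lp_norm 3 (\<lambda>x. c (Suc n) x - c n x) \<le> a n" for n
  proof -
    have "Lp_norm 3 (\<lambda>x. (v (Suc n) x - v n x, ?g (Suc n) x - ?g n x)) \<le>
        Lp_norm 3 (\<lambda>x. v (Suc n) x - v n x) + Lp_norm 3 (\<lambda>x. ?g (Suc n) x - ?g n x)"
      using vL gL(2) by (intro Lp_norm_Pair Lp_diff) auto
    also have "Lp_norm 3 (\<lambda>x. v (Suc n) x - v n x) \<le> Linf_norm (\<lambda>x. v (Suc n) x - v n x)"
      using X_diff(1)[OF v v] by (intro Linf_subset_Lp) auto
    also have "Lp_norm 3 (\<lambda>x. ?g (Suc n) x - ?g n x) = Lp_norm 3 (weak_gradient (\<lambda>x. v (Suc n) x - v n x))"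
      using weak_gradient_eq(3)[OF g_diff] by simp
    finally show ?thesis using le[of n] by (simp add: c_def X_norm_def)
  qed
  obtain h where h: "h \<in> Lp 3" "AE x in torus. (\<lambda>n. c n x) \<longlonglongrightarrow> h x"
    "(\<lambda>n. Lp_norm 3 (\<lambda>x. c n x - h x)) \<longlonglongrightarrow> 0"
    by (rule Lp_complete[OF _ cL cd a]) simp_all
  define U where "U x = fst (h x)" for x
  define H where "H x = snd (h x)" for x
  have UL: "U \<in> Lp 1" "H \<in> Lp 1"
    using Lp_pair[OF h(1)] Lp_subset(1)[of 1 3 U] Lp_subset(1)[of 1 3 H] by (auto simp: U_def[abs_def] H_def[abs_def])
  have d: "(\<lambda>x. c n x - h x) \<in> Lp 3" for n using cL h by (intro Lp_diff) auto
  have lim1: "(\<lambda>n. Lp_norm 1 (\<lambda>x. v n x - U x)) \<longlonglongrightarrow> 0" "(\<lambda>n. Lp_norm 1 (\<lambda>x. ?g n x - H x)) \<longlonglongrightarrow> 0"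
  proof -
    have "Lp_norm 1 (\<lambda>x. v n x - U x) \<le> Lp_norm 3 (\<lambda>x. c n x - h x)"
      "Lp_norm 1 (\<lambda>x. ?g n x - H x) \<le> Lp_norm 3 (\<lambda>x. c n x - h x)" for n
      using Lp_pair[OF d[of n]] Lp_subset(2)[of 1 3 "\<lambda>x. v n x - U x"]
        Lp_subset(2)[of 1 3 "\<lambda>x. ?g n x - H x"] by (auto simp: c_def U_def H_def)
    then show "(\<lambda>n. Lp_norm 1 (\<lambda>x. v n x - U x)) \<longlonglongrightarrow> 0" "(\<lambda>n. Lp_norm 1 (\<lambda>x. ?g n x - H x)) \<longlonglongrightarrow> 0"
      by (intro Lim_null_comparison[OF always_eventually h(3)]; simp)+
  qed
  have wU: "has_weak_gradient U H" by (rule has_weak_gradient_limit[OF gL(1) UL lim1])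
  have AE: "AE x in torus. (\<lambda>n. v n x) \<longlonglongrightarrow> U x" "AE x in torus. (\<lambda>n. ?g n x) \<longlonglongrightarrow> H x"
  proof -
    show "AE x in torus. (\<lambda>n. v n x) \<longlonglongrightarrow> U x"
      using h(2) by eventually_elim (drule tendsto_fst, simp add: c_def U_def)
    show "AE x in torus. (\<lambda>n. ?g n x) \<longlonglongrightarrow> H x"
      using h(2) by eventually_elim (drule tendsto_snd, simp add: c_def H_def)
  qed
  have bound: "X_norm (\<lambda>x. v n x - v (n + k) x) \<le> (\<Sum>i<k. a (i + n))" for n k
  proof (induction k)
    case 0
    then show ?case by (simp add: X_zero)
  next
    case (Suc k)
    let ?d = "\<lambda>x. v (Suc (n + k)) x - v (n + k) x"
    have "X_norm (\<lambda>x. v n x - v (n + Suc k) x) = X_norm (\<lambda>x. (v n x - v (n + k) x) + (- ?d x))" by simp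
    also have "\<dots> \<le> X_norm (\<lambda>x. v n x - v (n + k) x) + X_norm (\<lambda>x. - ?d x)"
      by (intro X_add X_norm_uminus X_diff v)
    also have "X_norm (\<lambda>x. - ?d x) \<le> X_norm ?d" by (intro X_norm_uminus X_diff v)
    finally show ?case using Suc le[of "n + k"] by (simp add: add.commute)
  qed
  have main: "(\<lambda>x. v n x - U x) \<in> Linf \<inter> W13" "X_norm (\<lambda>x. v n x - U x) \<le> (\<Sum>i. a (i + n))" for n
  proof -
    have dI: "(\<lambda>x. v n x - v (n + k) x) \<in> Linf" for k using X_diff(1)[OF v v] by blast
    have w: "has_weak_gradient (\<lambda>x. v n x - U x) (\<lambda>x. ?g n x - H x)"
      using has_weak_gradient_comb[OF gL(1)[of n] wU, of 1 "-1"] by simp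
    have shift: "(\<lambda>k. s (n + k)) \<longlonglongrightarrow> l" if "s \<longlonglongrightarrow> l" for s :: "nat \<Rightarrow> 'z::topological_space" and l
      using LIMSEQ_ignore_initial_segment[OF that, of n] by (simp add: add.commute)
    have l1: "AE x in torus. (\<lambda>k. v n x - v (n + k) x) \<longlonglongrightarrow> v n x - U x"
      using AE(1) by eventually_elim (rule tendsto_diff[OF tendsto_const], erule shift)
    have l2: "AE x in torus. (\<lambda>k. ?g n x - ?g (n + k) x) \<longlonglongrightarrow> ?g n x - H x"
      using AE(2) by eventually_elim (rule tendsto_diff[OF tendsto_const], erule shift)
    \<comment> \<open>The vanishing second term gives the bound the form of
      \<open>energy_lsc\<close> with weight 0 and datum 0.\<close>
    have b: "X_norm (\<lambda>x. v n x - v (n + k) x) + 0 * Lp_norm 3 (\<lambda>x. 0 - weak_curl (\<lambda>x. v n x - v (n + k) x) x) ^ 3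
        \<le> (\<Sum>i<k. a (i + n))" for k using bound by simp
    have s: "(\<lambda>k. \<Sum>i<k. a (i + n)) \<longlonglongrightarrow> (\<Sum>i. a (i + n))"
      using a by (intro summable_LIMSEQ) (simp add: summable_iff_shift)
    note E = energy_lsc[OF dI g_diff w l1 l2 Lp_zero(1) order_refl b s]
    show "(\<lambda>x. v n x - U x) \<in> Linf \<inter> W13" "X_norm (\<lambda>x. v n x - U x) \<le> (\<Sum>i. a (i + n))" using E by simp_all
  qed
  have "(\<lambda>x. v 0 x - (v 0 x - U x)) \<in> Linf \<inter> W13" by (rule X_diff(1)[OF v main(1)])
  then have "U \<in> Linf \<inter> W13" by simp
  then show ?thesis using main(2) that by blast
qed

subsection \<open>The hierarchical expansion\<close>

text \<open>\<open>weak_curl\<close> is additive only almost everywhere, so norms of residuals are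
  compared instead of functions. Each step of the expansion thereby becomes a single minimization
  with the current residual as datum.\<close>

lemma residual_add:
  assumes f: "f \<in> Lp 3" and s: "s \<in> Linf \<inter> W13" and v: "v \<in> Linf \<inter> W13"
  shows "Lp_norm 3 (\<lambda>x. f x - weak_curl (\<lambda>y. s y + v y) x) = Lp_norm 3 (\<lambda>x. (f x - weak_curl s x) - weak_curl v x)"
proof (rule Lp_cong_AE(2))
  show "(\<lambda>x. f x - weak_curl (\<lambda>y. s y + v y) x) \<in> periodic_measurable"
    using residual_Lp[OF f] X_add(1)[OF s v] by (intro Lp_measurable) auto
  show "(\<lambda>x. (f x - weak_curl s x) - weak_curl v x) \<in> Lp 3"
    using f s v by (intro residual_Lp) auto
  show "AE x in torus. f x - weak_curl (\<lambda>y. s y + v y) x = (f x - weak_curl s x) - weak_curl v x"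
    using weak_curl_comb[of s v 1 1] s v by (auto elim!: eventually_mono)
qed auto

text \<open>Each minimization depends on the earlier increments only through their sum. Dependent
  choice therefore runs over partial sums, started at 0 by the clause of \<open>P\<close> for
  \<open>n = 0\<close>, and the increments are recovered as differences.\<close>

lemma hierarchical_exists:
  assumes f: "f \<in> Lp 3" and lam: "lam1 > 0"
  shows "\<exists>u. hierarchical f lam1 u"
proof -
  let ?J = "\<lambda>j s v. X_norm v + lam1 * 2 ^ j * Lp_norm 3 (\<lambda>x. f x - weak_curl (\<lambda>y. s y + v y) x) ^ 3"
  define P where "P n s \<longleftrightarrow> s \<in> Linf \<inter> W13 \<and> (n = 0 \<longrightarrow> s = (\<lambda>x. 0))" for n :: nat and s :: "real^3 \<Rightarrow> real^3"
  define Q where "Q j s s' \<longleftrightarrow> is_arg_min (?J j s) (\<lambda>v. v \<in> Linf \<inter> W13) (\<lambda>x. s' x - s x)" for j s s'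
  have "\<exists>S. \<forall>n. P n (S n) \<and> Q n (S n) (S (Suc n))"
  proof (rule dependent_nat_choice)
    show "\<exists>s. P 0 s" unfolding P_def using X_zero(1) by blast
    fix s n assume "P n s"
    then have s: "s \<in> Linf \<inter> W13" by (simp add: P_def)
    have "(\<lambda>x. f x - weak_curl s x) \<in> Lp 3" using f s by (intro residual_Lp) auto
    moreover have "lam1 * 2 ^ n \<ge> 0" using lam by simp
    ultimately obtain v where v: "is_arg_min (\<lambda>v. X_norm v + lam1 * 2 ^ n *
        Lp_norm 3 (\<lambda>x. (f x - weak_curl s x) - weak_curl v x) ^ 3) (\<lambda>v. v \<in> Linf \<inter> W13) v"
      using minimizer_exists by blast
    then have vX: "v \<in> Linf \<inter> W13" by (simp add: is_arg_min_def)
    have "is_arg_min (?J n s) (\<lambda>v. v \<in> Linf \<inter> W13) v"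
      using v residual_add[OF f s] unfolding is_arg_min_def by auto
    then have "Q n s (\<lambda>x. s x + v x)" by (simp add: Q_def)
    moreover have "P (Suc n) (\<lambda>x. s x + v x)" using X_add(1)[OF s vX] by (simp add: P_def)
    ultimately show "\<exists>s'. P (Suc n) s' \<and> Q n s s'" by blast
  qed
  then obtain S where S: "\<And>n. P n (S n)" "\<And>n. Q n (S n) (S (Suc n))" by blast
  define u where "u k x = S k x - S (k - 1) x" for k x
  have "(\<Sum>k=1..j. u k y) = S j y" for j y
    unfolding u_def using sum_telescope''[of 0 j "\<lambda>k. S k y"] S(1)[of 0] by (simp add: P_def)
  moreover have "u (Suc j) = (\<lambda>x. S (Suc j) x - S j x)" for j by (simp add: u_def[abs_def])
  ultimately have "hierarchical f lam1 u" using S(2) by (simp add: hierarchical_def Q_def)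
  then show ?thesis by blast
qed

lemma hierarchical_converges:
  assumes \<gamma>: "\<gamma> > 0"
    and solve: "\<And>g. g \<in> Lp_sharp 3 \<Longrightarrow>
      \<exists>h \<in> Linf \<inter> W13. (AE x in torus. weak_curl h x = g x) \<and> X_norm h \<le> \<gamma> * Lp_norm 3 g"
    and f: "f \<in> Lp_sharp 3" and lam: "lam1 > 0" "\<gamma> \<le> lam1 * (Lp_norm 3 f)\<^sup>2 \<or> Lp_norm 3 f = 0"
    and u: "hierarchical f lam1 u"
  shows "\<exists>U \<in> Linf \<inter> W13. series_converges_to u U \<and> (AE x in torus. weak_curl U x = f x) \<and>
    X_norm U \<le> 16 / 3 * \<gamma> * Lp_norm 3 f"
proof -
  let ?N = "Lp_norm 3 f"
  have fL: "f \<in> Lp 3" using f by (simp add: Lp_sharp_def)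
  define S where "S j y = (\<Sum>k=1..j. u k y)" for j y
  define J where "J j v = X_norm v + lam1 * 2 ^ j * Lp_norm 3 (\<lambda>x. f x - weak_curl (\<lambda>y. S j y + v y) x) ^ 3" for j v
  have uX: "u (Suc j) \<in> Linf \<inter> W13" and uJ: "\<And>v. v \<in> Linf \<inter> W13 \<Longrightarrow> J j (u (Suc j)) \<le> J j v" for j
    using u unfolding hierarchical_def is_arg_min_def J_def S_def by (auto simp: not_less)
  have S0: "S 0 = (\<lambda>x. 0)" by (simp add: S_def[abs_def])
  have SSuc: "S (Suc j) = (\<lambda>y. S j y + u (Suc j) y)" for j by (simp add: S_def[abs_def])
  have SX: "S j \<in> Linf \<inter> W13" for j
  proof (induction j)
    case 0
    show ?case unfolding S0 by (rule X_zero)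
  next
    case (Suc j)
    show ?case unfolding SSuc using Suc uX by (rule X_add)
  qed
  have SW: "S j \<in> W13" for j using SX by blast
  define r where "r j x = f x - weak_curl (S j) x" for j x
  define \<rho> where "\<rho> j = Lp_norm 3 (r j)" for j
  have rL: "r j \<in> Lp_sharp 3" for j
    using Lp_sharp_comb[OF f weak_curl_Lp_sharp[OF SW], of 1 "-1" j] by (simp add: r_def[abs_def])
  have \<rho>0: "\<rho> j \<ge> 0" for j by (simp add: \<rho>_def)
  \<comment> \<open>These \<open>h\<close> are the competitors of both comparisons: for index j in
    \<open>step1\<close>, and for \<open>Suc j\<close>, added to \<open>u (Suc j)\<close>, in
    \<open>step2\<close>. In either case the residual term of the energy vanishes. The weight
    \<open>lam1 * 2 ^ j\<close> goes with \<open>\<rho> (Suc j)\<close>.\<close>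
  have solved: "\<exists>h \<in> Linf \<inter> W13. X_norm h \<le> \<gamma> * \<rho> j \<and> Lp_norm 3 (\<lambda>x. f x - weak_curl (\<lambda>y. S j y + h y) x) = 0" for j
  proof -
    obtain h where h: "h \<in> Linf \<inter> W13" "AE x in torus. weak_curl h x = r j x" "X_norm h \<le> \<gamma> * Lp_norm 3 (r j)"
      using solve[OF rL] by blast
    have rh: "(\<lambda>x. r j x - weak_curl h x) \<in> Lp 3"
      using rL h by (intro residual_Lp) (auto simp: Lp_sharp_def)
    have "Lp_norm 3 (\<lambda>x. r j x - weak_curl h x) = 0"
      using Lp_norm_eq_0_iff[OF _ rh] h(2) by (auto elim!: eventually_mono)
    then show ?thesis using h residual_add[OF fL SX h(1)] by (auto simp: \<rho>_def r_def)
  qed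
  have Ju: "J j (u (Suc j)) = X_norm (u (Suc j)) + lam1 * 2 ^ j * \<rho> (Suc j) ^ 3" for j
    by (simp add: J_def \<rho>_def r_def[abs_def] SSuc)
  have step1: "X_norm (u (Suc j)) + lam1 * 2 ^ j * \<rho> (Suc j) ^ 3 \<le> \<gamma> * \<rho> j" for j
  proof -
    obtain h where h: "h \<in> Linf \<inter> W13" "X_norm h \<le> \<gamma> * \<rho> j" "Lp_norm 3 (\<lambda>x. f x - weak_curl (\<lambda>y. S j y + h y) x) = 0"
      using solved by blast
    have "J j (u (Suc j)) \<le> J j h" using h(1) by (rule uJ)
    moreover have "J j h = X_norm h" using h(3) by (simp add: J_def)
    ultimately show ?thesis using h(2) Ju[of j] by linarith
  qed
  have step2: "lam1 * 2 ^ j * \<rho> (Suc j) ^ 3 \<le> \<gamma> * \<rho> (Suc j)" for j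
  proof -
    obtain h where h: "h \<in> Linf \<inter> W13" "X_norm h \<le> \<gamma> * \<rho> (Suc j)"
      "Lp_norm 3 (\<lambda>x. f x - weak_curl (\<lambda>y. S (Suc j) y + h y) x) = 0"
      using solved by blast
    let ?v = "\<lambda>x. u (Suc j) x + h x"
    have "J j (u (Suc j)) \<le> J j ?v" by (rule uJ, rule X_add(1)[OF uX h(1)])
    also have "J j ?v = X_norm ?v" using h(3) by (simp add: J_def SSuc add.assoc)
    also have "\<dots> \<le> X_norm (u (Suc j)) + X_norm h" by (rule X_add(2)[OF uX h(1)])
    finally show ?thesis using h(2) Ju by simp
  qed
  \<comment> \<open>The weak curl of the zero field rests on a chosen gradient and is 0 only almost
    everywhere, so \<open>r 0\<close> agrees with \<open>f\<close> up to a null set.\<close>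
  have \<rho>_0: "\<rho> 0 = ?N"
    unfolding \<rho>_def
  proof (rule Lp_cong_AE(2)[OF _ _ fL])
    show "r 0 \<in> periodic_measurable" using rL by (intro Lp_measurable[of _ 3]) (simp add: Lp_sharp_def)
    have "AE x in torus. weak_curl (\<lambda>x. 0) x = curl_of_gradient 0"
      by (rule weak_curl_eq[OF has_weak_gradient_zero]) simp
    then show "AE x in torus. r 0 x = f x"
      unfolding r_def S0 by eventually_elim (simp add: curl_of_gradient_simps)
  qed auto
  \<comment> \<open>Dividing \<open>step2\<close> by the residual and using the lower bound on
    \<open>lam1\<close> gives \<rho>_{i+1} \<le> N 2^{-i/2}. The ratio 3/4 is a rational number
    above the root of 1/2, since 1/2 \<le> 9/16; the factor 4/3 absorbs the shift from i + 1 to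
    i.\<close>
  have decay: "\<rho> j \<le> 4/3 * ?N * (3/4) ^ j" for j
  proof (cases "?N = 0")
    case True
    \<comment> \<open>For N = 0 the lower bound on \<open>lam1\<close> carries no information;
      instead \<open>step1\<close> propagates zero residuals.\<close>
    have "\<rho> j = 0"
    proof (induction j)
      case (Suc j)
      have "lam1 * 2 ^ j * \<rho> (Suc j) ^ 3 \<le> 0" using step1[of j] X_norm_nonneg[of "u (Suc j)"] Suc by simp
      moreover have "0 < lam1 * 2 ^ j" using lam(1) by simp
      ultimately have "\<rho> (Suc j) ^ 3 \<le> 0" by (metis mult_le_0_iff not_less)
      then show ?case using \<rho>0[of "Suc j"] by (simp add: power_le_zero_eq)
    qed (use \<rho>_0 True in simp)
    then show ?thesis using True by simp
  next
    case False
    then have N: "?N > 0" using Lp_norm_nonneg[of 3 f] by linarith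
    show ?thesis
    proof (cases j)
      case 0
      then show ?thesis using \<rho>_0 N by simp
    next
      case (Suc i)
      have "\<rho> (Suc i) \<le> ?N * (3/4) ^ i"
      proof (cases "\<rho> (Suc i) = 0")
        case False
        then have pos: "\<rho> (Suc i) > 0" using \<rho>0[of "Suc i"] by linarith
        have "(lam1 * 2 ^ i * (\<rho> (Suc i))\<^sup>2) * \<rho> (Suc i) \<le> \<gamma> * \<rho> (Suc i)"
          using step2[of i] by (simp add: power3_eq_cube power2_eq_square mult.assoc)
        then have 1: "lam1 * 2 ^ i * (\<rho> (Suc i))\<^sup>2 \<le> \<gamma>" using pos by simp
        also have "\<gamma> \<le> lam1 * ?N\<^sup>2" using lam(2) N by auto
        finally have "lam1 * (2 ^ i * (\<rho> (Suc i))\<^sup>2) \<le> lam1 * ?N\<^sup>2" by (simp add: mult.assoc)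
        then have "2 ^ i * (\<rho> (Suc i))\<^sup>2 \<le> ?N\<^sup>2" using lam(1) by simp
        then have "(\<rho> (Suc i))\<^sup>2 \<le> ?N\<^sup>2 * (1/2) ^ i"
          by (simp add: power_divide field_simps)
        also have "\<dots> \<le> ?N\<^sup>2 * (9/16) ^ i"
          by (intro mult_left_mono power_mono) auto
        also have "\<dots> = (?N * (3/4) ^ i)\<^sup>2"
        proof -
          have "((3/4 :: real) ^ i)\<^sup>2 = (9/16) ^ i"
            by (simp add: power2_eq_square flip: power_mult_distrib)
          then show ?thesis by (simp only: power_mult_distrib)
        qed
        finally show ?thesis by (rule power2_le_imp_le) (use N in simp)
      qed (use N in simp)
      then show ?thesis by (simp add: Suc)
    qed
  qed
  \<comment> \<open>\<gamma> times the decay bound, which dominates the increments by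
    \<open>step1\<close>. The geometric series contributes a factor 4, and 4 times 4/3 is
    16/3.\<close>
  define a where "a j = 4/3 * \<gamma> * ?N * (3/4) ^ j" for j
  have a: "a sums (16/3 * \<gamma> * ?N)"
    using sums_mult[OF geometric_sums[of "3/4 :: real"], of "4/3 * \<gamma> * ?N"] by (simp add: a_def[abs_def] mult.assoc)
  have "X_norm (\<lambda>x. S (Suc j) x - S j x) \<le> a j" for j
  proof -
    have "0 \<le> lam1 * 2 ^ j * \<rho> (Suc j) ^ 3" using lam(1) \<rho>0 by simp
    then have "X_norm (u (Suc j)) \<le> \<gamma> * \<rho> j" using step1[of j] by linarith
    also have "\<dots> \<le> \<gamma> * (4/3 * ?N * (3/4) ^ j)" using decay \<gamma> by (intro mult_left_mono) auto
    finally show ?thesis by (simp add: SSuc a_def algebra_simps)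
  qed
  then obtain U where U: "U \<in> Linf \<inter> W13" "\<And>n. X_norm (\<lambda>x. S n x - U x) \<le> (\<Sum>i. a (i + n))"
    using X_complete[of S a, OF SX _ sums_summable[OF a]] by blast
  have conv: "(\<lambda>n. X_norm (\<lambda>x. S n x - U x)) \<longlonglongrightarrow> 0"
    by (rule tendsto_sandwich[OF _ _ tendsto_const suminf_exist_split2[OF sums_summable[OF a]]])
      (use U(2) X_norm_nonneg in auto)
  have "X_norm U \<le> 16/3 * \<gamma> * ?N"
  proof -
    have "X_norm U = X_norm (\<lambda>x. - (S 0 x - U x))" by (simp add: S0)
    also have "\<dots> \<le> X_norm (\<lambda>x. S 0 x - U x)" by (intro X_norm_uminus X_diff SX U(1))
    also have "\<dots> \<le> 16/3 * \<gamma> * ?N" using U(2)[of 0] sums_unique[OF a] by simp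
    finally show ?thesis .
  qed
  moreover have "AE x in torus. weak_curl U x = f x"
  proof -
    let ?w = "\<lambda>x. f x - weak_curl U x"
    have wL: "?w \<in> Lp 3" using fL U(1) by (intro residual_Lp) auto
    \<comment> \<open>Almost everywhere f - curl U = (f - curl S_n) + curl (S_n - U). The first part
      has norm \<open>\<rho> n\<close>, and the second is controlled by the gradient part of
      \<open>X_norm\<close>.\<close>
    have le: "Lp_norm 3 ?w \<le> \<rho> n + onorm curl_of_gradient * X_norm (\<lambda>x. S n x - U x)" for n
    proof -
      let ?d = "\<lambda>x. S n x - U x"
      have dW: "?d \<in> W13" using X_diff(1)[OF SX U(1)] by blast
      have "Lp_norm 3 ?w = Lp_norm 3 (\<lambda>x. r n x + weak_curl ?d x)"
      proof (rule Lp_cong_AE(2)[OF _ Lp_measurable[OF wL]])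
        show "(\<lambda>x. r n x + weak_curl ?d x) \<in> Lp 3"
          using rL weak_curl_Lp(1)[OF dW] by (intro Lp_add) (auto simp: Lp_sharp_def)
        show "AE x in torus. ?w x = r n x + weak_curl ?d x"
          using weak_curl_comb[of "S n" U 1 "-1", OF SW] U(1) by (auto simp: r_def elim!: eventually_mono)
      qed auto
      also have "\<dots> \<le> \<rho> n + Lp_norm 3 (weak_curl ?d)"
        unfolding \<rho>_def using rL weak_curl_Lp(1)[OF dW] by (intro Lp_add) (auto simp: Lp_sharp_def)
      also have "Lp_norm 3 (weak_curl ?d) \<le> onorm curl_of_gradient * Lp_norm 3 (weak_gradient ?d)"
        by (rule weak_curl_Lp(2)[OF dW])
      also have "\<dots> \<le> onorm curl_of_gradient * X_norm ?d"
        using onorm_pos_le[OF bounded_linear_curl_of_gradient]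
        by (intro mult_left_mono) (auto simp: X_norm_def Linf_norm_nonneg)
      finally show ?thesis by simp
    qed
    have "(\<lambda>j. 4/3 * ?N * (3/4) ^ j) \<longlonglongrightarrow> 4/3 * ?N * 0"
      by (intro tendsto_mult tendsto_const LIMSEQ_power_zero) simp
    then have lim0: "(\<lambda>j. 4/3 * ?N * (3/4) ^ j) \<longlonglongrightarrow> 0" by simp
    have "\<rho> \<longlonglongrightarrow> 0"
      by (rule tendsto_sandwich[OF _ _ tendsto_const lim0]) (use \<rho>0 decay in auto)
    then have "(\<lambda>n. \<rho> n + onorm curl_of_gradient * X_norm (\<lambda>x. S n x - U x)) \<longlonglongrightarrow> 0 + onorm curl_of_gradient * 0"
      by (intro tendsto_add tendsto_mult tendsto_const conv)
    then have "Lp_norm 3 ?w \<le> 0" by (intro LIMSEQ_le_const[where X = "\<lambda>n. \<rho> n + onorm curl_of_gradient * X_norm (\<lambda>x. S n x - U x)"]) (use le in auto)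
    then have "AE x in torus. ?w x = 0" using Lp_norm_eq_0_iff[OF _ wL] Lp_norm_nonneg[of 3 ?w] by simp
    then show ?thesis by eventually_elim simp
  qed
  moreover have "series_converges_to u U" using conv by (simp add: series_converges_to_def S_def)
  ultimately show ?thesis using U(1) by blast
qed

theorem corollary3p1:
  fixes \<beta> :: real
  assumes "\<beta> > 0" and "bourgain_brezis \<beta>"
  shows "\<exists>\<gamma>::real. \<forall>f \<in> Lp_sharp 3.
    \<exists>\<Lambda>>0. \<Lambda> \<ge> \<beta> / 3 * Lp_norm 3 f powi (- 2) \<and>
      (\<forall>lam1\<ge>\<Lambda>.
        (\<exists>u. hierarchical f lam1 u) \<and>
        (\<forall>u. hierarchical f lam1 u \<longrightarrow>
          (\<exists>U \<in> Linf \<inter> W13.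
             series_converges_to u U \<and>
             (AE x in torus. weak_curl U x = f x) \<and>
             X_norm U \<le> \<gamma> * Lp_norm 3 f)))"
proof (rule exI[of _ "16/3 * (4 * \<beta>)"], rule ballI)
  fix f :: "real^3 \<Rightarrow> real^3" assume f: "f \<in> Lp_sharp 3"
  let ?N = "Lp_norm 3 f"
  have fL: "f \<in> Lp 3" using f by (simp add: Lp_sharp_def)
  \<comment> \<open>For N > 0 this is the least value with
    \<open>4 * \<beta> \<le> \<Lambda> * ?N\<^sup>2\<close>, where 4 \<beta> is the constant of the
    right inverse; it exceeds the prescribed threshold with \<beta> / 3. For N = 0 the threshold is
    0, because \<open>0 powi (- 2)\<close> is 0, and any positive value serves.\<close>
  define \<Lambda> where "\<Lambda> = (if ?N = 0 then 1 else 4 * \<beta> * ?N powi (- 2))"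
  have pw: "?N powi (- 2) = 1 / ?N\<^sup>2" by (simp add: power_int_minus inverse_eq_divide)
  have \<Lambda>: "\<Lambda> > 0" "\<Lambda> \<ge> \<beta> / 3 * ?N powi (- 2)"
    using assms(1) by (auto simp: \<Lambda>_def pw divide_simps)
  have solve: "\<exists>h \<in> Linf \<inter> W13. (AE x in torus. weak_curl h x = g x) \<and> X_norm h \<le> 4 * \<beta> * Lp_norm 3 g"
    if "g \<in> Lp_sharp 3" for g
    using curl_solvable[OF assms that] by blast
  have "(\<exists>u. hierarchical f lam1 u) \<and> (\<forall>u. hierarchical f lam1 u \<longrightarrow>
      (\<exists>U \<in> Linf \<inter> W13. series_converges_to u U \<and> (AE x in torus. weak_curl U x = f x) \<and>
        X_norm U \<le> 16/3 * (4 * \<beta>) * ?N))" if lam: "lam1 \<ge> \<Lambda>" for lam1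
  proof (intro conjI allI impI)
    have pos: "lam1 > 0" using \<Lambda>(1) lam by simp
    show "\<exists>u. hierarchical f lam1 u" using fL pos by (rule hierarchical_exists)
    fix u assume u: "hierarchical f lam1 u"
    have "4 * \<beta> \<le> lam1 * ?N\<^sup>2 \<or> ?N = 0"
    proof (cases "?N = 0")
      case False
      then have "4 * \<beta> = \<Lambda> * ?N\<^sup>2" by (simp add: \<Lambda>_def pw)
      also have "\<dots> \<le> lam1 * ?N\<^sup>2" using lam by (intro mult_right_mono) auto
      finally show ?thesis by simp
    qed simp
    then show "\<exists>U \<in> Linf \<inter> W13. series_converges_to u U \<and> (AE x in torus. weak_curl U x = f x) \<and>
        X_norm U \<le> 16/3 * (4 * \<beta>) * ?N"
      using assms(1) solve f pos u by (intro hierarchical_converges) auto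
  qed
  then show "\<exists>\<Lambda>>0. \<Lambda> \<ge> \<beta> / 3 * Lp_norm 3 f powi (- 2) \<and>
      (\<forall>lam1\<ge>\<Lambda>.
        (\<exists>u. hierarchical f lam1 u) \<and>
        (\<forall>u. hierarchical f lam1 u \<longrightarrow>
          (\<exists>U \<in> Linf \<inter> W13.
             series_converges_to u U \<and>
             (AE x in torus. weak_curl U x = f x) \<and>
             X_norm U \<le> 16/3 * (4 * \<beta>) * Lp_norm 3 f)))"
    using \<Lambda> by blast
qed

end
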